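(* Assume that $u_0\in H^1$, $v_0\in H^1_{\mathbb R}$, $\gamma_1\gamma_2>0$, $\Phi_1\in\mathcal L_2(H_{\mathbb R};H^1)$, and $\Phi_2\in\mathcal L_2(H_{\mathbb R};H^1_{\mathbb R})$. Let $(U^n,V^n)_{0\le n\le N}$ be generated by the splitting Crank--Nicolson scheme described in the context. Then for all $n\in\{0,1,\dots,N\}$, $$\mathbb E\Big[\int_{\mathcal O}|U^n(x)|^2dx\Big]=\mathbb E\Big[\int_{\mathcal O}|U^0(x)|^2dx\Big]+\|\Phi_1\|_{\mathcal L_2^0}^2\,t_n,$$ $$\mathbb E\Big[\int_{\mathcal O}V^n(x)\,dx\Big]=\mathbb E\Big[\int_{\mathcal O}V^0(x)\,dx\Big],$$ and $$\mathbb E\Big[\int_{\mathcal O}\Big(\mathrm{Im}\big(U^n\overline{\partial_xU^n}\big)+\frac{\gamma_1}{2\gamma_2}(V^n)^2\Big)dx\Big]=\mathbb E\Big[\int_{\mathcal O}\Big(\mathrm{Im}\big(U^0\overline{\partial_xU^0}\big)+\frac{\gamma_1}{2\gamma_2}(V^0)^2\Big)dx\Big]+\Big(\mathrm{Im}\big(\mathrm{Tr}(\Phi_1^*\partial_x\Phi_1)\big)+\frac{\gamma_1}{2\gamma_2}\|\Phi_2\|_{\mathcal L_2^0}^2\Big)t_n,$$ where $\partial_x\Phi_1:=\partial_x\circ\Phi_1$.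
   Context: $\mathcal O=(0,L)$ with periodic boundary conditions; $\mathbf i=\sqrt{-1}$; $\gamma_1,\gamma_2,\beta\in\mathbb R$. $H=L^2(\mathcal O;\mathbb C)$ with inner product $\langle\phi,\psi\rangle=\int_{\mathcal O}\phi(x)\overline{\psi(x)}\,dx$, $H_{\mathbb R}=L^2(\mathcal O;\mathbb R)$, $H^m=H^m(\mathcal O;\mathbb C)$, $H^m_{\mathbb R}=H^m(\mathcal O;\mathbb R)$, and $\mathcal L_2(U_1;U_2)$ denotes the Hilbert--Schmidt operators from $U_1$ to $U_2$. $W_1,W_2$ are independent cylindrical Wiener processes on $H_{\mathbb R}$: $W_k(t)=\sum_{i=1}^\infty\beta_k^{(i)}(t)e_k^{(i)}$ with independent real standard Brownian motions $\beta_k^{(i)}$ and orthonormal bases $\{e_k^{(i)}\}_{i}$ of $H_{\mathbb R}$, $k=1,2$. Write $\|\Phi_k\|_{\mathcal L_2^0}^2:=\sum_{i=1}^\infty\|\Phi_ke_k^{(i)}\|_{L^2(\mathcal O)}^2$, and $\mathrm{Tr}(\Phi_1^*\partial_x\Phi_1)=\sum_{i=1}^\infty\langle\Phi_1^*\partial_x\Phi_1e_1^{(i)},e_1^{(i)}\rangle=\sum_{i=1}^\infty\langle\partial_x\Phi_1e_1^{(i)},\Phi_1e_1^{(i)}\rangle$. Let $T>0$, $N\in\mathbb N$, $\Delta t=T/N$, $t_n=n\Delta t$, $\Delta W_k^n=W_k(t_{n+1})-W_k(t_n)$. Splitting Crank--Nicolson scheme (for the equation $du=(\mathbf i\partial_x^2u-\mathbf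 i(\gamma_1v+\beta|u|^2)u)dt+\Phi_1dW_1$, $dv=(-\partial_x^3v+\gamma_2\partial_x|u|^2-v\partial_xv)dt+\Phi_2dW_2$ with periodic boundary conditions and initial value $(u_0,v_0)$): $(U^0,V^0)=(u_0,v_0)$, and given $(U^n,V^n)$, intermediate variables $(\widetilde U^{n+1},\widetilde V^{n+1})$ (with $\widetilde U^{n+1}$ complex-valued and $\widetilde V^{n+1}$ real-valued, $L$-periodic) are determined implicitly from $(U^n,V^n)$ by $$\frac{\widetilde U^{n+1}-U^n}{\Delta t}=\mathbf i\partial_x^2U^{n+\frac12}-\mathbf i\big(\gamma_1U^{n+\frac12}V^{n+\frac12}+\beta|U^{n+\frac12}|^2U^{n+\frac12}\big),$$ $$\frac{\widetilde V^{n+1}-V^n}{\Delta t}=-\partial_x^3V^{n+\frac12}+\gamma_2\partial_x|U^{n+\frac12}|^2-V^{n+\frac12}\partial_xV^{n+\frac12},$$ where $U^{n+\frac12}=\frac12(U^n+\widetilde U^{n+1})$, $V^{n+\frac12}=\frac12(V^n+\widetilde V^{n+1})$; then $$U^{n+1}=\widetilde U^{n+1}+\Phi_1\Delta W_1^n,\qquad V^{n+1}=\widetilde V^{n+1}+\Phi_2\Delta W_2^n.$$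
   Formalization: In the third identity the term + Im(Tr(Φ1^*∂xΦ1)) is replaced by − Im(Tr(Φ1^*∂xΦ1)); with the stated inner product the printed sign is wrong, e.g. for u0=v0=0, Φ2=0, Φ1 f=<f,e1>exp(2πix/L), N=1. *)

theory Defs
  imports "HOL-Probability.Probability"
begin

section \<open>Periodic Sobolev spaces on $(0,L)$\<close>

text \<open>
  Elements of $L^2(0,L)$ and $H^m(0,L)$ are represented by functions on the real line of which only
  the restriction to $(0,L)$ matters; equality is equality almost everywhere on $(0,L)$.
  The value type is real or complex.
\<close>

abbreviation Om :: "real \<Rightarrow> real measure" where
  "Om L \<equiv> lebesgue_on {0<..<L}"

definition aeq :: "real \<Rightarrow> (real \<Rightarrow> 'a) \<Rightarrow> (real \<Rightarrow> 'a) \<Rightarrow> bool" where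
  "aeq L u v \<longleftrightarrow> (AE x in Om L. u x = v x)"

definition L2 :: "real \<Rightarrow> (real \<Rightarrow> 'a::{banach, second_countable_topology}) set" where
  "L2 L = {u. u \<in> borel_measurable (Om L) \<and> integrable (Om L) (\<lambda>x. (norm (u x))\<^sup>2)}"

definition l2norm :: "real \<Rightarrow> (real \<Rightarrow> 'a::{banach, second_countable_topology}) \<Rightarrow> real" where
  "l2norm L u = sqrt (\<integral>x. (norm (u x))\<^sup>2 \<partial>Om L)"

definition inner_C :: "real \<Rightarrow> (real \<Rightarrow> complex) \<Rightarrow> (real \<Rightarrow> complex) \<Rightarrow> complex" where
  "inner_C L \<phi> \<psi> = (\<integral>x. \<phi> x * cnj (\<psi> x) \<partial>Om L)"

definition inner_R :: "real \<Rightarrow> (real \<Rightarrow> real) \<Rightarrow> (real \<Rightarrow> real) \<Rightarrow> real" where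
  "inner_R L f g = (\<integral>x. f x * g x \<partial>Om L)"

definition periodic_test :: "real \<Rightarrow> (real \<Rightarrow> real) \<Rightarrow> bool" where
  "periodic_test L \<phi> \<longleftrightarrow>
     (\<forall>x. \<phi> (x + L) = \<phi> x) \<and> (\<forall>k x. (deriv ^^ k) \<phi> field_differentiable (at x))"

text \<open>
  The test functions are smooth and L-periodic, not compactly supported in $(0,L)$: this is what
  puts the periodic boundary conditions into the weak derivative. Real test functions suffice
  for complex-valued functions, by linearity.
\<close>

definition has_wderiv ::
    "real \<Rightarrow> nat \<Rightarrow> (real \<Rightarrow> 'a::{banach, second_countable_topology}) \<Rightarrow> (real \<Rightarrow> 'a) \<Rightarrow> bool" where
  "has_wderiv L k u g \<longleftrightarrow> u \<in> L2 L \<and> g \<in> L2 L \<and>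
     (\<forall>\<phi>. periodic_test L \<phi> \<longrightarrow>
        (\<integral>x. (deriv ^^ k) \<phi> x *\<^sub>R u x \<partial>Om L) = (-1) ^ k *\<^sub>R (\<integral>x. \<phi> x *\<^sub>R g x \<partial>Om L))"

text \<open>The weak derivative is unique up to a null set; the operator below picks a representative.\<close>

definition Dx ::
    "real \<Rightarrow> nat \<Rightarrow> (real \<Rightarrow> 'a::{banach, second_countable_topology}) \<Rightarrow> (real \<Rightarrow> 'a)" where
  "Dx L k u = (SOME g. has_wderiv L k u g)"

definition Hm :: "real \<Rightarrow> nat \<Rightarrow> (real \<Rightarrow> 'a::{banach, second_countable_topology}) set" where
  "Hm L m = {u \<in> L2 L. \<forall>k\<le>m. \<exists>g. has_wderiv L k u g}"

definition h1norm :: "real \<Rightarrow> (real \<Rightarrow> 'a::{banach, second_countable_topology}) \<Rightarrow> real" where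
  "h1norm L u = sqrt ((l2norm L u)\<^sup>2 + (l2norm L (Dx L 1 u))\<^sup>2)"

text \<open>
  The Borel sets of $H^1$; as $H^1$ is separable, they are generated by the open balls.
  Random variables with values in $H^1$ are measurable maps into this space.
\<close>

definition H1_borel :: "real \<Rightarrow> (real \<Rightarrow> 'a::{banach, second_countable_topology}) measure" where
  "H1_borel L = sigma (Hm L 1)
     {{u \<in> Hm L 1. h1norm L (\<lambda>x. u x - f x) < r} | f r. f \<in> Hm L 1}"

section \<open>Orthonormal bases, Hilbert--Schmidt operators, traces\<close>

definition orthonormal_basis :: "real \<Rightarrow> (nat \<Rightarrow> real \<Rightarrow> real) \<Rightarrow> bool" where
  "orthonormal_basis L e \<longleftrightarrow>
     (\<forall>i. e i \<in> L2 L) \<and>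
     (\<forall>i j. inner_R L (e i) (e j) = (if i = j then 1 else 0)) \<and>
     (\<forall>f\<in>L2 L. (\<lambda>n. l2norm L (\<lambda>x. f x - (\<Sum>i<n. inner_R L f (e i) * e i x))) \<longlonglongrightarrow> 0)"

text \<open>
  Hilbert--Schmidt operators from the real $L^2$ to $H^1$ (with real or complex values): bounded
  linear operators with square-summable values on orthonormal bases (the sum does not depend on
  the basis). Compatibility with almost-everywhere equality follows from linearity and boundedness.
\<close>

definition hilbert_schmidt_H1 ::
    "real \<Rightarrow> ((real \<Rightarrow> real) \<Rightarrow> (real \<Rightarrow> 'a::{banach, second_countable_topology})) \<Rightarrow> bool" where
  "hilbert_schmidt_H1 L \<Phi> \<longleftrightarrow>
     (\<forall>f\<in>L2 L. \<Phi> f \<in> Hm L 1) \<and>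
     (\<forall>f\<in>L2 L. \<forall>g\<in>L2 L. aeq L (\<Phi> (\<lambda>x. f x + g x)) (\<lambda>x. \<Phi> f x + \<Phi> g x)) \<and>
     (\<forall>c. \<forall>f\<in>L2 L. aeq L (\<Phi> (\<lambda>x. c * f x)) (\<lambda>x. c *\<^sub>R \<Phi> f x)) \<and>
     (\<exists>C. \<forall>f\<in>L2 L. h1norm L (\<Phi> f) \<le> C * l2norm L f) \<and>
     (\<forall>e. orthonormal_basis L e \<longrightarrow> summable (\<lambda>i. (h1norm L (\<Phi> (e i)))\<^sup>2))"

definition hs_norm_sq ::
    "real \<Rightarrow> (nat \<Rightarrow> real \<Rightarrow> real) \<Rightarrow>
      ((real \<Rightarrow> real) \<Rightarrow> (real \<Rightarrow> 'a::{banach, second_countable_topology})) \<Rightarrow> real" where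
  "hs_norm_sq L e \<Phi> = (\<Sum>i. (l2norm L (\<Phi> (e i)))\<^sup>2)"

text \<open>
  The trace of $\Phi^* A$, with the adjoint moved to the second argument of the inner product:
  $\langle \Phi^* A e_i, e_i\rangle = \langle A e_i, \Phi e_i\rangle$.
\<close>

definition trace_adj ::
    "real \<Rightarrow> (nat \<Rightarrow> real \<Rightarrow> real) \<Rightarrow> ((real \<Rightarrow> real) \<Rightarrow> (real \<Rightarrow> complex)) \<Rightarrow>
      ((real \<Rightarrow> real) \<Rightarrow> (real \<Rightarrow> complex)) \<Rightarrow> complex" where
  "trace_adj L e \<Phi> A = (\<Sum>i. inner_C L (A (e i)) (\<Phi> (e i)))"

text \<open>
  Sign convention: the inner product is conjugate-linear in its second argument, so the imaginary
  part of $\langle \partial_x\phi, \phi\rangle$ is minus the integral of the momentum density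
  $\mathrm{Im}(\phi\,\overline{\partial_x\phi})$. Hence additive noise $\Phi\,dW$ makes the expected
  momentum drift at rate $-\mathrm{Im}\,\mathrm{Tr}(\Phi^*\partial_x\Phi)$.
\<close>

lemma Im_inner_C_Dx:
  assumes "\<phi> \<in> Hm L 1"
  shows "Im (inner_C L (Dx L 1 \<phi>) \<phi>) = - (\<integral>x. Im (\<phi> x * cnj (Dx L 1 \<phi> x)) \<partial>Om L)"
proof -
  have "\<forall>k\<le>1. \<exists>g. has_wderiv L k \<phi> g"
    using assms unfolding Hm_def mem_Collect_eq by (rule conjunct2)
  then have "\<exists>g. has_wderiv L 1 \<phi> g"
    using order_refl by blast
  then have "has_wderiv L 1 \<phi> (Dx L 1 \<phi>)"
    unfolding Dx_def by (rule someI_ex)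
  then have m: "\<phi> \<in> L2 L" "Dx L 1 \<phi> \<in> L2 L"
    unfolding has_wderiv_def by blast+
  then have [measurable]: "\<phi> \<in> borel_measurable (Om L)" "Dx L 1 \<phi> \<in> borel_measurable (Om L)"
    by (auto simp: L2_def)
  have cnj_meas: "(\<lambda>x. cnj (\<phi> x)) \<in> borel_measurable (Om L)"
    by (rule borel_measurable_continuous_on[where f = cnj]) (auto intro: continuous_intros)
  have i: "integrable (Om L) (\<lambda>x. (norm (\<phi> x))\<^sup>2 + (norm (Dx L 1 \<phi> x))\<^sup>2)"
    using m by (auto simp: L2_def)
  have int: "integrable (Om L) (\<lambda>x. Dx L 1 \<phi> x * cnj (\<phi> x))"
  proof (rule Bochner_Integration.integrable_bound[OF i])
    show "(\<lambda>x. Dx L 1 \<phi> x * cnj (\<phi> x)) \<in> borel_measurable (Om L)"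
      by (intro borel_measurable_times cnj_meas) measurable
    show "AE x in Om L. norm (Dx L 1 \<phi> x * cnj (\<phi> x))
        \<le> norm ((norm (\<phi> x))\<^sup>2 + (norm (Dx L 1 \<phi> x))\<^sup>2)"
    proof (rule AE_I2)
      fix x
      have "2 * norm (\<phi> x) * norm (Dx L 1 \<phi> x) \<le> (norm (\<phi> x))\<^sup>2 + (norm (Dx L 1 \<phi> x))\<^sup>2"
        by (rule sum_squares_bound)
      moreover have "0 \<le> norm (\<phi> x) * norm (Dx L 1 \<phi> x)" by (intro mult_nonneg_nonneg norm_ge_zero)
      moreover have "norm (Dx L 1 \<phi> x * cnj (\<phi> x)) = norm (\<phi> x) * norm (Dx L 1 \<phi> x)"
        by (simp only: norm_mult complex_mod_cnj mult.commute)
      ultimately show "norm (Dx L 1 \<phi> x * cnj (\<phi> x))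
          \<le> norm ((norm (\<phi> x))\<^sup>2 + (norm (Dx L 1 \<phi> x))\<^sup>2)"
        unfolding real_norm_def by linarith
    qed
  qed
  have "Im (inner_C L (Dx L 1 \<phi>) \<phi>) = (\<integral>x. Im (Dx L 1 \<phi> x * cnj (\<phi> x)) \<partial>Om L)"
    unfolding inner_C_def by (rule integral_Im[OF int, symmetric])
  also have "\<dots> = (\<integral>x. - Im (\<phi> x * cnj (Dx L 1 \<phi> x)) \<partial>Om L)"
    by (rule arg_cong[where f = "integral\<^sup>L (Om L)"]) (rule ext, simp add: mult.commute)
  also have "\<dots> = - (\<integral>x. Im (\<phi> x * cnj (Dx L 1 \<phi> x)) \<partial>Om L)"
    by (rule Bochner_Integration.integral_minus)
  finally show ?thesis .
qed

section \<open>Cylindrical Wiener processes\<close>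

definition std_brownian_motion :: "'w measure \<Rightarrow> (real \<Rightarrow> 'w \<Rightarrow> real) \<Rightarrow> bool" where
  "std_brownian_motion M B \<longleftrightarrow>
     (\<forall>t\<ge>0. B t \<in> borel_measurable M) \<and>
     (AE \<omega> in M. B 0 \<omega> = 0) \<and>
     (\<forall>s t. 0 \<le> s \<and> s < t \<longrightarrow>
        distributed M lborel (\<lambda>\<omega>. B t \<omega> - B s \<omega>) (normal_density 0 (sqrt (t - s)))) \<and>
     (\<forall>\<tau> :: nat \<Rightarrow> real. 0 \<le> \<tau> 0 \<and> mono \<tau> \<longrightarrow>
        prob_space.indep_vars M (\<lambda>_. borel) (\<lambda>j \<omega>. B (\<tau> (Suc j)) \<omega> - B (\<tau> j) \<omega>) UNIV) \<and>
     (AE \<omega> in M. continuous_on {0..} (\<lambda>t. B t \<omega>))"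

text \<open>
  The series of a cylindrical Wiener process diverges in $L^2$, so the process is given by its
  coordinates: the basis and the independent Brownian motions.
\<close>

definition cylindrical_wiener ::
    "real \<Rightarrow> 'w measure \<Rightarrow> (nat \<Rightarrow> real \<Rightarrow> real) \<Rightarrow> (nat \<Rightarrow> real \<Rightarrow> 'w \<Rightarrow> real) \<Rightarrow> bool" where
  "cylindrical_wiener L M e B \<longleftrightarrow>
     orthonormal_basis L e \<and>
     (\<forall>i. std_brownian_motion M (B i)) \<and>
     prob_space.indep_vars M (\<lambda>_. PiM {0..} (\<lambda>_. borel)) (\<lambda>i \<omega>. \<lambda>t\<in>{0..}. B i t \<omega>) UNIV"

definition indep_wiener ::
    "'w measure \<Rightarrow> (nat \<Rightarrow> real \<Rightarrow> 'w \<Rightarrow> real) \<Rightarrow> (nat \<Rightarrow> real \<Rightarrow> 'w \<Rightarrow> real) \<Rightarrow> bool" where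
  "indep_wiener M B1 B2 \<longleftrightarrow>
     prob_space.indep_var M
       (PiM (UNIV \<times> {0..}) (\<lambda>_. borel)) (\<lambda>\<omega>. \<lambda>(i, t)\<in>UNIV \<times> {0..}. B1 i t \<omega>)
       (PiM (UNIV \<times> {0..}) (\<lambda>_. borel)) (\<lambda>\<omega>. \<lambda>(i, t)\<in>UNIV \<times> {0..}. B2 i t \<omega>)"

text \<open>The filtration generated by both Wiener processes up to time t, augmented by the null sets.\<close>

definition wiener_filtration ::
    "'w measure \<Rightarrow> (nat \<Rightarrow> real \<Rightarrow> 'w \<Rightarrow> real) \<Rightarrow> (nat \<Rightarrow> real \<Rightarrow> 'w \<Rightarrow> real) \<Rightarrow> real \<Rightarrow> 'w measure" where
  "wiener_filtration M B1 B2 t = sigma (space M)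
     ({B i s -` A \<inter> space M | B i s A. B \<in> {B1, B2} \<and> 0 \<le> s \<and> s \<le> t \<and> A \<in> sets borel}
      \<union> null_sets M)"

text \<open>
  X is $\Phi (W(t) - W(s))$, that is, the sum of the series
  $\sum_i (\beta_i(t) - \beta_i(s))\, \Phi e_i$, which converges in $L^2(\Omega; H^1)$.
\<close>

definition wiener_increment ::
    "real \<Rightarrow> 'w measure \<Rightarrow> (nat \<Rightarrow> real \<Rightarrow> real) \<Rightarrow> (nat \<Rightarrow> real \<Rightarrow> 'w \<Rightarrow> real) \<Rightarrow>
      ((real \<Rightarrow> real) \<Rightarrow> (real \<Rightarrow> 'a::{banach, second_countable_topology})) \<Rightarrow>
      real \<Rightarrow> real \<Rightarrow> ('w \<Rightarrow> real \<Rightarrow> 'a) \<Rightarrow> bool" where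
  "wiener_increment L M e B \<Phi> s t X \<longleftrightarrow>
     X \<in> M \<rightarrow>\<^sub>M H1_borel L \<and>
     (\<lambda>m. \<integral>\<^sup>+ \<omega>. ennreal ((h1norm L
        (\<lambda>x. X \<omega> x - (\<Sum>i<m. (B i t \<omega> - B i s \<omega>) *\<^sub>R \<Phi> (e i) x)))\<^sup>2) \<partial>M) \<longlonglongrightarrow> 0"

section \<open>The splitting Crank--Nicolson scheme\<close>

text \<open>
  One deterministic step of length h from $(U,V)$ to $(U',V')$. The midpoints are in $H^2$ and $H^3$,
  so that the derivatives in the scheme exist as weak derivatives in $L^2$; this does not restrict
  the solutions, since for $U, V, U', V'$ in $H^1$ the equations themselves express
  these derivatives by $L^2$ functions.
\<close>

definition CN_step ::
    "real \<Rightarrow> real \<Rightarrow> real \<Rightarrow> real \<Rightarrow> real \<Rightarrow> (real \<Rightarrow> complex) \<Rightarrow> (real \<Rightarrow> real) \<Rightarrow>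
      (real \<Rightarrow> complex) \<Rightarrow> (real \<Rightarrow> real) \<Rightarrow> bool" where
  "CN_step L \<gamma>1 \<gamma>2 \<beta> h U V U' V' \<longleftrightarrow>
     (let Um = (\<lambda>x. (U x + U' x) / 2); Vm = (\<lambda>x. (V x + V' x) / 2) in
       Um \<in> Hm L 2 \<and> Vm \<in> Hm L 3 \<and>
       (AE x in Om L. (U' x - U x) / of_real h =
          \<i> * Dx L 2 Um x
          - \<i> * (of_real \<gamma>1 * Um x * of_real (Vm x) + of_real \<beta> * of_real ((cmod (Um x))\<^sup>2) * Um x)) \<and>
       (AE x in Om L. (V' x - V x) / h =
          - Dx L 3 Vm x + \<gamma>2 * Dx L 1 (\<lambda>y. (cmod (Um y))\<^sup>2) x - Vm x * Dx L 1 Vm x))"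

text \<open>
  The intermediate variables are determined by $(U^n, V^n)$: as random variables they are
  measurable with respect to the information available at time $t_n$.
\<close>

definition splitting_CN_scheme ::
    "real \<Rightarrow> 'w measure \<Rightarrow> real \<Rightarrow> nat \<Rightarrow> real \<Rightarrow> real \<Rightarrow> real \<Rightarrow>
      (nat \<Rightarrow> real \<Rightarrow> real) \<Rightarrow> (nat \<Rightarrow> real \<Rightarrow> 'w \<Rightarrow> real) \<Rightarrow>
      (nat \<Rightarrow> real \<Rightarrow> real) \<Rightarrow> (nat \<Rightarrow> real \<Rightarrow> 'w \<Rightarrow> real) \<Rightarrow>
      ((real \<Rightarrow> real) \<Rightarrow> (real \<Rightarrow> complex)) \<Rightarrow> ((real \<Rightarrow> real) \<Rightarrow> (real \<Rightarrow> real)) \<Rightarrow>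
      (real \<Rightarrow> complex) \<Rightarrow> (real \<Rightarrow> real) \<Rightarrow>
      (nat \<Rightarrow> 'w \<Rightarrow> real \<Rightarrow> complex) \<Rightarrow> (nat \<Rightarrow> 'w \<Rightarrow> real \<Rightarrow> real) \<Rightarrow> bool" where
  "splitting_CN_scheme L M T N \<gamma>1 \<gamma>2 \<beta> e1 B1 e2 B2 \<Phi>1 \<Phi>2 u0 v0 U V \<longleftrightarrow>
     (let h = T / real N; t = (\<lambda>n. real n * h) in
       (\<forall>n\<le>N. U n \<in> M \<rightarrow>\<^sub>M H1_borel L \<and> V n \<in> M \<rightarrow>\<^sub>M H1_borel L) \<and>
       (AE \<omega> in M. aeq L (U 0 \<omega>) u0 \<and> aeq L (V 0 \<omega>) v0) \<and>
       (\<forall>n<N. \<exists>U' V' X1 X2.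
          U' \<in> wiener_filtration M B1 B2 (t n) \<rightarrow>\<^sub>M H1_borel L \<and>
          V' \<in> wiener_filtration M B1 B2 (t n) \<rightarrow>\<^sub>M H1_borel L \<and>
          (AE \<omega> in M. CN_step L \<gamma>1 \<gamma>2 \<beta> h (U n \<omega>) (V n \<omega>) (U' \<omega>) (V' \<omega>)) \<and>
          wiener_increment L M e1 B1 \<Phi>1 (t n) (t (Suc n)) X1 \<and>
          wiener_increment L M e2 B2 \<Phi>2 (t n) (t (Suc n)) X2 \<and>
          (AE \<omega> in M. aeq L (U (Suc n) \<omega>) (\<lambda>x. U' \<omega> x + X1 \<omega> x)) \<and>
          (AE \<omega> in M. aeq L (V (Suc n) \<omega>) (\<lambda>x. V' \<omega> x + X2 \<omega> x))))"

end

theory Submission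
  imports Defs
begin

text \<open>
  Each step of the scheme is a deterministic Crank--Nicolson step followed by an independent Gaussian
  increment. The deterministic step conserves the three functionals path by path, and adding a centred
  increment independent of the past raises the mean of a quadratic functional by its mean value on
  the increment alone. Summing over the steps gives the three identities.

  \<^emph>\<open>Conservation.\<close> Let \<open>u\<close>, \<open>v\<close> be the midpoints, so that the step reads \<open>U' - U = h F\<close>, \<open>V' - V = h G\<close> with
  \<open>F = i u'' - i (\<gamma>1 v + \<beta> |u|\<^sup>2) u\<close> and \<open>G = - v''' + \<gamma>2 (|u|\<^sup>2)' - v v'\<close>. A symmetric form satisfies
  \<open>b(U', U') - b(U, U) = 2 h b(u, F)\<close>, so that a quadratic functional needs to be studied only along the
  vector field at the midpoint, where everything is an integration by parts (\<open>CN_vector_field\<close>,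
  \<open>CN_step_conserved\<close>): \<open>F\<close> is orthogonal to \<open>u\<close>, the momentum of \<open>U\<close> changes by
  \<open>- h \<gamma>1 \<integral> v (|u|\<^sup>2)'\<close>, and the square norm of \<open>V\<close> by \<open>2 h \<gamma>2 \<integral> v (|u|\<^sup>2)'\<close>; the weight \<open>\<gamma>1 / (2 \<gamma>2)\<close> makes
  the last two cancel.

  \<^emph>\<open>Integrability.\<close> The momentum has no sign, so these laws give no moment of the norm of \<open>V\<close>, whereas the
  mixed term of \<open>V'\<close> and the increment has to be integrable. By independence a first moment of the norm
  of \<open>V'\<close> is enough, and it comes from an a priori bound that is linear in the norm of \<open>V\<close> and quadratic
  in that of \<open>U\<close> (\<open>CN_step_bound\<close>). Hence the finiteness of the second moment of \<open>U\<close> and of the first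
  moment of \<open>V\<close> passes from one step to the next.

  \<^emph>\<open>Noise.\<close> The increment is a series with Gaussian coefficients, which are independent of the
  filtration at the beginning of the step (\<open>filtration_indep_increments\<close>). Therefore the mixed terms have
  mean zero (\<open>expectation_cross_term\<close>), and the mean of a quadratic form on the increment is the step size
  times its trace (\<open>expectation_quadratic\<close>): the square of a Hilbert--Schmidt norm for the square norms and, up to
  sign, the imaginary part of the trace of \<open>\<Phi>\<^sup>* \<partial>\<^sub>x \<Phi>\<close> for the momentum.

  \<^emph>\<open>Foundations.\<close> Weak periodic derivatives are handled through absolutely continuous representatives
  (\<open>has_wderiv_periodic_AC\<close>), for which products can be differentiated by Fubini's theorem. The Borel
  sets of the Sobolev space are given by balls; its separability makes continuous functionals of the random
  fields into random variables (\<open>H1_borel_measurable_continuous\<close>).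
\<close>

section \<open>Test functions determine integrable functions\<close>

lemma real_polynomial_function_cis_deriv:
  fixes g :: "complex \<Rightarrow> real"
  assumes "real_polynomial_function g"
  shows "\<exists>g'. real_polynomial_function g' \<and>
    (\<forall>x. ((\<lambda>x. g (cis (w * x))) has_field_derivative g' (cis (w * x))) (at x))"
  using assms
proof induction
  case (linear f)
  have "bounded_linear (\<lambda>z. f (of_real w * \<i> * z))"
    using bounded_linear_compose[OF linear bounded_linear_mult_right[of "of_real w * \<i>"]] by simp
  moreover have "((\<lambda>x. f (cis (w * x))) has_field_derivative f (of_real w * \<i> * cis (w * x))) (at x)" for x
  proof -
    have "((\<lambda>x. cis (w * x)) has_vector_derivative (of_real w * \<i> * cis (w * x))) (at x)"
      unfolding has_vector_derivative_complex_iff by (auto intro!: derivative_eq_intros)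
    from bounded_linear.has_vector_derivative[OF linear this]
    show ?thesis by (simp add: has_real_derivative_iff_has_vector_derivative)
  qed
  ultimately show ?case by blast
next
  case (const c)
  show ?case by (rule exI[of _ "\<lambda>_. 0"]) auto
next
  case (add f g)
  then obtain f' g' where "real_polynomial_function f'" "real_polynomial_function g'"
    "\<And>x. ((\<lambda>x. f (cis (w * x))) has_field_derivative f' (cis (w * x))) (at x)"
    "\<And>x. ((\<lambda>x. g (cis (w * x))) has_field_derivative g' (cis (w * x))) (at x)" by blast
  then show ?case by (intro exI[of _ "\<lambda>z. f' z + g' z"]) (auto intro!: derivative_eq_intros)
next
  case (mult f g)
  then obtain f' g' where *: "real_polynomial_function f'" "real_polynomial_function g'"
    "\<And>x. ((\<lambda>x. f (cis (w * x))) has_field_derivative f' (cis (w * x))) (at x)"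
    "\<And>x. ((\<lambda>x. g (cis (w * x))) has_field_derivative g' (cis (w * x))) (at x)" by blast
  show ?case
  proof (intro exI[of _ "\<lambda>z. f' z * g z + g' z * f z"] conjI allI)
    show "real_polynomial_function (\<lambda>z. f' z * g z + g' z * f z)"
      using * mult by (intro real_polynomial_function.intros(3,4))
    show "((\<lambda>x. f (cis (w * x)) * g (cis (w * x))) has_field_derivative
        f' (cis (w * x)) * g (cis (w * x)) + g' (cis (w * x)) * f (cis (w * x))) (at x)" for x
      by (rule DERIV_mult *)+
  qed
qed

text \<open>Polynomials in \<open>cos (2 \<pi> x / L)\<close> and \<open>sin (2 \<pi> x / L)\<close> are the supply of test functions: they are closed under
  differentiation, hence smooth.\<close>

lemma periodic_test_trig:
  assumes "L > 0" "real_polynomial_function g"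
  shows "periodic_test L (\<lambda>x. g (cis (2 * pi / L * x)))"
  unfolding periodic_test_def
proof (intro conjI allI)
  fix x
  have "2 * pi / L * (x + L) = 2 * pi / L * x + 2 * pi" using assms by (simp add: field_simps)
  then show "g (cis (2 * pi / L * (x + L))) = g (cis (2 * pi / L * x))"
    by (simp add: cis.ctr)
next
  fix k x
  have "\<exists>f. real_polynomial_function f \<and>
      (deriv ^^ k) (\<lambda>x. g (cis (2 * pi / L * x))) = (\<lambda>x. f (cis (2 * pi / L * x)))"
  proof (induction k)
    case 0
    show ?case using assms by auto
  next
    case (Suc k)
    then obtain f where f: "real_polynomial_function f"
      "(deriv ^^ k) (\<lambda>x. g (cis (2 * pi / L * x))) = (\<lambda>x. f (cis (2 * pi / L * x)))" by blast
    obtain f' where f': "real_polynomial_function f'"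
      "\<And>x. ((\<lambda>x. f (cis (2 * pi / L * x))) has_field_derivative f' (cis (2 * pi / L * x))) (at x)"
      using real_polynomial_function_cis_deriv[OF f(1)] by blast
    show ?case using f f' by (intro exI[of _ f']) (auto intro!: DERIV_imp_deriv)
  qed
  then obtain f where f: "real_polynomial_function f"
      "(deriv ^^ k) (\<lambda>x. g (cis (2 * pi / L * x))) = (\<lambda>x. f (cis (2 * pi / L * x)))" by blast
  obtain f' where "\<And>x. ((\<lambda>x. f (cis (2 * pi / L * x))) has_field_derivative f' (cis (2 * pi / L * x))) (at x)"
      using real_polynomial_function_cis_deriv[OF f(1)] by blast
  then show "(deriv ^^ k) (\<lambda>x. g (cis (2 * pi / L * x))) field_differentiable (at x)"
    unfolding f(2) field_differentiable_def by blast
qed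

lemma periodic_test_deriv: "periodic_test L \<phi> \<Longrightarrow> (\<phi> has_field_derivative deriv \<phi> x) (at x)"
  unfolding periodic_test_def using field_differentiable_derivI[of \<phi> x] by (metis funpow_0)

lemma periodic_test_derivI:
  assumes "periodic_test L \<phi>" shows "periodic_test L (deriv \<phi>)"
  unfolding periodic_test_def
proof (intro conjI allI)
  fix x
  have p: "(\<lambda>y. \<phi> (y + L)) = \<phi>" using assms by (auto simp: periodic_test_def)
  have "(\<phi> has_field_derivative deriv \<phi> (x + L)) (at (x + L))" by (rule periodic_test_deriv[OF assms])
  then have "((\<lambda>y. \<phi> (y + L)) has_field_derivative deriv \<phi> (x + L)) (at x)" by (simp add: DERIV_shift)
  then show "deriv \<phi> (x + L) = deriv \<phi> x" unfolding p by (simp add: DERIV_imp_deriv)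
next
  fix k x
  have "(deriv ^^ Suc k) \<phi> field_differentiable at x" using assms unfolding periodic_test_def by blast
  then show "(deriv ^^ k) (deriv \<phi>) field_differentiable at x" by (simp add: funpow_swap1)
qed

lemma periodic_test_continuous: "periodic_test L \<phi> \<Longrightarrow> continuous_on S \<phi>"
  by (meson DERIV_continuous continuous_at_imp_continuous_on periodic_test_deriv)

lemma finite_measure_Om: "finite_measure (Om L)"
  by (rule finite_measureI, cases "L \<ge> 0") (simp_all add: emeasure_restrict_space space_restrict_space)

interpretation Om: finite_measure "Om L" for L by (rule finite_measure_Om)

lemma borel_measurable_continuous_Om:
  fixes f :: "real \<Rightarrow> 'a::topological_space"
  assumes "continuous_on {0<..<L} f" shows "f \<in> borel_measurable (Om L)"
  by (rule continuous_imp_measurable_on_sets_lebesgue[OF assms]) auto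

lemma borel_imp_Om: "f \<in> borel_measurable borel \<Longrightarrow> f \<in> borel_measurable (Om L)"
  by (intro measurable_restrict_space1 measurable_completion) simp

lemma measure_Om: "L \<ge> 0 \<Longrightarrow> measure (Om L) (space (Om L)) = L"
  by (simp add: measure_restrict_space space_restrict_space)

lemma cis_inj_Om:
  assumes "L > 0" "0 < x" "x < L" "0 < y" "y < L" "cis (2 * pi / L * x) = cis (2 * pi / L * y)"
  shows "x = y"
proof -
  have "cis (2 * pi / L * x - 2 * pi / L * y) = 1"
    using assms(6) by (simp flip: cis_divide)
  then have "sin (2 * pi / L * x - 2 * pi / L * y) = 0" "cos (2 * pi / L * x - 2 * pi / L * y) = 1"
    by (auto simp: complex_eq_iff)
  then obtain n :: int where n: "2 * pi / L * x - 2 * pi / L * y = real_of_int n * 2 * pi"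
    using cos_one_2pi_int[of "2 * pi / L * x - 2 * pi / L * y"] by auto
  have "2 * pi / L * x - 2 * pi / L * y = 2 * pi * ((x - y) / L)"
    by (simp add: right_diff_distrib diff_divide_distrib)
  with n have "2 * pi * ((x - y) / L) = 2 * pi * n" by (simp only: mult.commute mult.left_commute)
  then have "(x - y) / L = n" by (simp only: mult_cancel_left) simp
  moreover have "\<bar>(x - y) / L\<bar> < 1" using assms by (auto simp: abs_if field_simps)
  ultimately have "n = 0" by linarith
  then show ?thesis using \<open>(x - y) / L = n\<close> assms by simp
qed

lemma integrable_bounded_scaleR_Om:
  fixes w :: "real \<Rightarrow> 'a::{banach,second_countable_topology}"
  assumes "integrable (Om L) w" "\<phi> \<in> borel_measurable (Om L)" "\<And>x. x \<in> {0<..<L} \<Longrightarrow> \<bar>\<phi> x\<bar> \<le> C"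
  shows "integrable (Om L) (\<lambda>x. \<phi> x *\<^sub>R w x)"
proof (rule Bochner_Integration.integrable_bound[where f="\<lambda>x. C * norm (w x)"])
  show "integrable (Om L) (\<lambda>x. C * norm (w x))" using assms by simp
  show "(\<lambda>x. \<phi> x *\<^sub>R w x) \<in> borel_measurable (Om L)" using assms by measurable
  show "AE x in Om L. norm (\<phi> x *\<^sub>R w x) \<le> norm (C * norm (w x))"
  proof (rule AE_I2)
    fix x assume "x \<in> space (Om L)"
    then have "\<bar>\<phi> x\<bar> \<le> C" using assms by (simp add: space_restrict_space)
    then show "norm (\<phi> x *\<^sub>R w x) \<le> norm (C * norm (w x))"
      by (simp add: abs_mult mult_right_mono)
  qed
qed

lemma periodic_test_bounded:
  assumes "periodic_test L \<phi>" "L > 0"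
  obtains C where "\<And>x. x \<in> {0..L} \<Longrightarrow> \<bar>\<phi> x\<bar> \<le> C"
proof -
  have "compact (\<phi> ` {0..L})"
    by (intro compact_continuous_image periodic_test_continuous[OF assms(1)]) auto
  then have "bounded (\<phi> ` {0..L})" by (rule compact_imp_bounded)
  then obtain C where "\<forall>x\<in>\<phi> ` {0..L}. norm x \<le> C" unfolding bounded_iff by blast
  then show thesis by (intro that[of C]) auto
qed

text \<open>By Stone--Weierstrass, trigonometric polynomials approximate every continuous function on the circle
  uniformly, so \<open>w\<close> is orthogonal to all of these. They in turn converge boundedly to the indicator of any compact
  \<open>K \<subseteq> (0,L)\<close>, and every Lebesgue set is a countable union of compact sets up to a null set. Hence the
  integral of \<open>w\<close> over every measurable set vanishes.\<close>

lemma AE_zero_if_orthogonal_to_tests: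
  fixes w :: "real \<Rightarrow> 'a::euclidean_space"
  assumes L: "L > 0" and w: "integrable (Om L) w"
    and orth: "\<And>\<phi>. periodic_test L \<phi> \<Longrightarrow> (\<integral>x. \<phi> x *\<^sub>R w x \<partial>Om L) = 0"
  shows "AE x in Om L. w x = 0"
proof (rule Om.density_zero[OF w])
  define c where "c x = cis (2 * pi / L * x)" for x
  have c_cont: "continuous_on S c" for S unfolding c_def by (intro continuous_intros)
  note [measurable] = borel_measurable_integrable[OF w]
  have c_meas[measurable]: "c \<in> borel_measurable (Om L)"
    by (rule borel_measurable_continuous_Om[OF c_cont])
  have cont: "(\<integral>x. h (c x) *\<^sub>R w x \<partial>Om L) = 0" if h: "continuous_on UNIV h" for h :: "complex \<Rightarrow> real"
  proof -
    have hm[measurable]: "h \<in> borel_measurable borel" using h by (rule borel_measurable_continuous_onI)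
    have bound: "norm (\<integral>x. h (c x) *\<^sub>R w x \<partial>Om L) \<le> e * (\<integral>x. norm (w x) \<partial>Om L)" if e: "e > 0" for e
    proof -
      obtain g where g: "real_polynomial_function g" "\<And>z. z \<in> sphere 0 1 \<Longrightarrow> \<bar>h z - g z\<bar> < e"
        by (rule Stone_Weierstrass_real_polynomial_function
            [OF compact_sphere[of "0::complex" 1] continuous_on_subset[OF h subset_UNIV] e]) blast
      have pt: "periodic_test L (\<lambda>x. g (c x))" unfolding c_def by (rule periodic_test_trig[OF L g(1)])
      have gm: "(\<lambda>x. g (c x)) \<in> borel_measurable (Om L)"
        by (rule borel_measurable_continuous_Om[OF periodic_test_continuous[OF pt]])
      obtain C where "\<And>x. x \<in> {0..L} \<Longrightarrow> \<bar>g (c x)\<bar> \<le> C" using periodic_test_bounded[OF pt L] by blast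
      then have gi: "integrable (Om L) (\<lambda>x. g (c x) *\<^sub>R w x)"
        by (intro integrable_bounded_scaleR_Om[OF w gm, of C]) auto
      have b: "\<bar>h (c x) - g (c x)\<bar> \<le> e" for x using g(2)[of "c x"] by (simp add: c_def less_imp_le)
      have di: "integrable (Om L) (\<lambda>x. (h (c x) - g (c x)) *\<^sub>R w x)"
        by (rule integrable_bounded_scaleR_Om[OF w _ b]) (use gm in measurable)
      have "(\<integral>x. h (c x) *\<^sub>R w x \<partial>Om L) = (\<integral>x. g (c x) *\<^sub>R w x + (h (c x) - g (c x)) *\<^sub>R w x \<partial>Om L)"
        by (simp add: algebra_simps)
      also have "\<dots> = (\<integral>x. (h (c x) - g (c x)) *\<^sub>R w x \<partial>Om L)"
        using gi di orth[OF pt] by simp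
      finally have "norm (\<integral>x. h (c x) *\<^sub>R w x \<partial>Om L) \<le> (\<integral>x. norm ((h (c x) - g (c x)) *\<^sub>R w x) \<partial>Om L)"
        by (simp only: integral_norm_bound)
      also have "\<dots> \<le> (\<integral>x. e * norm (w x) \<partial>Om L)"
        by (rule integral_mono[OF integrable_norm[OF di]]) (use w b in \<open>auto intro!: mult_right_mono\<close>)
      finally show ?thesis by simp
    qed
    have "norm (\<integral>x. h (c x) *\<^sub>R w x \<partial>Om L) \<le> 0"
    proof (rule field_le_epsilon)
      fix e :: real assume "e > 0"
      define I where "I = (\<integral>x. norm (w x) \<partial>Om L)"
      have "I \<ge> 0" unfolding I_def by simp
      have "norm (\<integral>x. h (c x) *\<^sub>R w x \<partial>Om L) \<le> e / (I + 1) * I"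
        using bound[of "e / (I + 1)"] \<open>e > 0\<close> \<open>I \<ge> 0\<close> by (simp add: I_def[symmetric])
      also have "\<dots> \<le> e" using \<open>I \<ge> 0\<close> \<open>e > 0\<close> by (simp add: field_simps)
      finally show "norm (\<integral>x. h (c x) *\<^sub>R w x \<partial>Om L) \<le> 0 + e" by simp
    qed
    then show ?thesis by simp
  qed
  have cpt: "(\<integral>x. indicator K x *\<^sub>R w x \<partial>Om L) = 0" if K: "compact K" "K \<subseteq> {0<..<L}" for K
  proof (cases "K = {}")
    case False
    \<comment> \<open>continuous functions on the plane that decrease to the indicator of the image of \<open>K\<close> on the circle;
      since \<open>c\<close> is injective on \<open>(0,L)\<close>, pulling back gives the indicator of \<open>K\<close>\<close>
    define h where "h n z = max 0 (1 - real n * infdist z (c ` K))" for n z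
    have cK: "closed (c ` K)" "c ` K \<noteq> {}"
      using K False by (auto intro!: compact_imp_closed compact_continuous_image c_cont)
    have "(\<lambda>n. \<integral>x. h n (c x) *\<^sub>R w x \<partial>Om L) \<longlonglongrightarrow> (\<integral>x. indicator K x *\<^sub>R w x \<partial>Om L)"
    proof (rule integral_dominated_convergence[where w="\<lambda>x. norm (w x)"])
      have hm: "continuous_on UNIV (h n)" for n unfolding h_def by (intro continuous_intros)
      have [measurable]: "h n \<in> borel_measurable borel" for n
        using hm by (rule borel_measurable_continuous_onI)
      show "(\<lambda>x. h n (c x) *\<^sub>R w x) \<in> borel_measurable (Om L)" for n by measurable
      have [measurable]: "K \<in> sets borel" using K by (simp add: compact_imp_closed)
      have [measurable]: "(indicator K :: real \<Rightarrow> real) \<in> borel_measurable (Om L)" by (rule borel_imp_Om) measurable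
      show "(\<lambda>x. indicator K x *\<^sub>R w x) \<in> borel_measurable (Om L)" by measurable
      show "integrable (Om L) (\<lambda>x. norm (w x))" using w by simp
      show "AE x in Om L. norm (h n (c x) *\<^sub>R w x) \<le> norm (w x)" for n
      proof (rule AE_I2)
        fix x
        have "h n (c x) \<le> 1" "0 \<le> h n (c x)" unfolding h_def by (auto simp: infdist_nonneg)
        then show "norm (h n (c x) *\<^sub>R w x) \<le> norm (w x)" by (simp add: mult_left_le_one_le)
      qed
      show "AE x in Om L. (\<lambda>n. h n (c x) *\<^sub>R w x) \<longlonglongrightarrow> indicator K x *\<^sub>R w x"
      proof (rule AE_I2)
        fix x assume "x \<in> space (Om L)"
        then have x: "0 < x" "x < L" by (auto simp: space_restrict_space)
        have "(\<lambda>n. h n (c x)) \<longlonglongrightarrow> indicator K x"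
        proof (cases "x \<in> K")
          case True
          then show ?thesis by (simp add: h_def)
        next
          case nK: False
          have "c x \<notin> c ` K"
          proof
            assume "c x \<in> c ` K"
            then obtain y where "y \<in> K" "c x = c y" by auto
            then have "x = y" using cis_inj_Om[OF L x, of y] K by (auto simp: c_def)
            with \<open>y \<in> K\<close> nK show False by simp
          qed
          then have d: "infdist (c x) (c ` K) > 0" using infdist_pos_not_in_closed[OF cK] by simp
          obtain n0 :: nat where n0: "1 / infdist (c x) (c ` K) \<le> n0" using real_arch_simple by blast
          have "h n (c x) = 0" if "n \<ge> n0" for n
          proof -
            have "1 \<le> n0 * infdist (c x) (c ` K)" using n0 d by (simp add: field_simps)
            also have "\<dots> \<le> n * infdist (c x) (c ` K)" using that d by simp
            finally show ?thesis by (simp add: h_def)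
          qed
          then have "eventually (\<lambda>n. h n (c x) = 0) sequentially" unfolding eventually_sequentially by blast
          then show ?thesis using nK by (simp add: tendsto_eventually)
        qed
        then show "(\<lambda>n. h n (c x) *\<^sub>R w x) \<longlonglongrightarrow> indicator K x *\<^sub>R w x" by (intro tendsto_intros)
      qed
    qed
    moreover have "(\<integral>x. h n (c x) *\<^sub>R w x \<partial>Om L) = 0" for n
      unfolding h_def by (rule cont) (intro continuous_intros)
    ultimately show ?thesis by (simp add: LIMSEQ_const_iff)
  qed simp
  fix A assume "A \<in> sets (Om L)"
  then have A: "A \<subseteq> {0<..<L}" "A \<in> sets lebesgue" by (auto simp: sets_restrict_space)
  obtain C N where CN: "fsigma C" "N \<in> null_sets lebesgue" "C \<union> N = A"
    using lebesgue_set_almost_fsigma[OF A(2)] by metis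
  obtain F :: "nat \<Rightarrow> real set" where F: "range F \<subseteq> Collect compact" "C = \<Union>(range F)"
    using CN(1) fsigma_Union_compact by metis
  define G where "G n = (\<Union>i\<le>n. F i)" for n
  have G: "compact (G n)" "G n \<subseteq> {0<..<L}" for n
    using F CN A by (auto simp: G_def)
  have Nn: "AE x in Om L. x \<notin> N"
    using AE_not_in[OF CN(2)] by (subst AE_restrict_space_iff) (auto elim: eventually_mono)
  have "(\<lambda>n. \<integral>x. indicator (G n) x *\<^sub>R w x \<partial>Om L) \<longlonglongrightarrow> (\<integral>x. indicator A x *\<^sub>R w x \<partial>Om L)"
  proof (rule integral_dominated_convergence[where w="\<lambda>x. norm (w x)"])
    have [measurable]: "(indicator (G n) :: real \<Rightarrow> real) \<in> borel_measurable (Om L)" for n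
      by (rule borel_imp_Om) (use G in \<open>simp add: compact_imp_closed\<close>)
    show "(\<lambda>x. indicator (G n) x *\<^sub>R w x) \<in> borel_measurable (Om L)" for n by measurable
    show "(\<lambda>x. indicator A x *\<^sub>R w x) \<in> borel_measurable (Om L)"
      using \<open>A \<in> sets (Om L)\<close> by measurable
    show "integrable (Om L) (\<lambda>x. norm (w x))" using w by simp
    show "AE x in Om L. norm (indicator (G n) x *\<^sub>R w x) \<le> norm (w x)" for n
      by (rule AE_I2) (simp add: indicator_def)
    show "AE x in Om L. (\<lambda>n. indicator (G n) x *\<^sub>R w x) \<longlonglongrightarrow> indicator A x *\<^sub>R w x"
      using Nn
    proof eventually_elim
      fix x assume x: "x \<notin> N"
      have "eventually (\<lambda>n. (indicator (G n) x :: real) = indicator A x) sequentially"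
      proof (cases "x \<in> A")
        case True
        then obtain i where "x \<in> F i" using x CN F by auto
        then have "x \<in> G n" if "n \<ge> i" for n using that by (auto simp: G_def)
        then show ?thesis using True unfolding eventually_sequentially by (intro exI[of _ i]) auto
      next
        case False
        then have "x \<notin> G n" for n using CN F by (auto simp: G_def)
        then show ?thesis using False by simp
      qed
      then have "eventually (\<lambda>n. indicator (G n) x *\<^sub>R w x = indicator A x *\<^sub>R w x) sequentially"
        by eventually_elim simp
      then show "(\<lambda>n. indicator (G n) x *\<^sub>R w x) \<longlonglongrightarrow> indicator A x *\<^sub>R w x"
        by (rule tendsto_eventually)
    qed
  qed
  then show "set_lebesgue_integral (Om L) A w = 0"
    using cpt[OF G] by (simp add: set_lebesgue_integral_def LIMSEQ_const_iff)
qed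

section \<open>Square-integrable functions\<close>

lemma L2_meas: "u \<in> L2 L \<Longrightarrow> u \<in> borel_measurable (Om L)"
  and L2_norm_sq: "u \<in> L2 L \<Longrightarrow> integrable (Om L) (\<lambda>x. (norm (u x))\<^sup>2)"
  by (auto simp: L2_def)

lemma L2_norm_prod:
  assumes "u \<in> L2 L" "v \<in> L2 L"
  shows "integrable (Om L) (\<lambda>x. norm (u x) * norm (v x))"
proof (rule Bochner_Integration.integrable_bound)
  note [measurable] = assms[THEN L2_meas]
  show "integrable (Om L) (\<lambda>x. (norm (u x))\<^sup>2 + (norm (v x))\<^sup>2)"
    using assms[THEN L2_norm_sq] by simp
  show "(\<lambda>x. norm (u x) * norm (v x)) \<in> borel_measurable (Om L)" by measurable
  show "AE x in Om L. norm (norm (u x) * norm (v x)) \<le> norm ((norm (u x))\<^sup>2 + (norm (v x))\<^sup>2)"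
  proof (rule AE_I2)
    fix x
    have "2 * norm (u x) * norm (v x) \<le> (norm (u x))\<^sup>2 + (norm (v x))\<^sup>2" by (rule sum_squares_bound)
    moreover have "0 \<le> norm (u x) * norm (v x)" by simp
    ultimately show "norm (norm (u x) * norm (v x)) \<le> norm ((norm (u x))\<^sup>2 + (norm (v x))\<^sup>2)"
      unfolding real_norm_def by linarith
  qed
qed

lemma L2_integrable: "u \<in> L2 L \<Longrightarrow> integrable (Om L) u"
  for u :: "real \<Rightarrow> 'a::{banach,second_countable_topology}"
proof (rule Bochner_Integration.integrable_bound[where f="\<lambda>x. norm (u x) * norm (1::real) + (norm (u x))\<^sup>2 + 1"])
  assume u: "u \<in> L2 L"
  show "u \<in> borel_measurable (Om L)" using u by (rule L2_meas)
  have "(\<lambda>_. 1::real) \<in> L2 L" by (simp add: L2_def)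
  from L2_norm_prod[OF u this] L2_norm_sq[OF u]
  show "integrable (Om L) (\<lambda>x. norm (u x) * norm (1::real) + (norm (u x))\<^sup>2 + 1)" by simp
  show "AE x in Om L. norm (u x) \<le> norm (norm (u x) * norm (1::real) + (norm (u x))\<^sup>2 + 1)"
    by (rule AE_I2) (simp add: add_nonneg_nonneg)
qed

lemma L2I_bound:
  fixes u :: "real \<Rightarrow> 'a::{banach,second_countable_topology}"
    and v :: "real \<Rightarrow> 'b::{banach,second_countable_topology}"
  assumes "u \<in> borel_measurable (Om L)" "v \<in> L2 L" "\<And>x. x \<in> {0<..<L} \<Longrightarrow> norm (u x) \<le> C * norm (v x)"
  shows "u \<in> L2 L"
  unfolding L2_def
proof (intro CollectI conjI assms(1))
  note [measurable] = assms(1)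
  show "integrable (Om L) (\<lambda>x. (norm (u x))\<^sup>2)"
  proof (rule Bochner_Integration.integrable_bound[where f="\<lambda>x. C\<^sup>2 * (norm (v x))\<^sup>2"])
    show "integrable (Om L) (\<lambda>x. C\<^sup>2 * (norm (v x))\<^sup>2)" using L2_norm_sq[OF assms(2)] by simp
    show "(\<lambda>x. (norm (u x))\<^sup>2) \<in> borel_measurable (Om L)" by measurable
    show "AE x in Om L. norm ((norm (u x))\<^sup>2) \<le> norm (C\<^sup>2 * (norm (v x))\<^sup>2)"
    proof (rule AE_I2)
      fix x assume "x \<in> space (Om L)"
      then have "norm (u x) \<le> C * norm (v x)" using assms by (simp add: space_restrict_space)
      then have "(norm (u x))\<^sup>2 \<le> (C * norm (v x))\<^sup>2" by (intro power_mono) auto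
      then show "norm ((norm (u x))\<^sup>2) \<le> norm (C\<^sup>2 * (norm (v x))\<^sup>2)" by (simp add: power_mult_distrib)
    qed
  qed
qed

lemma L2_add:
  fixes u :: "real \<Rightarrow> 'a::{banach,second_countable_topology}"
  assumes "u \<in> L2 L" "v \<in> L2 L" shows "(\<lambda>x. u x + v x) \<in> L2 L"
proof (rule L2I_bound[where C=1 and v="\<lambda>x. norm (u x) + norm (v x)"])
  note [measurable] = assms[THEN L2_meas]
  show "(\<lambda>x. u x + v x) \<in> borel_measurable (Om L)" by measurable
  show "(\<lambda>x. norm (u x) + norm (v x)) \<in> L2 L"
    unfolding L2_def using assms[THEN L2_norm_sq] L2_norm_prod[OF assms]
    by (auto simp: power2_sum algebra_simps)
qed (simp add: norm_triangle_ineq)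

lemma L2_bounded_linear:
  fixes u :: "real \<Rightarrow> 'a::{banach,second_countable_topology}"
  assumes T: "bounded_linear T" and "u \<in> L2 L"
  shows "(\<lambda>x. T (u x) :: 'b::{banach,second_countable_topology}) \<in> L2 L"
proof -
  obtain K where K: "\<And>x. norm (T x) \<le> K * norm x"
    using bounded_linear.bounded[OF T] by (metis mult.commute)
  show ?thesis
  proof (rule L2I_bound[OF _ assms(2)])
    have "T \<in> borel_measurable borel"
      by (intro borel_measurable_continuous_onI linear_continuous_on T)
    then show "(\<lambda>x. T (u x)) \<in> borel_measurable (Om L)" using L2_meas[OF assms(2)] by measurable
  qed (rule K)
qed

lemma L2_scaleR: "u \<in> L2 L \<Longrightarrow> (\<lambda>x. c *\<^sub>R u x) \<in> L2 L"
  for u :: "real \<Rightarrow> 'a::{banach,second_countable_topology}"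
  by (rule L2_bounded_linear[OF bounded_linear_scaleR_right])

lemma L2_diff:
  fixes u :: "real \<Rightarrow> 'a::{banach,second_countable_topology}"
  assumes "u \<in> L2 L" "v \<in> L2 L" shows "(\<lambda>x. u x - v x) \<in> L2 L"
  using L2_add[OF assms(1) L2_scaleR[OF assms(2), of "-1"]] by simp

lemma L2_const: "(\<lambda>_. c) \<in> L2 L"
  by (simp add: L2_def)

lemma measurable_bounded_bilinear:
  fixes f :: "_ \<Rightarrow> 'a::euclidean_space" and g :: "_ \<Rightarrow> 'b::euclidean_space"
    and prod :: "'a \<Rightarrow> 'b \<Rightarrow> 'c::euclidean_space"
  assumes "bounded_bilinear prod" and f: "f \<in> borel_measurable M" and g: "g \<in> borel_measurable M"
  shows "(\<lambda>x. prod (f x) (g x)) \<in> borel_measurable M"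
  by (rule borel_measurable_continuous_Pair[OF f g])
    (intro bounded_bilinear.continuous_on[OF assms(1)] continuous_intros)

lemma integrable_bounded_bilinear:
  fixes f :: "_ \<Rightarrow> 'a::euclidean_space" and g :: "_ \<Rightarrow> 'b::euclidean_space"
    and prod :: "'a \<Rightarrow> 'b \<Rightarrow> 'c::euclidean_space"
  assumes b: "bounded_bilinear prod" and f: "f \<in> borel_measurable M" and g: "g \<in> borel_measurable M"
    and i: "integrable M (\<lambda>x. norm (f x) * norm (g x))"
  shows "integrable M (\<lambda>x. prod (f x) (g x))"
proof -
  obtain K where K: "\<And>a b. norm (prod a b) \<le> norm a * norm b * K" "0 < K"
    using bounded_bilinear.pos_bounded[OF b] by blast
  have i': "integrable M (\<lambda>x. norm (f x) * norm (g x) * K)" using i by simp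
  have le: "norm (prod (f x) (g x)) \<le> norm (norm (f x) * norm (g x) * K)" for x
    unfolding real_norm_def by (rule order_trans[OF K(1) abs_ge_self])
  show ?thesis
    by (rule Bochner_Integration.integrable_bound[OF i' measurable_bounded_bilinear[OF b f g] AE_I2[OF le]])
qed

lemma L2_prod_integrable:
  fixes u :: "_ \<Rightarrow> 'a::euclidean_space" and v :: "_ \<Rightarrow> 'b::euclidean_space"
    and prod :: "'a \<Rightarrow> 'b \<Rightarrow> 'c::euclidean_space"
  assumes "bounded_bilinear prod" "u \<in> L2 L" "v \<in> L2 L"
  shows "integrable (Om L) (\<lambda>x. prod (u x) (v x))"
  by (rule integrable_bounded_bilinear[OF assms(1) L2_meas[OF assms(2)] L2_meas[OF assms(3)] L2_norm_prod[OF assms(2,3)]])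

lemma integrable_bounded_prod:
  fixes f :: "_ \<Rightarrow> 'a::euclidean_space" and F :: "_ \<Rightarrow> 'b::euclidean_space"
    and prod :: "'a \<Rightarrow> 'b \<Rightarrow> 'c::euclidean_space"
  assumes "bounded_bilinear prod" and f: "integrable (Om L) f" and F: "F \<in> borel_measurable (Om L)"
    and b: "\<And>x. x \<in> {0<..<L} \<Longrightarrow> norm (F x) \<le> C"
  shows "integrable (Om L) (\<lambda>x. prod (f x) (F x))"
proof (rule integrable_bounded_bilinear[OF assms(1) borel_measurable_integrable[OF f] F])
  have "integrable (Om L) (\<lambda>x. norm (F x) *\<^sub>R norm (f x))"
    using f F b by (intro integrable_bounded_scaleR_Om) auto
  then show "integrable (Om L) (\<lambda>x. norm (f x) * norm (F x))" by (simp add: mult.commute)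
qed

section \<open>Absolutely continuous periodic functions\<close>

lemma id_Om[measurable]: "(\<lambda>x. x) \<in> Om L \<rightarrow>\<^sub>M borel"
  by (rule borel_imp_Om) simp

lemma integrable_indicator_atMost:
  fixes f :: "real \<Rightarrow> 'a::{banach,second_countable_topology}"
  assumes "integrable (Om L) f"
  shows "integrable (Om L) (\<lambda>y. indicator {..x} y *\<^sub>R f y)"
proof (rule integrable_bounded_scaleR_Om[OF assms])
  show "(indicator {..x} :: real \<Rightarrow> real) \<in> borel_measurable (Om L)" by (rule borel_imp_Om) simp
  show "\<bar>indicator {..x} y\<bar> \<le> (1::real)" for y by (simp add: indicator_def)
qed

lemma AE_Om_neq: "AE y in Om L. y \<noteq> z"
proof -
  have "{z} \<in> null_sets lebesgue" by simp
  from AE_not_in[OF this] show ?thesis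
    by (subst AE_restrict_space_iff) (auto elim: eventually_mono)
qed

text \<open>Fubini's theorem on the square \<open>(0,L) \<times> (0,L)\<close>, cut along its diagonal into two triangles: integrating each
  triangle in the order that makes the inner integral an indefinite one is integration by parts for indefinite
  integrals. This avoids differentiating indefinite integrals almost everywhere.\<close>

lemma integral_triangle:
  fixes f :: "real \<Rightarrow> 'a::euclidean_space" and g :: "real \<Rightarrow> 'b::euclidean_space"
    and prod :: "'a \<Rightarrow> 'b \<Rightarrow> 'c::euclidean_space"
  assumes b: "bounded_bilinear prod" and f: "integrable (Om L) f" and g: "integrable (Om L) g"
  shows "(\<integral>y. prod (f y) (\<integral>z. indicator {..y} z *\<^sub>R g z \<partial>Om L) \<partial>Om L)
     + (\<integral>z. prod (\<integral>y. indicator {..z} y *\<^sub>R f y \<partial>Om L) (g z) \<partial>Om L)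
     = prod (\<integral>y. f y \<partial>Om L) (\<integral>z. g z \<partial>Om L)"
proof -
  interpret pair_sigma_finite "Om L" "Om L" by unfold_locales
  interpret b: bounded_bilinear prod by (fact b)
  let ?P = "Om L \<Otimes>\<^sub>M Om L"
  note [measurable] = borel_measurable_integrable[OF f] borel_measurable_integrable[OF g]
  define H where "H p = prod (f (fst p)) (g (snd p))" for p
  have N: "integrable ?P (\<lambda>p. norm (f (fst p)) * norm (g (snd p)))"
    by (rule Fubini_integrable) (use f g in simp_all)
  have H: "integrable ?P H" unfolding H_def
    by (rule integrable_bounded_bilinear[OF b _ _ N]) measurable
  have m: "Measurable.pred ?P (\<lambda>p. snd p \<le> fst p)"
    by measurable
  have A: "integrable ?P (\<lambda>p. indicator {p. snd p \<le> fst p} p *\<^sub>R H p)"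
    by (rule Bochner_Integration.integrable_bound[OF H]) (use H m in \<open>auto simp: indicator_def\<close>)
  have B: "integrable ?P (\<lambda>p. indicator {p. fst p < snd p} p *\<^sub>R H p)"
    by (rule Bochner_Integration.integrable_bound[OF H]) (use H m in \<open>auto simp: indicator_def\<close>)
  have "integral\<^sup>L ?P H = integral\<^sup>L ?P (\<lambda>p. indicator {p. snd p \<le> fst p} p *\<^sub>R H p + indicator {p. fst p < snd p} p *\<^sub>R H p)"
    by (rule Bochner_Integration.integral_cong) (auto simp: indicator_def)
  also have "\<dots> = integral\<^sup>L ?P (\<lambda>p. indicator {p. snd p \<le> fst p} p *\<^sub>R H p)
      + integral\<^sup>L ?P (\<lambda>p. indicator {p. fst p < snd p} p *\<^sub>R H p)"
    by (rule Bochner_Integration.integral_add[OF A B])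
  also have "integral\<^sup>L ?P (\<lambda>p. indicator {p. snd p \<le> fst p} p *\<^sub>R H p)
      = (\<integral>y. prod (f y) (\<integral>z. indicator {..y} z *\<^sub>R g z \<partial>Om L) \<partial>Om L)"
  proof -
    have "(\<integral>z. indicator {p. snd p \<le> fst p} (y, z) *\<^sub>R H (y, z) \<partial>Om L)
        = prod (f y) (\<integral>z. indicator {..y} z *\<^sub>R g z \<partial>Om L)" for y
      unfolding integral_bounded_linear[OF b.bounded_linear_right integrable_indicator_atMost[OF g], symmetric]
      by (rule Bochner_Integration.integral_cong) (auto simp: indicator_def H_def b.zero_right)
    then show ?thesis using integral_fst'[OF A] by simp
  qed
  also have "integral\<^sup>L ?P (\<lambda>p. indicator {p. fst p < snd p} p *\<^sub>R H p)
      = (\<integral>z. prod (\<integral>y. indicator {..z} y *\<^sub>R f y \<partial>Om L) (g z) \<partial>Om L)"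
  proof -
    have "(\<integral>y. indicator {p. fst p < snd p} (y, z) *\<^sub>R H (y, z) \<partial>Om L)
        = prod (\<integral>y. indicator {..z} y *\<^sub>R f y \<partial>Om L) (g z)" for z
    proof -
      have "(\<integral>y. indicator {p. fst p < snd p} (y, z) *\<^sub>R H (y, z) \<partial>Om L)
          = (\<integral>y. prod (indicator {..z} y *\<^sub>R f y) (g z) \<partial>Om L)"
      proof (rule integral_cong_AE)
        have [measurable]: "(indicator {..z} :: real \<Rightarrow> real) \<in> borel_measurable (Om L)"
          "(indicator {..<z} :: real \<Rightarrow> real) \<in> borel_measurable (Om L)"
          by (rule borel_imp_Om, simp)+
        have "(\<lambda>y. indicator {..<z} y *\<^sub>R prod (f y) (g z)) \<in> borel_measurable (Om L)"
          by (intro borel_measurable_scaleR measurable_bounded_bilinear[OF b]) measurable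
        also have "(\<lambda>y. indicator {..<z} y *\<^sub>R prod (f y) (g z)) = (\<lambda>y. indicator {p. fst p < snd p} (y, z) *\<^sub>R H (y, z))"
          by (auto simp: indicator_def H_def)
        finally show "(\<lambda>y. indicator {p. fst p < snd p} (y, z) *\<^sub>R H (y, z)) \<in> borel_measurable (Om L)" .
        show "(\<lambda>y. prod (indicator {..z} y *\<^sub>R f y) (g z)) \<in> borel_measurable (Om L)"
          by (intro measurable_bounded_bilinear[OF b]) measurable
        show "AE y in Om L. indicator {p. fst p < snd p} (y, z) *\<^sub>R H (y, z) = prod (indicator {..z} y *\<^sub>R f y) (g z)"
          using AE_Om_neq[of z L] by eventually_elim (auto simp: indicator_def H_def b.zero_left)
      qed
      then show ?thesis
        unfolding integral_bounded_linear[OF b.bounded_linear_left integrable_indicator_atMost[OF f], symmetric] .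
    qed
    moreover have "(\<lambda>(y, z). indicator {p. fst p < snd p} (y, z) *\<^sub>R H (y, z)) = (\<lambda>p. indicator {p. fst p < snd p} p *\<^sub>R H p)"
      by auto
    ultimately show ?thesis
      using integral_snd[of "\<lambda>y z. indicator {p. fst p < snd p} (y, z) *\<^sub>R H (y, z)"] B by simp
  qed
  also have "integral\<^sup>L ?P H = prod (\<integral>y. f y \<partial>Om L) (\<integral>z. g z \<partial>Om L)"
    using integral_fst'[OF H]
    by (simp add: H_def integral_bounded_linear[OF b.bounded_linear_right g]
        integral_bounded_linear[OF b.bounded_linear_left f])
  finally show ?thesis by simp
qed

text \<open>\<open>F\<close> is absolutely continuous on \<open>[0,L]\<close> with equal end values, and \<open>f\<close> is its almost everywhere derivative. In contrast
  to a weak derivative, \<open>F\<close> is an actual function on the closed interval here, so it can be evaluated and bounded pointwise.\<close>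

definition periodic_AC :: "real \<Rightarrow> (real \<Rightarrow> 'a::euclidean_space) \<Rightarrow> (real \<Rightarrow> 'a) \<Rightarrow> bool" where
  "periodic_AC L F f \<longleftrightarrow> f \<in> L2 L \<and>
     (\<forall>x\<in>{0..L}. F x = F 0 + (\<integral>y. indicator {..x} y *\<^sub>R f y \<partial>Om L)) \<and> F L = F 0"

lemma periodic_AC_eq:
  "periodic_AC L F f \<Longrightarrow> x \<in> {0..L} \<Longrightarrow> F x = F 0 + (\<integral>y. indicator {..x} y *\<^sub>R f y \<partial>Om L)"
  by (simp only: periodic_AC_def)

lemma periodic_AC_L2: "periodic_AC L F f \<Longrightarrow> f \<in> L2 L"
  by (simp add: periodic_AC_def)

lemma indefinite_integral_bound:
  fixes f :: "real \<Rightarrow> 'a::euclidean_space"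
  assumes "integrable (Om L) f"
  shows "norm (\<integral>y. indicator {..x} y *\<^sub>R f y \<partial>Om L) \<le> (\<integral>y. norm (f y) \<partial>Om L)"
proof -
  have "norm (\<integral>y. indicator {..x} y *\<^sub>R f y \<partial>Om L) \<le> (\<integral>y. norm (indicator {..x} y *\<^sub>R f y) \<partial>Om L)"
    by (rule integral_norm_bound)
  also have "\<dots> \<le> (\<integral>y. norm (f y) \<partial>Om L)"
    by (rule integral_mono[OF integrable_norm[OF integrable_indicator_atMost[OF assms]] integrable_norm[OF assms]])
      (auto simp: indicator_def)
  finally show ?thesis .
qed

lemma indefinite_integral_meas:
  fixes f :: "real \<Rightarrow> 'a::euclidean_space"
  assumes "integrable (Om L) f"
  shows "(\<lambda>x. \<integral>y. indicator {..x} y *\<^sub>R f y \<partial>Om L) \<in> borel_measurable (Om L)"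
proof -
  note [measurable] = borel_measurable_integrable[OF assms]
  have "(\<lambda>(x, y). (if y \<le> x then f y else 0)) \<in> borel_measurable (Om L \<Otimes>\<^sub>M Om L)" by measurable
  then have "(\<lambda>x. \<integral>y. (if y \<le> x then f y else 0) \<partial>Om L) \<in> borel_measurable (Om L)"
    by (rule Om.borel_measurable_lebesgue_integral)
  also have "(\<lambda>x. \<integral>y. (if y \<le> x then f y else 0) \<partial>Om L) = (\<lambda>x. \<integral>y. indicator {..x} y *\<^sub>R f y \<partial>Om L)"
    by (intro ext Bochner_Integration.integral_cong) (auto simp: indicator_def)
  finally show ?thesis .
qed

lemma periodic_AC_bounded:
  assumes "periodic_AC L F f"
  obtains C where "\<And>x. x \<in> {0..L} \<Longrightarrow> norm (F x) \<le> C"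
proof (rule that)
  fix x assume "x \<in> {0..L}"
  show "norm (F x) \<le> norm (F 0) + (\<integral>y. norm (f y) \<partial>Om L)"
    unfolding periodic_AC_eq[OF assms \<open>x \<in> {0..L}\<close>]
    using indefinite_integral_bound[OF L2_integrable[OF periodic_AC_L2[OF assms]]]
    by (intro order_trans[OF norm_triangle_ineq] add_mono) auto
qed

lemma periodic_AC_meas:
  assumes "periodic_AC L F f" shows "F \<in> borel_measurable (Om L)"
proof -
  have "(\<lambda>x. F 0 + (\<integral>y. indicator {..x} y *\<^sub>R f y \<partial>Om L)) \<in> borel_measurable (Om L)"
    using indefinite_integral_meas[OF L2_integrable[OF periodic_AC_L2[OF assms]]] by measurable
  also have "?this \<longleftrightarrow> ?thesis"
    by (rule measurable_cong, rule sym, rule periodic_AC_eq[OF assms]) (auto simp: space_restrict_space)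
  finally show ?thesis .
qed

lemma periodic_AC_in_L2:
  assumes "periodic_AC L F f" shows "F \<in> L2 L"
proof -
  obtain C where "\<And>x. x \<in> {0..L} \<Longrightarrow> norm (F x) \<le> C" using periodic_AC_bounded[OF assms] by blast
  then show ?thesis
    by (intro L2I_bound[OF periodic_AC_meas[OF assms] L2_const[of "1::real"], where C=C]) auto
qed

lemma periodic_AC_integral_zero:
  assumes "periodic_AC L F f" "L > 0"
  shows "(\<integral>x. f x \<partial>Om L) = 0"
proof -
  have "(\<integral>y. indicator {..L} y *\<^sub>R f y \<partial>Om L) = (\<integral>x. f x \<partial>Om L)"
    by (rule Bochner_Integration.integral_cong) (auto simp: space_restrict_space)
  moreover have "F L = F 0" using assms(1) by (simp only: periodic_AC_def)
  moreover have "F L = F 0 + (\<integral>y. indicator {..L} y *\<^sub>R f y \<partial>Om L)"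
    by (rule periodic_AC_eq[OF assms(1)]) (use assms(2) in auto)
  ultimately show ?thesis by (metis add_cancel_left_right)
qed

text \<open>The product rule, for an arbitrary bounded bilinear product (multiplication, inner product, scaling), by
  applying \<open>integral_triangle\<close> to the derivatives cut off at \<open>x\<close>. Derivatives stay square-integrable because \<open>F\<close> and \<open>G\<close> are bounded.\<close>

lemma periodic_AC_prod:
  fixes F f :: "real \<Rightarrow> 'a::euclidean_space" and G g :: "real \<Rightarrow> 'b::euclidean_space"
    and prod :: "'a \<Rightarrow> 'b \<Rightarrow> 'c::euclidean_space"
  assumes b: "bounded_bilinear prod" and F: "periodic_AC L F f" and G: "periodic_AC L G g"
  shows "periodic_AC L (\<lambda>x. prod (F x) (G x)) (\<lambda>x. prod (F x) (g x) + prod (f x) (G x))"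
  unfolding periodic_AC_def
proof (intro conjI ballI)
  interpret b: bounded_bilinear prod using b .
  obtain K where K: "\<And>a b. norm (prod a b) \<le> norm a * norm b * K" "0 < K"
    using bounded_bilinear.pos_bounded[OF b] by metis
  note f = periodic_AC_L2[OF F] and g = periodic_AC_L2[OF G]
  note fi = L2_integrable[OF f] and gi = L2_integrable[OF g]
  note [measurable] = periodic_AC_meas[OF F] periodic_AC_meas[OF G] f[THEN L2_meas] g[THEN L2_meas]
  obtain CF where CF: "\<And>x. x \<in> {0..L} \<Longrightarrow> norm (F x) \<le> CF" using periodic_AC_bounded[OF F] by blast
  obtain CG where CG: "\<And>x. x \<in> {0..L} \<Longrightarrow> norm (G x) \<le> CG" using periodic_AC_bounded[OF G] by blast
  show "(\<lambda>x. prod (F x) (g x) + prod (f x) (G x)) \<in> L2 L"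
  proof (rule L2_add)
    show "(\<lambda>x. prod (F x) (g x)) \<in> L2 L"
    proof (rule L2I_bound[OF _ g, of _ "CF * K"])
      show "(\<lambda>x. prod (F x) (g x)) \<in> borel_measurable (Om L)"
        by (rule measurable_bounded_bilinear[OF b]) measurable
      fix x assume "x \<in> {0<..<L}"
      then have "norm (F x) * norm (g x) * K \<le> CF * norm (g x) * K"
        using K CF by (intro mult_right_mono) auto
      then show "norm (prod (F x) (g x)) \<le> CF * K * norm (g x)"
        using order_trans[OF K(1)[of "F x" "g x"]] by (simp only: ac_simps)
    qed
    show "(\<lambda>x. prod (f x) (G x)) \<in> L2 L"
    proof (rule L2I_bound[OF _ f, of _ "CG * K"])
      show "(\<lambda>x. prod (f x) (G x)) \<in> borel_measurable (Om L)"
        by (rule measurable_bounded_bilinear[OF b]) measurable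
      fix x assume "x \<in> {0<..<L}"
      then have "norm (f x) * norm (G x) * K \<le> norm (f x) * CG * K"
        using K CG by (intro mult_right_mono mult_left_mono) auto
      then show "norm (prod (f x) (G x)) \<le> CG * K * norm (f x)"
        using order_trans[OF K(1)[of "f x" "G x"]] by (simp only: ac_simps)
    qed
  qed
  show "prod (F L) (G L) = prod (F 0) (G 0)" using F G by (simp only: periodic_AC_def)
  fix x assume x: "x \<in> {0..L}"
  define fx where "fx y = indicator {..x} y *\<^sub>R f y" for y
  define gx where "gx y = indicator {..x} y *\<^sub>R g y" for y
  have fxi: "integrable (Om L) fx" and gxi: "integrable (Om L) gx"
    unfolding fx_def gx_def by (intro integrable_indicator_atMost fi gi)+
  define If where "If z = (\<integral>y. indicator {..z} y *\<^sub>R fx y \<partial>Om L)" for z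
  define Ig where "Ig z = (\<integral>y. indicator {..z} y *\<^sub>R gx y \<partial>Om L)" for z
  have bf: "bounded_bilinear (\<lambda>x y. prod y x)" by (rule bounded_bilinear.flip[OF b])
  have 1: "integrable (Om L) (\<lambda>y. prod (fx y) (G 0))" "integrable (Om L) (\<lambda>y. prod (F 0) (gx y))"
    by (rule integrable_bounded_linear[OF b.bounded_linear_left fxi] integrable_bounded_linear[OF b.bounded_linear_right gxi])+
  have 2: "integrable (Om L) (\<lambda>y. prod (fx y) (Ig y))"
    unfolding Ig_def
    by (rule integrable_bounded_prod[OF b fxi indefinite_integral_meas[OF gxi] indefinite_integral_bound[OF gxi]])
  have 3: "integrable (Om L) (\<lambda>y. prod (If y) (gx y))"
    unfolding If_def
    by (rule integrable_bounded_prod[OF bf gxi indefinite_integral_meas[OF fxi] indefinite_integral_bound[OF fxi]])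
  have eq: "indicator {..x} y *\<^sub>R (prod (F y) (g y) + prod (f y) (G y))
      = (prod (F 0) (gx y) + prod (If y) (gx y)) + (prod (fx y) (G 0) + prod (fx y) (Ig y))"
    if y: "y \<in> space (Om L)" for y
  proof (cases "y \<le> x")
    case True
    have y: "y \<in> {0..L}" using y by (simp add: space_restrict_space)
    have "If y = (\<integral>z. indicator {..y} z *\<^sub>R f z \<partial>Om L)" "Ig y = (\<integral>z. indicator {..y} z *\<^sub>R g z \<partial>Om L)"
      unfolding If_def Ig_def fx_def gx_def
      using True by (auto intro!: Bochner_Integration.integral_cong simp: indicator_def)
    then have "F y = F 0 + If y" "G y = G 0 + Ig y"
      using periodic_AC_eq[OF F y] periodic_AC_eq[OF G y] by auto
    then show ?thesis using True by (simp add: fx_def gx_def b.add_left b.add_right)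
  next
    case False
    then show ?thesis by (simp add: fx_def gx_def b.zero_left b.zero_right)
  qed
  have "(\<integral>y. indicator {..x} y *\<^sub>R (prod (F y) (g y) + prod (f y) (G y)) \<partial>Om L)
     = (\<integral>y. (prod (F 0) (gx y) + prod (If y) (gx y)) + (prod (fx y) (G 0) + prod (fx y) (Ig y)) \<partial>Om L)"
    by (rule Bochner_Integration.integral_cong[OF refl eq])
  also have "\<dots> = ((\<integral>y. prod (F 0) (gx y) \<partial>Om L) + (\<integral>y. prod (If y) (gx y) \<partial>Om L))
      + ((\<integral>y. prod (fx y) (G 0) \<partial>Om L) + (\<integral>y. prod (fx y) (Ig y) \<partial>Om L))"
    using 1 2 3 by simp
  also have "\<dots> = prod (F 0) (\<integral>y. gx y \<partial>Om L) + prod (\<integral>y. fx y \<partial>Om L) (G 0)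
      + prod (\<integral>y. fx y \<partial>Om L) (\<integral>y. gx y \<partial>Om L)"
    using integral_triangle[OF b fxi gxi]
    by (simp add: add.commute If_def Ig_def integral_bounded_linear[OF b.bounded_linear_right gxi]
      integral_bounded_linear[OF b.bounded_linear_left fxi])
  also have "\<dots> = prod (F 0 + (\<integral>y. fx y \<partial>Om L)) (G 0 + (\<integral>y. gx y \<partial>Om L)) - prod (F 0) (G 0)"
    by (simp add: b.add_left b.add_right)
  also have "\<dots> = prod (F x) (G x) - prod (F 0) (G 0)"
    using periodic_AC_eq[OF F x] periodic_AC_eq[OF G x] by (simp add: fx_def gx_def)
  finally show "prod (F x) (G x) = prod (F 0) (G 0) +
      (\<integral>y. indicator {..x} y *\<^sub>R (prod (F y) (g y) + prod (f y) (G y)) \<partial>Om L)" by simp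
qed

lemma FTC_Om:
  fixes F f :: "real \<Rightarrow> real"
  assumes "\<And>x. (F has_field_derivative f x) (at x)" "continuous_on UNIV f" "x \<in> {0..L}"
  shows "(\<integral>y. indicator {..x} y *\<^sub>R f y \<partial>Om L) = F x - F 0"
proof -
  have "compact (f ` {0..L})"
    by (intro compact_continuous_image continuous_on_subset[OF assms(2)]) auto
  then have "bounded (f ` {0..L})" by (rule compact_imp_bounded)
  then obtain C where C: "\<forall>x\<in>f ` {0..L}. norm x \<le> C" unfolding bounded_iff by blast
  have "integrable (Om L) (\<lambda>y. f y *\<^sub>R (1::real))"
    using C by (intro integrable_bounded_scaleR_Om borel_measurable_continuous_Om continuous_on_subset[OF assms(2)]) auto
  then have i: "integrable (Om L) (\<lambda>y. indicator {..x} y *\<^sub>R f y)"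
    by (intro integrable_indicator_atMost) simp
  have "((\<lambda>y. indicator {..x} y *\<^sub>R f y) has_integral (\<integral>y. indicator {..x} y *\<^sub>R f y \<partial>Om L)) {0<..<L}"
    by (rule has_integral_integral_lebesgue_on[OF i]) simp
  then have 1: "((\<lambda>y. if y \<in> {0<..<L} then indicator {..x} y *\<^sub>R f y else 0) has_integral (\<integral>y. indicator {..x} y *\<^sub>R f y \<partial>Om L)) UNIV"
    by (simp only: has_integral_restrict_UNIV)
  have "(f has_integral F x - F 0) {0..x}"
    using assms by (intro fundamental_theorem_of_calculus)
      (auto simp: has_real_derivative_iff_has_vector_derivative[symmetric] intro: has_field_derivative_at_within)
  then have "((\<lambda>y. if y \<in> {0..x} then f y else 0) has_integral F x - F 0) UNIV"
    by (simp only: has_integral_restrict_UNIV)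
  then have "((\<lambda>y. if y \<in> {0<..<L} then indicator {..x} y *\<^sub>R f y else 0) has_integral F x - F 0) UNIV"
    by (rule has_integral_spike_finite[of "{0, x, L}", rotated 2]) (use assms(3) in \<open>auto simp: indicator_def\<close>)
  from has_integral_unique[OF 1 this] show ?thesis .
qed

lemma periodic_test_AC:
  assumes "periodic_test L \<phi>" "L > 0" shows "periodic_AC L \<phi> (deriv \<phi>)"
  unfolding periodic_AC_def
proof (intro conjI ballI)
  note d = periodic_test_derivI[OF assms(1)]
  obtain C where C: "\<And>x. x \<in> {0..L} \<Longrightarrow> \<bar>deriv \<phi> x\<bar> \<le> C" using periodic_test_bounded[OF d assms(2)] by blast
  show "deriv \<phi> \<in> L2 L"
  proof (rule L2I_bound[where v="\<lambda>_. 1::real" and C=C])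
    show "deriv \<phi> \<in> borel_measurable (Om L)"
      by (rule borel_measurable_continuous_Om[OF periodic_test_continuous[OF d]])
    show "(\<lambda>_. 1::real) \<in> L2 L" by (rule L2_const)
    show "norm (deriv \<phi> x) \<le> C * norm (1::real)" if "x \<in> {0<..<L}" for x using C[of x] that by simp
  qed
  show "\<phi> L = \<phi> 0" using assms unfolding periodic_test_def by (metis add_0)
  fix x assume "x \<in> {0..L}"
  from FTC_Om[OF periodic_test_deriv[OF assms(1)] periodic_test_continuous[OF d] this]
  show "\<phi> x = \<phi> 0 + (\<integral>y. indicator {..x} y *\<^sub>R deriv \<phi> y \<partial>Om L)" by simp
qed

lemma periodic_test_const: "L > 0 \<Longrightarrow> periodic_test L (\<lambda>_. c)"
  using periodic_test_trig[of L "\<lambda>_. c"] by auto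

lemma periodic_test_diff_const:
  assumes "periodic_test L \<phi>" shows "periodic_test L (\<lambda>x. \<phi> x - c)"
  unfolding periodic_test_def
proof (intro conjI allI)
  show "\<phi> (x + L) - c = \<phi> x - c" for x using assms by (simp add: periodic_test_def)
  fix k x
  have d: "((\<lambda>x. \<phi> x - c) has_field_derivative deriv \<phi> x) (at x)" for x
    using periodic_test_deriv[OF assms, of x] by (auto intro!: derivative_eq_intros)
  then have "deriv (\<lambda>x. \<phi> x - c) = deriv \<phi>" by (auto intro!: DERIV_imp_deriv)
  moreover have "(deriv ^^ j) (deriv \<phi>) field_differentiable at x" for j
    using periodic_test_derivI[OF assms] by (simp add: periodic_test_def)
  moreover have "(\<lambda>x. \<phi> x - c) field_differentiable at x" using d unfolding field_differentiable_def by blast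
  ultimately show "(deriv ^^ k) (\<lambda>x. \<phi> x - c) field_differentiable at x"
    by (cases k) (simp_all add: funpow_Suc_right del: funpow.simps(2))
qed

text \<open>Test functions of mean zero are derivatives of test functions; this is what turns a statement about \<open>\<phi>'\<close> into one
  about all test functions in the proof of \<open>has_wderiv_periodic_AC\<close>.\<close>

lemma periodic_test_antiderivative:
  assumes L: "L > 0" and \<phi>: "periodic_test L \<phi>" and zero: "(\<integral>x. \<phi> x \<partial>Om L) = 0"
  obtains \<psi> where "periodic_test L \<psi>" "deriv \<psi> = \<phi>"
proof -
  have "isCont \<phi> x" for x using periodic_test_deriv[OF \<phi>] by (rule DERIV_isCont)
  then obtain F where F: "\<And>x. (F has_vector_derivative \<phi> x) (at x)"
    using einterval_antiderivative[of "-\<infinity>" "\<infinity>" \<phi>] by auto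
  then have F: "\<And>x. (F has_field_derivative \<phi> x) (at x)"
    by (simp add: has_real_derivative_iff_has_vector_derivative)
  then have d: "deriv F = \<phi>" by (auto intro!: DERIV_imp_deriv)
  have "F L - F 0 = (\<integral>y. indicator {..L} y *\<^sub>R \<phi> y \<partial>Om L)"
    using FTC_Om[OF F periodic_test_continuous[OF \<phi>], of L L] L by simp
  also have "\<dots> = (\<integral>x. \<phi> x \<partial>Om L)"
    by (rule Bochner_Integration.integral_cong) (auto simp: space_restrict_space)
  finally have FL: "F L = F 0" using zero by simp
  have "((\<lambda>x. F (x + L) - F x) has_field_derivative 0) (at x)" for x
  proof -
    have "((\<lambda>x. F (x + L)) has_field_derivative \<phi> (x + L)) (at x)"
      using F[of "x + L"] by (simp add: DERIV_shift)
    from DERIV_diff[OF this F[of x]] show ?thesis using \<phi> by (simp add: periodic_test_def)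
  qed
  then have "F (x + L) - F x = F (0 + L) - F 0" for x
    using DERIV_isconst_all[of "\<lambda>x. F (x + L) - F x"] by blast
  then have per: "F (x + L) = F x" for x using FL by simp
  have "periodic_test L F" unfolding periodic_test_def
  proof (intro conjI allI per)
    fix k x
    have "(deriv ^^ j) (deriv F) field_differentiable at x" for j
      using \<phi> by (simp add: periodic_test_def d)
    moreover have "F field_differentiable at x" using F unfolding field_differentiable_def by blast
    ultimately show "(deriv ^^ k) F field_differentiable at x"
      by (cases k) (simp_all add: funpow_Suc_right del: funpow.simps(2))
  qed
  then show thesis by (rule that[OF _ d])
qed

section \<open>Weak derivatives\<close>

lemma has_wderivD:
  assumes "has_wderiv L k u g"
  shows "u \<in> L2 L" "g \<in> L2 L"
    "periodic_test L \<phi> \<Longrightarrow> (\<integral>x. (deriv ^^ k) \<phi> x *\<^sub>R u x \<partial>Om L) = (-1) ^ k *\<^sub>R (\<integral>x. \<phi> x *\<^sub>R g x \<partial>Om L)"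
  using assms by (auto simp: has_wderiv_def)

lemma periodic_test_L2: "periodic_test L \<phi> \<Longrightarrow> L > 0 \<Longrightarrow> \<phi> \<in> L2 L"
  using periodic_AC_in_L2[OF periodic_test_AC] by blast

lemma test_scaleR_integrable:
  fixes u :: "real \<Rightarrow> 'a::euclidean_space"
  assumes "periodic_test L \<phi>" "L > 0" "u \<in> L2 L"
  shows "integrable (Om L) (\<lambda>x. \<phi> x *\<^sub>R u x)"
  by (rule L2_prod_integrable[OF bounded_bilinear_scaleR periodic_test_L2[OF assms(1,2)] assms(3)])

lemma test_by_parts:
  fixes F :: "real \<Rightarrow> 'a::euclidean_space"
  assumes L: "L > 0" and \<phi>: "periodic_test L \<phi>" and F: "periodic_AC L F f"
  shows "(\<integral>x. deriv \<phi> x *\<^sub>R F x \<partial>Om L) = - (\<integral>x. \<phi> x *\<^sub>R f x \<partial>Om L)"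
proof -
  have "(\<integral>x. \<phi> x *\<^sub>R f x + deriv \<phi> x *\<^sub>R F x \<partial>Om L) = 0"
    by (rule periodic_AC_integral_zero[OF periodic_AC_prod[OF bounded_bilinear_scaleR periodic_test_AC[OF \<phi> L] F] L])
  moreover have "integrable (Om L) (\<lambda>x. \<phi> x *\<^sub>R f x)" "integrable (Om L) (\<lambda>x. deriv \<phi> x *\<^sub>R F x)"
    by (rule test_scaleR_integrable[OF \<phi> L periodic_AC_L2[OF F]]
        test_scaleR_integrable[OF periodic_test_derivI[OF \<phi>] L periodic_AC_in_L2[OF F]])+
  ultimately show ?thesis by (simp add: add_eq_0_iff2)
qed

lemma periodic_AC_has_wderiv:
  fixes F :: "real \<Rightarrow> 'a::euclidean_space"
  assumes "L > 0" "periodic_AC L F f" shows "has_wderiv L 1 F f"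
  unfolding has_wderiv_def using periodic_AC_in_L2[OF assms(2)] periodic_AC_L2[OF assms(2)] test_by_parts[OF assms(1) _ assms(2)]
  by auto

lemma aeq_refl[simp]: "aeq L u u" by (simp add: aeq_def)
lemma aeq_sym: "aeq L u v \<Longrightarrow> aeq L v u" unfolding aeq_def by (auto elim: eventually_mono)
lemma aeq_trans[trans]: "aeq L u v \<Longrightarrow> aeq L v w \<Longrightarrow> aeq L u w"
  unfolding aeq_def by (auto elim: eventually_elim2)

lemma aeq_integral:
  fixes u :: "real \<Rightarrow> 'a::{banach,second_countable_topology}"
  assumes "u \<in> borel_measurable (Om L)" "v \<in> borel_measurable (Om L)" "aeq L u v"
  shows "integral\<^sup>L (Om L) u = integral\<^sup>L (Om L) v"
  using assms unfolding aeq_def by (rule integral_cong_AE)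

text \<open>Du Bois-Reymond: let \<open>G\<close> be the indefinite integral of \<open>g\<close>, which is periodic because the constant test function
  forces the mean of \<open>g\<close> to vanish. Then \<open>u - G\<close> is orthogonal to all derivatives of test functions, that is, to all test
  functions of mean zero, and is therefore constant.\<close>

lemma has_wderiv_periodic_AC:
  fixes u g :: "real \<Rightarrow> 'a::euclidean_space"
  assumes L: "L > 0" and ug: "has_wderiv L 1 u g"
  obtains F where "aeq L u F" "periodic_AC L F g"
proof -
  note u = has_wderivD(1)[OF ug] and g = has_wderivD(2)[OF ug]
  have g0: "(\<integral>x. g x \<partial>Om L) = 0"
    using has_wderivD(3)[OF ug periodic_test_const[OF L, of 1]] by simp
  define G where "G x = (\<integral>y. indicator {..x} y *\<^sub>R g y \<partial>Om L)" for x
  have G0: "G 0 = 0"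
  proof -
    have "G 0 = (\<integral>y. 0 \<partial>Om L)" unfolding G_def
      by (rule Bochner_Integration.integral_cong) (auto simp: space_restrict_space indicator_def)
    then show ?thesis by simp
  qed
  have "G L = (\<integral>y. g y \<partial>Om L)" unfolding G_def
    by (rule Bochner_Integration.integral_cong) (auto simp: space_restrict_space)
  then have G: "periodic_AC L G g"
    unfolding periodic_AC_def using G0 g0 g by (auto simp: G_def)
  define w where "w x = u x - G x" for x
  have w: "w \<in> L2 L" unfolding w_def by (rule L2_diff[OF u periodic_AC_in_L2[OF G]])
  note wi = L2_integrable[OF w]
  define c where "c = (\<integral>x. w x \<partial>Om L) /\<^sub>R L"
  have "AE x in Om L. w x - c = 0"
  proof (rule AE_zero_if_orthogonal_to_tests[OF L])
    show "integrable (Om L) (\<lambda>x. w x - c)" using wi by simp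
    fix \<phi> assume \<phi>: "periodic_test L \<phi>"
    define m where "m = (\<integral>x. \<phi> x \<partial>Om L) / L"
    have \<phi>i: "integrable (Om L) \<phi>" by (rule L2_integrable[OF periodic_test_L2[OF \<phi> L]])
    have "(\<integral>x. \<phi> x - m \<partial>Om L) = 0"
      using \<phi>i L measure_Om[of L] by (simp add: m_def)
    then obtain \<psi> where \<psi>: "periodic_test L \<psi>" "deriv \<psi> = (\<lambda>x. \<phi> x - m)"
      by (rule periodic_test_antiderivative[OF L periodic_test_diff_const[OF \<phi>]])
    have wi': "integrable (Om L) (\<lambda>x. \<phi> x *\<^sub>R w x)" by (rule test_scaleR_integrable[OF \<phi> L w])
    have "(\<integral>x. (\<phi> x - m) *\<^sub>R w x \<partial>Om L) = (\<integral>x. deriv \<psi> x *\<^sub>R u x - deriv \<psi> x *\<^sub>R G x \<partial>Om L)"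
      by (simp add: \<psi>(2) w_def scaleR_diff_right)
    also have "\<dots> = (\<integral>x. deriv \<psi> x *\<^sub>R u x \<partial>Om L) - (\<integral>x. deriv \<psi> x *\<^sub>R G x \<partial>Om L)"
      by (rule Bochner_Integration.integral_diff)
        (rule test_scaleR_integrable[OF periodic_test_derivI[OF \<psi>(1)] L] u periodic_AC_in_L2[OF G])+
    also have "\<dots> = 0"
      using has_wderivD(3)[OF ug \<psi>(1)] test_by_parts[OF L \<psi>(1) G] by simp
    finally have "(\<integral>x. \<phi> x *\<^sub>R w x \<partial>Om L) = m *\<^sub>R (\<integral>x. w x \<partial>Om L)"
      using wi wi' by (simp add: scaleR_diff_left)
    moreover have "(\<integral>x. \<phi> x *\<^sub>R (w x - c) \<partial>Om L) = (\<integral>x. \<phi> x *\<^sub>R w x \<partial>Om L) - (\<integral>x. \<phi> x \<partial>Om L) *\<^sub>R c"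
      using wi' \<phi>i by (simp add: scaleR_diff_right)
    ultimately show "(\<integral>x. \<phi> x *\<^sub>R (w x - c) \<partial>Om L) = 0"
      using L by (simp add: m_def c_def divide_inverse)
  qed
  then have "aeq L u (\<lambda>x. c + G x)"
    unfolding aeq_def w_def by (auto elim!: eventually_mono simp: algebra_simps)
  moreover have "periodic_AC L (\<lambda>x. c + G x) g"
    using G periodic_AC_eq[OF G] unfolding periodic_AC_def by (auto simp: G0)
  ultimately show thesis by (rule that)
qed

lemma has_wderiv_unique:
  fixes u g :: "real \<Rightarrow> 'a::euclidean_space"
  assumes L: "L > 0" and 1: "has_wderiv L k u g" and 2: "has_wderiv L k u' g'" and u: "aeq L u u'"
  shows "aeq L g g'"
proof -
  note [measurable] = has_wderivD(1)[OF 1, THEN L2_meas] has_wderivD(1)[OF 2, THEN L2_meas]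
  have "AE x in Om L. g x - g' x = 0"
  proof (rule AE_zero_if_orthogonal_to_tests[OF L])
    show "integrable (Om L) (\<lambda>x. g x - g' x)"
      using L2_integrable[OF has_wderivD(2)[OF 1]] L2_integrable[OF has_wderivD(2)[OF 2]] by simp
    fix \<phi> assume \<phi>: "periodic_test L \<phi>"
    have "periodic_test L ((deriv ^^ k) \<phi>)"
      by (induction k) (simp_all add: \<phi> periodic_test_derivI)
    note [measurable] = periodic_test_L2[OF this L, THEN L2_meas]
    have "(\<integral>x. (deriv ^^ k) \<phi> x *\<^sub>R u x \<partial>Om L) = (\<integral>x. (deriv ^^ k) \<phi> x *\<^sub>R u' x \<partial>Om L)"
      by (rule integral_cong_AE) (use u in \<open>auto simp: aeq_def elim: eventually_mono\<close>)
    then have "(-1) ^ k *\<^sub>R (\<integral>x. \<phi> x *\<^sub>R g x \<partial>Om L) = (-1) ^ k *\<^sub>R (\<integral>x. \<phi> x *\<^sub>R g' x \<partial>Om L)"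
      unfolding has_wderivD(3)[OF 1 \<phi>] has_wderivD(3)[OF 2 \<phi>] .
    then have "(\<integral>x. \<phi> x *\<^sub>R g x \<partial>Om L) = (\<integral>x. \<phi> x *\<^sub>R g' x \<partial>Om L)" by simp
    then show "(\<integral>x. \<phi> x *\<^sub>R (g x - g' x) \<partial>Om L) = 0"
      using test_scaleR_integrable[OF \<phi> L has_wderivD(2)[OF 1]] test_scaleR_integrable[OF \<phi> L has_wderivD(2)[OF 2]]
      by (simp add: scaleR_diff_right)
  qed
  then show ?thesis unfolding aeq_def by (auto elim!: eventually_mono)
qed

lemma has_wderiv_cong:
  fixes u g :: "real \<Rightarrow> 'a::euclidean_space"
  assumes 1: "has_wderiv L k u g" and L: "L > 0" and u: "aeq L u u'" "u' \<in> L2 L" and g: "aeq L g g'" "g' \<in> L2 L"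
  shows "has_wderiv L k u' g'"
  unfolding has_wderiv_def
proof (intro conjI allI impI u(2) g(2))
  fix \<phi> assume \<phi>: "periodic_test L \<phi>"
  note [measurable] = has_wderivD(1)[OF 1, THEN L2_meas] has_wderivD(2)[OF 1, THEN L2_meas] u(2)[THEN L2_meas] g(2)[THEN L2_meas]
  have "periodic_test L ((deriv ^^ k) \<phi>)"
    by (induction k) (simp_all add: \<phi> periodic_test_derivI)
  note [measurable] = periodic_test_L2[OF this L, THEN L2_meas] periodic_test_L2[OF \<phi> L, THEN L2_meas]
  have "(\<integral>x. (deriv ^^ k) \<phi> x *\<^sub>R u' x \<partial>Om L) = (\<integral>x. (deriv ^^ k) \<phi> x *\<^sub>R u x \<partial>Om L)"
    by (rule integral_cong_AE) (use u in \<open>auto simp: aeq_def elim: eventually_mono\<close>)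
  also have "\<dots> = (-1) ^ k *\<^sub>R (\<integral>x. \<phi> x *\<^sub>R g x \<partial>Om L)" by (rule has_wderivD(3)[OF 1 \<phi>])
  also have "(\<integral>x. \<phi> x *\<^sub>R g x \<partial>Om L) = (\<integral>x. \<phi> x *\<^sub>R g' x \<partial>Om L)"
    by (rule integral_cong_AE) (use g in \<open>auto simp: aeq_def elim: eventually_mono\<close>)
  finally show "(\<integral>x. (deriv ^^ k) \<phi> x *\<^sub>R u' x \<partial>Om L) = (-1) ^ k *\<^sub>R (\<integral>x. \<phi> x *\<^sub>R g' x \<partial>Om L)" .
qed

text \<open>The derivatives of order \<open>1\<close> and \<open>Suc k\<close> in the definition of \<open>Hm\<close> are taken independently of each other; testing with \<open>(deriv ^^ k) \<phi>\<close> shows that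
  they fit together.\<close>

lemma has_wderiv_chain:
  fixes u g1 g :: "real \<Rightarrow> 'a::euclidean_space"
  assumes 1: "has_wderiv L 1 u g1" and 2: "has_wderiv L (Suc k) u g"
  shows "has_wderiv L k g1 g"
  unfolding has_wderiv_def
proof (intro conjI allI impI has_wderivD(2)[OF 1] has_wderivD(2)[OF 2])
  fix \<phi> assume \<phi>: "periodic_test L \<phi>"
  have "periodic_test L ((deriv ^^ k) \<phi>)"
    by (induction k) (simp_all add: \<phi> periodic_test_derivI)
  from has_wderivD(3)[OF 1 this] has_wderivD(3)[OF 2 \<phi>]
  show "(\<integral>x. (deriv ^^ k) \<phi> x *\<^sub>R g1 x \<partial>Om L) = (-1) ^ k *\<^sub>R (\<integral>x. \<phi> x *\<^sub>R g x \<partial>Om L)" by simp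
qed

lemma has_wderiv_add:
  fixes u g :: "real \<Rightarrow> 'a::euclidean_space"
  assumes L: "L > 0" and 1: "has_wderiv L k u g" and 2: "has_wderiv L k v h"
  shows "has_wderiv L k (\<lambda>x. u x + v x) (\<lambda>x. g x + h x)"
  unfolding has_wderiv_def
proof (intro conjI allI impI)
  note D = has_wderivD[OF 1] has_wderivD[OF 2]
  show "(\<lambda>x. u x + v x) \<in> L2 L" "(\<lambda>x. g x + h x) \<in> L2 L" using D by (auto intro: L2_add)
  fix \<phi> assume \<phi>: "periodic_test L \<phi>"
  have k: "periodic_test L ((deriv ^^ k) \<phi>)"
    by (induction k) (simp_all add: \<phi> periodic_test_derivI)
  show "(\<integral>x. (deriv ^^ k) \<phi> x *\<^sub>R (u x + v x) \<partial>Om L) = (-1) ^ k *\<^sub>R (\<integral>x. \<phi> x *\<^sub>R (g x + h x) \<partial>Om L)"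
    using test_scaleR_integrable[OF \<phi> L D(2)] test_scaleR_integrable[OF \<phi> L D(5)]
     test_scaleR_integrable[OF k L D(1)] test_scaleR_integrable[OF k L D(4)] D(3)[OF \<phi>] D(6)[OF \<phi>]
    by (simp add: scaleR_add_right)
qed

lemma has_wderiv_bounded_linear:
  fixes u g :: "real \<Rightarrow> 'a::euclidean_space"
  assumes L: "L > 0" and 1: "has_wderiv L k u g" and T: "bounded_linear T"
  shows "has_wderiv L k (\<lambda>x. T (u x) :: 'b::euclidean_space) (\<lambda>x. T (g x))"
  unfolding has_wderiv_def
proof (intro conjI allI impI)
  interpret T: bounded_linear T by (rule T)
  note D = has_wderivD[OF 1]
  show "(\<lambda>x. T (u x)) \<in> L2 L" "(\<lambda>x. T (g x)) \<in> L2 L" by (rule L2_bounded_linear[OF T] D)+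
  fix \<phi> assume \<phi>: "periodic_test L \<phi>"
  have k: "periodic_test L ((deriv ^^ k) \<phi>)"
    by (induction k) (simp_all add: \<phi> periodic_test_derivI)
  have "(\<integral>x. (deriv ^^ k) \<phi> x *\<^sub>R T (u x) \<partial>Om L) = T (\<integral>x. (deriv ^^ k) \<phi> x *\<^sub>R u x \<partial>Om L)"
    using integral_bounded_linear[OF T test_scaleR_integrable[OF k L D(1)]] by (simp add: T.scaleR)
  moreover have "(\<integral>x. \<phi> x *\<^sub>R T (g x) \<partial>Om L) = T (\<integral>x. \<phi> x *\<^sub>R g x \<partial>Om L)"
    using integral_bounded_linear[OF T test_scaleR_integrable[OF \<phi> L D(2)]] by (simp add: T.scaleR)
  ultimately show "(\<integral>x. (deriv ^^ k) \<phi> x *\<^sub>R T (u x) \<partial>Om L) = (-1) ^ k *\<^sub>R (\<integral>x. \<phi> x *\<^sub>R T (g x) \<partial>Om L)"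
    using D(3)[OF \<phi>] by (simp add: T.scaleR)
qed

lemma Dx_has_wderiv: "u \<in> Hm L m \<Longrightarrow> k \<le> m \<Longrightarrow> has_wderiv L k u (Dx L k u)"
  unfolding Hm_def Dx_def mem_Collect_eq by (metis someI_ex)

lemma Hm_L2: "u \<in> Hm L m \<Longrightarrow> u \<in> L2 L" by (simp add: Hm_def)

lemma Dx_L2: "u \<in> Hm L m \<Longrightarrow> k \<le> m \<Longrightarrow> Dx L k u \<in> L2 L"
  using Dx_has_wderiv has_wderivD(2) by blast

lemma Dx1_L2: "u \<in> Hm L 1 \<Longrightarrow> Dx L 1 u \<in> L2 L"
  using Dx_L2 by blast

lemma Dx1_has_wderiv: "u \<in> Hm L 1 \<Longrightarrow> has_wderiv L 1 u (Dx L 1 u)"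
  using Dx_has_wderiv by blast

lemma has_wderiv_0: "u \<in> L2 L \<Longrightarrow> has_wderiv L 0 u u"
  by (simp add: has_wderiv_def)

lemma has_wderiv_Hm1: "has_wderiv L 1 u g \<Longrightarrow> u \<in> Hm L 1"
  unfolding Hm_def
proof (intro CollectI conjI allI impI)
  assume *: "has_wderiv L 1 u g"
  show "u \<in> L2 L" by (rule has_wderivD(1)[OF *])
  then show "\<exists>g. has_wderiv L k u g" if "k \<le> 1" for k
    using that * has_wderiv_0 by (cases "k = 0") (auto simp: le_Suc_eq)
qed

text \<open>The order of a derivative should remain the numeral \<open>1\<close>.\<close>

declare One_nat_def [simp del]

text \<open>The derivative chosen by \<open>Dx\<close> is accessible only through its uniqueness up to null sets.\<close>

lemma Dx_aeq:
  fixes u g :: "real \<Rightarrow> 'a::euclidean_space"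
  assumes "L > 0" "has_wderiv L k u g" shows "aeq L (Dx L k u) g"
  using has_wderiv_unique[OF assms(1) _ assms(2) aeq_refl] someI[of "has_wderiv L k u" g] assms(2)
  unfolding Dx_def by blast

lemma Hm1_add:
  fixes u v :: "real \<Rightarrow> 'a::euclidean_space"
  assumes "L > 0" "u \<in> Hm L 1" "v \<in> Hm L 1"
  shows "(\<lambda>x. u x + v x) \<in> Hm L 1" "aeq L (Dx L 1 (\<lambda>x. u x + v x)) (\<lambda>x. Dx L 1 u x + Dx L 1 v x)"
  using has_wderiv_add[OF assms(1) Dx1_has_wderiv[OF assms(2)] Dx1_has_wderiv[OF assms(3)]]
  by (auto intro: has_wderiv_Hm1 Dx_aeq[OF assms(1)])

lemma Hm1_bounded_linear:
  fixes u :: "real \<Rightarrow> 'a::euclidean_space" and T :: "'a \<Rightarrow> 'b::euclidean_space"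
  assumes "L > 0" "u \<in> Hm L 1" "bounded_linear T"
  shows "(\<lambda>x. T (u x)) \<in> Hm L 1" "aeq L (Dx L 1 (\<lambda>x. T (u x))) (\<lambda>x. T (Dx L 1 u x))"
  using has_wderiv_bounded_linear[OF assms(1) Dx1_has_wderiv[OF assms(2)] assms(3)]
  by (auto intro: has_wderiv_Hm1 Dx_aeq[OF assms(1)])

lemma Hm1_scaleR:
  fixes u :: "real \<Rightarrow> 'a::euclidean_space"
  assumes "L > 0" "u \<in> Hm L 1"
  shows "(\<lambda>x. c *\<^sub>R u x) \<in> Hm L 1" "aeq L (Dx L 1 (\<lambda>x. c *\<^sub>R u x)) (\<lambda>x. c *\<^sub>R Dx L 1 u x)"
  using Hm1_bounded_linear[OF assms bounded_linear_scaleR_right] by auto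

lemma aeq_add: "aeq L u u' \<Longrightarrow> aeq L v v' \<Longrightarrow> aeq L (\<lambda>x. u x + v x) (\<lambda>x. u' x + v' x)"
  unfolding aeq_def by (auto elim: eventually_elim2)

lemma aeq_comp: "aeq L u u' \<Longrightarrow> aeq L (\<lambda>x. T (u x)) (\<lambda>x. T (u' x))"
  unfolding aeq_def by (auto elim: eventually_mono)

lemma Hm1_diff:
  fixes u v :: "real \<Rightarrow> 'a::euclidean_space"
  assumes "L > 0" "u \<in> Hm L 1" "v \<in> Hm L 1"
  shows "(\<lambda>x. u x - v x) \<in> Hm L 1" "aeq L (Dx L 1 (\<lambda>x. u x - v x)) (\<lambda>x. Dx L 1 u x - Dx L 1 v x)"
proof -
  note v = Hm1_scaleR[OF assms(1,3), of "-1"]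
  note * = Hm1_add[OF assms(1,2) v(1)]
  show "(\<lambda>x. u x - v x) \<in> Hm L 1" using *(1) by simp
  show "aeq L (Dx L 1 (\<lambda>x. u x - v x)) (\<lambda>x. Dx L 1 u x - Dx L 1 v x)"
    using aeq_trans[OF *(2) aeq_add[OF aeq_refl v(2)]] by simp
qed

lemma Hm1_sum:
  fixes a :: "nat \<Rightarrow> real \<Rightarrow> 'a::euclidean_space"
  assumes "L > 0" "\<And>i. i < m \<Longrightarrow> a i \<in> Hm L 1"
  shows "(\<lambda>x. \<Sum>i<m. c i *\<^sub>R a i x) \<in> Hm L 1"
  using assms(2)
proof (induction m)
  case 0
  have "periodic_AC L (\<lambda>_. 0::'a) (\<lambda>_. 0)" by (simp add: periodic_AC_def L2_const)
  from periodic_AC_has_wderiv[OF assms(1) this] show ?case by (simp add: has_wderiv_Hm1)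
next
  case (Suc m)
  then show ?case using Hm1_add(1)[OF assms(1) _ Hm1_scaleR(1)[OF assms(1)], of "\<lambda>x. \<Sum>i<m. c i *\<^sub>R a i x" "a m" "c m"] by simp
qed

lemma Hm1_cong:
  fixes u v :: "real \<Rightarrow> 'a::euclidean_space"
  assumes "L > 0" "u \<in> Hm L 1" "v \<in> L2 L" "aeq L u v"
  shows "v \<in> Hm L 1" "aeq L (Dx L 1 u) (Dx L 1 v)"
proof -
  have *: "has_wderiv L 1 v (Dx L 1 u)"
    by (rule has_wderiv_cong[OF Dx1_has_wderiv[OF assms(2)] assms(1) assms(4,3)]) (simp_all add: Dx1_L2[OF assms(2)])
  show "v \<in> Hm L 1" by (rule has_wderiv_Hm1[OF *])
  show "aeq L (Dx L 1 u) (Dx L 1 v)" by (rule aeq_sym[OF Dx_aeq[OF assms(1) *]])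
qed

section \<open>Inner products and norms\<close>

definition l2ip :: "real \<Rightarrow> (real \<Rightarrow> 'a::euclidean_space) \<Rightarrow> (real \<Rightarrow> 'a) \<Rightarrow> real" where
  "l2ip L u v = (\<integral>x. u x \<bullet> v x \<partial>Om L)"

lemma l2ip_integrable:
  fixes u v :: "real \<Rightarrow> 'a::euclidean_space"
  shows "u \<in> L2 L \<Longrightarrow> v \<in> L2 L \<Longrightarrow> integrable (Om L) (\<lambda>x. u x \<bullet> v x)"
  by (rule L2_prod_integrable[OF bounded_bilinear_inner])

lemma l2ip_commute: "l2ip L u v = l2ip L v u"
  by (simp add: l2ip_def inner_commute)

lemma l2ip_add_left:
  assumes "u \<in> L2 L" "v \<in> L2 L" "w \<in> L2 L"
  shows "l2ip L (\<lambda>x. u x + v x) w = l2ip L u w + l2ip L v w"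
  using l2ip_integrable[OF assms(1,3)] l2ip_integrable[OF assms(2,3)]
  by (simp add: l2ip_def inner_add_left)

lemma l2ip_scaleR_left: "l2ip L (\<lambda>x. c *\<^sub>R u x) w = c * l2ip L u w"
  by (simp add: l2ip_def)

lemma l2ip_cong:
  fixes u v :: "real \<Rightarrow> 'a::euclidean_space"
  assumes "u \<in> L2 L" "u' \<in> L2 L" "v \<in> L2 L" "v' \<in> L2 L" "aeq L u u'" "aeq L v v'"
  shows "l2ip L u v = l2ip L u' v'"
  unfolding l2ip_def
proof (rule integral_cong_AE)
  note m = assms(1-4)[THEN L2_meas]
  show "(\<lambda>x. u x \<bullet> v x) \<in> borel_measurable (Om L)" "(\<lambda>x. u' x \<bullet> v' x) \<in> borel_measurable (Om L)"
    using m by measurable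
  show "AE x in Om L. u x \<bullet> v x = u' x \<bullet> v' x"
    using assms(5,6) unfolding aeq_def by eventually_elim simp
qed

lemma l2norm_nonneg[simp]: "l2norm L u \<ge> 0" by (simp add: l2norm_def)

lemma l2norm_sq_eq: "(l2norm L u)\<^sup>2 = (\<integral>x. (norm (u x))\<^sup>2 \<partial>Om L)"
  by (simp add: l2norm_def)

lemma l2norm_sq: "(l2norm L u)\<^sup>2 = l2ip L u u"
  by (simp add: l2norm_sq_eq l2ip_def power2_norm_eq_inner)

text \<open>The discriminant argument, used for the Cauchy--Schwarz inequality both on \<open>(0,L)\<close> and on the probability space.\<close>

lemma nonneg_quadratic_imp_le:
  fixes a b c :: real
  assumes "\<And>t. 0 \<le> a + 2 * t * b + t\<^sup>2 * c" "c \<ge> 0"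
  shows "b\<^sup>2 \<le> a * c"
proof (cases "c = 0")
  case True
  then have lin: "0 \<le> a + 2 * t * b" for t using assms(1)[of t] by simp
  have "b = 0"
  proof (rule ccontr)
    assume "b \<noteq> 0"
    then have "2 * (- (a + 1) / (2 * b)) * b = - (a + 1)" by simp
    with lin[of "- (a + 1) / (2 * b)"] show False by linarith
  qed
  then show ?thesis using True by simp
next
  case False
  then have c: "c > 0" using assms by simp
  have "0 \<le> (a + 2 * (- b / c) * b + (- b / c)\<^sup>2 * c) * c"
    using assms(1)[of "- b / c"] c by (intro mult_nonneg_nonneg) auto
  also have "\<dots> = a * c - b\<^sup>2" using c by (simp add: field_simps power2_eq_square)
  finally show ?thesis by simp
qed

lemma L2_norm_prod_le:
  fixes u :: "real \<Rightarrow> 'a::{banach,second_countable_topology}" and v :: "real \<Rightarrow> 'b::{banach,second_countable_topology}"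
  assumes u: "u \<in> L2 L" and v: "v \<in> L2 L"
  shows "(\<integral>x. norm (u x) * norm (v x) \<partial>Om L) \<le> l2norm L u * l2norm L v"
proof -
  note i = L2_norm_sq[OF u] L2_norm_sq[OF v] L2_norm_prod[OF u v]
  have "(\<integral>x. norm (u x) * norm (v x) \<partial>Om L)\<^sup>2 \<le> (l2norm L u)\<^sup>2 * (l2norm L v)\<^sup>2"
  proof (rule nonneg_quadratic_imp_le)
    fix t :: real
    have "0 \<le> (\<integral>x. (norm (u x) + t * norm (v x))\<^sup>2 \<partial>Om L)" by simp
    also have "\<dots> = (\<integral>x. (norm (u x))\<^sup>2 + 2 * t * (norm (u x) * norm (v x)) + t\<^sup>2 * (norm (v x))\<^sup>2 \<partial>Om L)"
      by (simp add: power2_sum power_mult_distrib algebra_simps)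
    also have "\<dots> = (l2norm L u)\<^sup>2 + 2 * t * (\<integral>x. norm (u x) * norm (v x) \<partial>Om L) + t\<^sup>2 * (l2norm L v)\<^sup>2"
      using i by (simp add: l2norm_sq_eq)
    finally show "0 \<le> (l2norm L u)\<^sup>2 + 2 * t * (\<integral>x. norm (u x) * norm (v x) \<partial>Om L) + t\<^sup>2 * (l2norm L v)\<^sup>2" .
  qed simp
  then have "(\<integral>x. norm (u x) * norm (v x) \<partial>Om L)\<^sup>2 \<le> (l2norm L u * l2norm L v)\<^sup>2"
    by (simp add: power_mult_distrib)
  then show ?thesis by (rule power2_le_imp_le) simp
qed

lemma l2ip_le:
  fixes u v :: "real \<Rightarrow> 'a::euclidean_space"
  assumes u: "u \<in> L2 L" and v: "v \<in> L2 L"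
  shows "\<bar>l2ip L u v\<bar> \<le> l2norm L u * l2norm L v"
proof -
  have "\<bar>l2ip L u v\<bar> \<le> (\<integral>x. \<bar>u x \<bullet> v x\<bar> \<partial>Om L)"
    unfolding l2ip_def by (rule integral_abs_bound)
  also have "\<dots> \<le> (\<integral>x. norm (u x) * norm (v x) \<partial>Om L)"
    by (rule integral_mono[OF integrable_abs[OF l2ip_integrable[OF u v]] L2_norm_prod[OF u v]])
      (rule Cauchy_Schwarz_ineq2)
  finally show ?thesis using L2_norm_prod_le[OF u v] by simp
qed

lemma l2norm_triangle:
  fixes u v :: "real \<Rightarrow> 'a::{banach,second_countable_topology}"
  assumes u: "u \<in> L2 L" and v: "v \<in> L2 L"
  shows "l2norm L (\<lambda>x. u x + v x) \<le> l2norm L u + l2norm L v"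
proof (rule power2_le_imp_le)
  note i = L2_norm_sq[OF u] L2_norm_sq[OF v] L2_norm_prod[OF u v]
  have "(l2norm L (\<lambda>x. u x + v x))\<^sup>2 \<le> (\<integral>x. (norm (u x))\<^sup>2 + 2 * (norm (u x) * norm (v x)) + (norm (v x))\<^sup>2 \<partial>Om L)"
    unfolding l2norm_sq_eq
  proof (rule integral_mono)
    show "integrable (Om L) (\<lambda>x. (norm (u x + v x))\<^sup>2)" by (rule L2_norm_sq[OF L2_add[OF u v]])
    show "integrable (Om L) (\<lambda>x. (norm (u x))\<^sup>2 + 2 * (norm (u x) * norm (v x)) + (norm (v x))\<^sup>2)" using i by simp
    fix x
    have "(norm (u x + v x))\<^sup>2 \<le> (norm (u x) + norm (v x))\<^sup>2" by (intro power_mono norm_triangle_ineq) simp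
    then show "(norm (u x + v x))\<^sup>2 \<le> (norm (u x))\<^sup>2 + 2 * (norm (u x) * norm (v x)) + (norm (v x))\<^sup>2"
      by (simp add: power2_sum)
  qed
  also have "\<dots> = (l2norm L u)\<^sup>2 + 2 * (\<integral>x. norm (u x) * norm (v x) \<partial>Om L) + (l2norm L v)\<^sup>2"
    using i by (simp add: l2norm_sq_eq)
  also have "\<dots> \<le> (l2norm L u + l2norm L v)\<^sup>2"
    using L2_norm_prod_le[OF u v] by (simp add: power2_sum)
  finally show "(l2norm L (\<lambda>x. u x + v x))\<^sup>2 \<le> (l2norm L u + l2norm L v)\<^sup>2" .
qed simp

lemma l2norm_scaleR: "l2norm L (\<lambda>x. c *\<^sub>R u x) = \<bar>c\<bar> * l2norm L u"
  by (simp add: l2norm_def power_mult_distrib real_sqrt_mult)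

lemma l2norm_minus_commute: "l2norm L (\<lambda>x. u x - v x) = l2norm L (\<lambda>x. v x - u x)"
  by (simp add: l2norm_def norm_minus_commute)

lemma l2norm_cong:
  fixes u v :: "real \<Rightarrow> 'a::{banach,second_countable_topology}"
  assumes "u \<in> L2 L" "v \<in> L2 L" "aeq L u v"
  shows "l2norm L u = l2norm L v"
proof -
  note [measurable] = assms(1,2)[THEN L2_meas]
  have "(\<integral>x. (norm (u x))\<^sup>2 \<partial>Om L) = (\<integral>x. (norm (v x))\<^sup>2 \<partial>Om L)"
    using assms(3) unfolding aeq_def by (intro integral_cong_AE) (auto elim: eventually_mono)
  then show ?thesis by (simp add: l2norm_def)
qed

lemma l2norm_zero[simp]: "l2norm L (\<lambda>_. 0) = 0" by (simp add: l2norm_def)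

lemma l2norm_sum:
  fixes a :: "'i \<Rightarrow> real \<Rightarrow> 'a::{banach,second_countable_topology}"
  assumes "finite I" "\<And>i. i \<in> I \<Longrightarrow> a i \<in> L2 L"
  shows "(\<lambda>x. \<Sum>i\<in>I. a i x) \<in> L2 L \<and> l2norm L (\<lambda>x. \<Sum>i\<in>I. a i x) \<le> (\<Sum>i\<in>I. l2norm L (a i))"
  using assms
proof (induction I)
  case empty
  then show ?case by (simp add: L2_const)
next
  case (insert i I)
  then show ?case using L2_add[of "a i" L "\<lambda>x. \<Sum>i\<in>I. a i x"] l2norm_triangle[of "a i" L "\<lambda>x. \<Sum>i\<in>I. a i x"]
    by (auto intro: order_trans)
qed

definition h1ip :: "real \<Rightarrow> (real \<Rightarrow> 'a::euclidean_space) \<Rightarrow> (real \<Rightarrow> 'a) \<Rightarrow> real" where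
  "h1ip L u v = l2ip L u v + l2ip L (Dx L 1 u) (Dx L 1 v)"

lemma h1norm_nonneg[simp]: "h1norm L u \<ge> 0" by (simp add: h1norm_def)

lemma h1norm_sq: "(h1norm L u)\<^sup>2 = h1ip L u u"
  by (simp add: h1norm_def h1ip_def l2norm_sq[symmetric])

lemma l2norm_le_h1norm: "l2norm L u \<le> h1norm L u"
  and l2norm_Dx_le_h1norm: "l2norm L (Dx L 1 u) \<le> h1norm L u"
  by (simp_all add: h1norm_def real_le_rsqrt)

lemma h1norm_le_add: "h1norm L u \<le> l2norm L u + l2norm L (Dx L 1 u)"
  unfolding h1norm_def by (rule sqrt_sum_squares_le_sum) auto

lemma h1ip_commute: "h1ip L u v = h1ip L v u"
  by (simp add: h1ip_def l2ip_commute)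

lemma h1ip_le:
  fixes u v :: "real \<Rightarrow> 'a::euclidean_space"
  assumes "u \<in> Hm L 1" "v \<in> Hm L 1"
  shows "\<bar>h1ip L u v\<bar> \<le> h1norm L u * h1norm L v"
proof -
  let ?a = "l2norm L u" and ?b = "l2norm L v" and ?c = "l2norm L (Dx L 1 u)" and ?d = "l2norm L (Dx L 1 v)"
  have "\<bar>h1ip L u v\<bar> \<le> ?a * ?b + ?c * ?d"
    unfolding h1ip_def using l2ip_le[OF assms[THEN Hm_L2]] l2ip_le[OF assms[THEN Dx1_L2]] by linarith
  also have "\<dots> \<le> sqrt (?a\<^sup>2 + ?c\<^sup>2) * sqrt (?b\<^sup>2 + ?d\<^sup>2)"
    using Cauchy_Schwarz_ineq2[of "(?a, ?c)" "(?b, ?d)"] by (simp add: norm_prod_def)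
  finally show ?thesis by (simp add: h1norm_def)
qed

lemma h1norm_eq_comp:
  fixes u :: "real \<Rightarrow> 'a::euclidean_space"
  assumes "u \<in> Hm L 1" "L > 0" "aeq L (Dx L 1 u) g" "g \<in> L2 L"
  shows "h1norm L u = sqrt ((l2norm L u)\<^sup>2 + (l2norm L g)\<^sup>2)"
  unfolding h1norm_def using l2norm_cong[OF Dx1_L2[OF assms(1)] assms(4,3)] by simp

lemma h1norm_triangle:
  fixes u v :: "real \<Rightarrow> 'a::euclidean_space"
  assumes L: "L > 0" and u: "u \<in> Hm L 1" and v: "v \<in> Hm L 1"
  shows "h1norm L (\<lambda>x. u x + v x) \<le> h1norm L u + h1norm L v"
proof -
  have "h1norm L (\<lambda>x. u x + v x) = sqrt ((l2norm L (\<lambda>x. u x + v x))\<^sup>2 + (l2norm L (\<lambda>x. Dx L 1 u x + Dx L 1 v x))\<^sup>2)"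
    by (rule h1norm_eq_comp[OF Hm1_add(1)[OF L u v] L Hm1_add(2)[OF L u v] L2_add[OF Dx1_L2[OF u] Dx1_L2[OF v]]])
  also have "\<dots> \<le> sqrt ((l2norm L u + l2norm L v)\<^sup>2 + (l2norm L (Dx L 1 u) + l2norm L (Dx L 1 v))\<^sup>2)"
    using l2norm_triangle[OF Hm_L2[OF u] Hm_L2[OF v]] l2norm_triangle[OF Dx1_L2[OF u] Dx1_L2[OF v]]
    by (intro real_sqrt_le_mono add_mono power_mono) auto
  also have "\<dots> \<le> h1norm L u + h1norm L v"
    unfolding h1norm_def by (rule real_sqrt_sum_squares_triangle_ineq)
  finally show ?thesis .
qed

lemma h1norm_scaleR:
  fixes u :: "real \<Rightarrow> 'a::euclidean_space"
  assumes L: "L > 0" and u: "u \<in> Hm L 1"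
  shows "h1norm L (\<lambda>x. c *\<^sub>R u x) = \<bar>c\<bar> * h1norm L u"
proof -
  have "h1norm L (\<lambda>x. c *\<^sub>R u x) = sqrt ((l2norm L (\<lambda>x. c *\<^sub>R u x))\<^sup>2 + (l2norm L (\<lambda>x. c *\<^sub>R Dx L 1 u x))\<^sup>2)"
    by (rule h1norm_eq_comp[OF Hm1_scaleR(1)[OF L u] L Hm1_scaleR(2)[OF L u] L2_scaleR[OF Dx1_L2[OF u]]])
  also have "\<dots> = sqrt (c\<^sup>2 * ((l2norm L u)\<^sup>2 + (l2norm L (Dx L 1 u))\<^sup>2))"
    by (simp add: l2norm_scaleR power_mult_distrib distrib_left)
  finally show ?thesis by (simp add: real_sqrt_mult h1norm_def)
qed

lemma h1norm_cong:
  fixes u v :: "real \<Rightarrow> 'a::euclidean_space"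
  assumes L: "L > 0" and u: "u \<in> Hm L 1" and v: "v \<in> Hm L 1" and uv: "aeq L u v"
  shows "h1norm L u = h1norm L v"
proof -
  have "aeq L (Dx L 1 u) (Dx L 1 v)" using Hm1_cong(2)[OF L u Hm_L2[OF v] uv] .
  then show ?thesis
    unfolding h1norm_def using l2norm_cong[OF Hm_L2[OF u] Hm_L2[OF v] uv] l2norm_cong[OF Dx1_L2[OF u] Dx1_L2[OF v]]
    by simp
qed

lemma h1norm_minus_commute:
  fixes u v :: "real \<Rightarrow> 'a::euclidean_space"
  assumes L: "L > 0" and u: "u \<in> Hm L 1" and v: "v \<in> Hm L 1"
  shows "h1norm L (\<lambda>x. u x - v x) = h1norm L (\<lambda>x. v x - u x)"
  using h1norm_scaleR[OF L Hm1_diff(1)[OF L u v], of "-1"] by simp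

lemma h1norm_triangle_diff:
  fixes u v w :: "real \<Rightarrow> 'a::euclidean_space"
  assumes L: "L > 0" and u: "u \<in> Hm L 1" and v: "v \<in> Hm L 1" and w: "w \<in> Hm L 1"
  shows "h1norm L (\<lambda>x. u x - w x) \<le> h1norm L (\<lambda>x. u x - v x) + h1norm L (\<lambda>x. v x - w x)"
  using h1norm_triangle[OF L Hm1_diff(1)[OF L u v] Hm1_diff(1)[OF L v w]] by simp

section \<open>Separability and measurable functionals\<close>

text \<open>Rational linear combinations of the basis functions are dense.\<close>

lemma L2_real_separable:
  assumes e: "orthonormal_basis L e"
  obtains S :: "(real \<Rightarrow> real) set" where "countable S" "S \<subseteq> L2 L"
    "\<And>u \<epsilon>. u \<in> L2 L \<Longrightarrow> \<epsilon> > 0 \<Longrightarrow> \<exists>s\<in>S. l2norm L (\<lambda>x. u x - s x) < \<epsilon>"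
proof
  define f where "f qs x = (\<Sum>i<length qs. real_of_rat (qs ! i) * e i x)" for qs x
  have eL: "e i \<in> L2 L" for i using e by (simp add: orthonormal_basis_def)
  have ceL: "(\<lambda>x. c * e i x) \<in> L2 L" for i c using L2_scaleR[OF eL, of c i] by simp
  have e1: "l2norm L (e i) = 1" for i
  proof -
    have "(l2norm L (e i))\<^sup>2 = 1"
      using e by (simp add: l2norm_sq l2ip_def orthonormal_basis_def inner_R_def)
    then show ?thesis using l2norm_nonneg[of L "e i"] by (simp add: power2_eq_1_iff)
  qed
  have sumL: "(\<lambda>x. \<Sum>i<n. c i * e i x) \<in> L2 L" for n :: nat and c
    using l2norm_sum[of "{..<n}" "\<lambda>i x. c i * e i x"] ceL by auto
  show "countable (range f)" by simp
  show "range f \<subseteq> L2 L" using sumL unfolding f_def by auto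
  fix u :: "real \<Rightarrow> real" and \<epsilon> :: real assume u: "u \<in> L2 L" and \<epsilon>: "\<epsilon> > 0"
  define c where "c i = inner_R L u (e i)" for i
  have "(\<lambda>n. l2norm L (\<lambda>x. u x - (\<Sum>i<n. c i * e i x))) \<longlonglongrightarrow> 0"
    using e u by (simp add: orthonormal_basis_def c_def)
  then have "eventually (\<lambda>n. l2norm L (\<lambda>x. u x - (\<Sum>i<n. c i * e i x)) < \<epsilon> / 2) sequentially"
    using \<epsilon> by (auto dest: order_tendstoD(2)[of _ 0 _ "\<epsilon> / 2"])
  then obtain n where n: "l2norm L (\<lambda>x. u x - (\<Sum>i<n. c i * e i x)) < \<epsilon> / 2"
    by (auto simp: eventually_sequentially)
  have "\<exists>q. \<bar>c i - real_of_rat q\<bar> < \<epsilon> / (2 * (real n + 1))" for i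
  proof -
    have p: "\<epsilon> / (2 * (real n + 1)) > 0" using \<epsilon> by simp
    then obtain r where r: "r \<in> \<rat>" "c i - \<epsilon> / (2 * (real n + 1)) < r" "r < c i"
      using Rats_dense_in_real[of "c i - \<epsilon> / (2 * (real n + 1))" "c i"] by auto
    moreover from r(1) obtain q where "r = real_of_rat q" by (auto elim: Rats_cases)
    ultimately show ?thesis by (intro exI[of _ q]) linarith
  qed
  then obtain q where q: "\<And>i. \<bar>c i - real_of_rat (q i)\<bar> < \<epsilon> / (2 * (real n + 1))" by metis
  define s where "s = f (map q [0..<n])"
  have s: "s = (\<lambda>x. \<Sum>i<n. real_of_rat (q i) * e i x)" by (auto simp: s_def f_def)
  have "l2norm L (\<lambda>x. (\<Sum>i<n. c i * e i x) - s x) = l2norm L (\<lambda>x. \<Sum>i<n. (c i - real_of_rat (q i)) * e i x)"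
    by (simp add: s sum_subtractf[symmetric] left_diff_distrib)
  also have "\<dots> \<le> (\<Sum>i<n. l2norm L (\<lambda>x. (c i - real_of_rat (q i)) * e i x))"
    using l2norm_sum[of "{..<n}" "\<lambda>i x. (c i - real_of_rat (q i)) * e i x"] ceL by auto
  also have "\<dots> = (\<Sum>i<n. \<bar>c i - real_of_rat (q i)\<bar>)"
    using l2norm_scaleR[of L "c i - real_of_rat (q i)" "e i" for i] e1 by simp
  also have "\<dots> \<le> (\<Sum>i<n. \<epsilon> / (2 * (real n + 1)))"
    using q by (intro sum_mono less_imp_le)
  also have "\<dots> \<le> \<epsilon> / 2" using \<epsilon> by (simp add: field_simps)
  finally have 2: "l2norm L (\<lambda>x. (\<Sum>i<n. c i * e i x) - s x) \<le> \<epsilon> / 2" .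
  have "l2norm L (\<lambda>x. u x - s x) \<le> l2norm L (\<lambda>x. u x - (\<Sum>i<n. c i * e i x)) + l2norm L (\<lambda>x. (\<Sum>i<n. c i * e i x) - s x)"
    using l2norm_triangle[OF L2_diff[OF u sumL[where n=n and c=c]] L2_diff[OF sumL[where n=n and c=c] sumL[where n=n and c="\<lambda>i. real_of_rat (q i)"]]]
    by (simp add: s)
  then have "l2norm L (\<lambda>x. u x - s x) < \<epsilon>" using n 2 by simp
  then show "\<exists>s\<in>range f. l2norm L (\<lambda>x. u x - s x) < \<epsilon>" unfolding s_def by blast
qed

lemma L2_separable:
  assumes e: "orthonormal_basis L e"
  obtains S :: "(real \<Rightarrow> 'a::euclidean_space) set" where "countable S" "S \<subseteq> L2 L"
    "\<And>u \<epsilon>. u \<in> L2 L \<Longrightarrow> \<epsilon> > 0 \<Longrightarrow> \<exists>s\<in>S. l2norm L (\<lambda>x. u x - s x) < \<epsilon>"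
proof -
  obtain R :: "(real \<Rightarrow> real) set" where R: "countable R" "R \<subseteq> L2 L"
    "\<And>u \<epsilon>. u \<in> L2 L \<Longrightarrow> \<epsilon> > 0 \<Longrightarrow> \<exists>s\<in>R. l2norm L (\<lambda>x. u x - s x) < \<epsilon>"
    using L2_real_separable[OF e] by metis
  define g :: "('a \<Rightarrow> real \<Rightarrow> real) \<Rightarrow> real \<Rightarrow> 'a" where "g f x = (\<Sum>b\<in>Basis. f b x *\<^sub>R b)" for f x
  let ?S = "g ` (\<Pi>\<^sub>E b\<in>Basis. R)"
  have bL: "(\<lambda>x. h x *\<^sub>R b) \<in> L2 L" if "h \<in> L2 L" for h :: "real \<Rightarrow> real" and b :: 'a
    by (rule L2_bounded_linear[OF bounded_linear_scaleR_left that])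
  show thesis
  proof (rule that)
    show "countable ?S" using R(1) by (intro countable_image countable_PiE) auto
    have "g f \<in> L2 L" if "f \<in> (\<Pi>\<^sub>E b\<in>Basis. R)" for f
      unfolding g_def[abs_def]
      using l2norm_sum[of Basis "\<lambda>b x. f b x *\<^sub>R b"] that R(2) by (auto intro!: bL)
    then show "?S \<subseteq> L2 L" by auto
    fix u :: "real \<Rightarrow> 'a" and \<epsilon> :: real assume u: "u \<in> L2 L" and \<epsilon>: "\<epsilon> > 0"
    let ?d = "\<epsilon> / (2 * real DIM('a))"
    have d: "?d > 0" using \<epsilon> by simp
    have ub: "(\<lambda>x. u x \<bullet> b) \<in> L2 L" for b by (rule L2_bounded_linear[OF bounded_linear_inner_left u])
    have "\<forall>b\<in>Basis. \<exists>s\<in>R. l2norm L (\<lambda>x. u x \<bullet> b - s x) < ?d" using R(3)[OF ub d] by blast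
    then obtain s where s: "\<And>b. b \<in> Basis \<Longrightarrow> s b \<in> R" "\<And>b. b \<in> Basis \<Longrightarrow> l2norm L (\<lambda>x. u x \<bullet> b - s b x) < ?d"
      by metis
    define f where "f = restrict s Basis"
    have f: "f \<in> (\<Pi>\<^sub>E b\<in>Basis. R)" using s(1) by (auto simp: f_def)
    have "l2norm L (\<lambda>x. u x - g f x) = l2norm L (\<lambda>x. \<Sum>b\<in>Basis. (u x \<bullet> b - s b x) *\<^sub>R b)"
      by (simp add: g_def f_def scaleR_diff_left sum_subtractf euclidean_representation)
    also have "\<dots> \<le> (\<Sum>b\<in>Basis. l2norm L (\<lambda>x. (u x \<bullet> b - s b x) *\<^sub>R b))"
    proof -
      have "(\<lambda>x. (u x \<bullet> b - s b x) *\<^sub>R b) \<in> L2 L" if "b \<in> Basis" for b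
        using s(1)[OF that] R(2) by (intro bL L2_diff[OF ub]) auto
      then show ?thesis using l2norm_sum[of Basis "\<lambda>b x. (u x \<bullet> b - s b x) *\<^sub>R b" L] by simp
    qed
    also have "\<dots> = (\<Sum>b\<in>Basis. l2norm L (\<lambda>x. u x \<bullet> b - s b x))"
      by (intro sum.cong refl) (simp add: l2norm_def)
    also have "\<dots> \<le> (\<Sum>b\<in>(Basis::'a set). ?d)" using s(2) by (intro sum_mono less_imp_le)
    also have "\<dots> = \<epsilon> / 2" by simp
    also have "\<dots> < \<epsilon>" using \<epsilon> by simp
    finally show "\<exists>s\<in>?S. l2norm L (\<lambda>x. u x - s x) < \<epsilon>" using f by blast
  qed
qed

text \<open>The map \<open>u \<mapsto> (u, u')\<close> embeds the Sobolev space into the separable space \<open>L2 \<times> L2\<close>, and a subspace of a separable metric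
  space is separable: choose one Sobolev function near each approximable point of a countable dense set, for each accuracy \<open>1 / (n + 1)\<close>.\<close>

lemma H1_separable:
  assumes L: "L > 0" and e: "orthonormal_basis L e"
  obtains D :: "(real \<Rightarrow> 'a::euclidean_space) set" where "countable D" "D \<subseteq> Hm L 1"
    "\<And>u \<epsilon>. u \<in> Hm L 1 \<Longrightarrow> \<epsilon> > 0 \<Longrightarrow> \<exists>d\<in>D. h1norm L (\<lambda>x. u x - d x) < \<epsilon>"
proof -
  obtain S :: "(real \<Rightarrow> 'a) set" where S: "countable S" "S \<subseteq> L2 L"
    "\<And>u \<epsilon>. u \<in> L2 L \<Longrightarrow> \<epsilon> > 0 \<Longrightarrow> \<exists>s\<in>S. l2norm L (\<lambda>x. u x - s x) < \<epsilon>"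
    using L2_separable[OF e] by metis
  define P where "P p d \<longleftrightarrow> (case p of (s, t, n) \<Rightarrow> d \<in> Hm L 1 \<and>
     l2norm L (\<lambda>x. d x - s x) < 1 / (real n + 1) \<and> l2norm L (\<lambda>x. Dx L 1 d x - t x) < 1 / (real n + 1))"
    for p :: "(real \<Rightarrow> 'a) \<times> (real \<Rightarrow> 'a) \<times> nat" and d
  define D where "D = (\<lambda>p. SOME d. P p d) ` {p \<in> S \<times> S \<times> UNIV. \<exists>d. P p d}"
  show thesis
  proof (rule that)
    show "countable D" unfolding D_def using S(1) by (intro countable_image countable_Collect countable_SIGMA) auto
    have *: "P p (SOME d. P p d)" if "\<exists>d. P p d" for p using that by (rule someI_ex)
    then show "D \<subseteq> Hm L 1" unfolding D_def P_def by (fastforce split: prod.splits)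
    fix u :: "real \<Rightarrow> 'a" and \<epsilon> :: real assume u: "u \<in> Hm L 1" and \<epsilon>: "\<epsilon> > 0"
    obtain n :: nat where n: "4 / \<epsilon> < real n" using reals_Archimedean2 by blast
    then have "4 / (real n + 1) < \<epsilon>" using \<epsilon> by (simp add: field_simps)
    let ?\<delta> = "1 / (real n + 1)"
    have \<delta>: "?\<delta> > 0" by simp
    obtain s where s: "s \<in> S" "l2norm L (\<lambda>x. u x - s x) < ?\<delta>" using S(3)[OF Hm_L2[OF u] \<delta>] by blast
    obtain t where t: "t \<in> S" "l2norm L (\<lambda>x. Dx L 1 u x - t x) < ?\<delta>" using S(3)[OF Dx1_L2[OF u] \<delta>] by blast
    have Pu: "P (s, t, n) u" unfolding P_def using u s t by auto
    define d where "d = (SOME d. P (s, t, n) d)"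
    have dD: "d \<in> D" unfolding D_def d_def using s(1) t(1) Pu by blast
    have "P (s, t, n) d" unfolding d_def by (rule *) (use Pu in blast)
    then have d: "d \<in> Hm L 1" "l2norm L (\<lambda>x. s x - d x) < ?\<delta>" "l2norm L (\<lambda>x. t x - Dx L 1 d x) < ?\<delta>"
      unfolding P_def l2norm_minus_commute[of L s d] l2norm_minus_commute[of L t "Dx L 1 d"] by auto
    have sL: "s \<in> L2 L" "t \<in> L2 L" using S(2) s t by auto
    have "l2norm L (\<lambda>x. u x - d x) \<le> l2norm L (\<lambda>x. u x - s x) + l2norm L (\<lambda>x. s x - d x)"
      using l2norm_triangle[OF L2_diff[OF Hm_L2[OF u] sL(1)] L2_diff[OF sL(1) Hm_L2[OF d(1)]]] by simp
    moreover have "l2norm L (\<lambda>x. Dx L 1 u x - Dx L 1 d x) \<le> l2norm L (\<lambda>x. Dx L 1 u x - t x) + l2norm L (\<lambda>x. t x - Dx L 1 d x)"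
      using l2norm_triangle[OF L2_diff[OF Dx1_L2[OF u] sL(2)] L2_diff[OF sL(2) Dx1_L2[OF d(1)]]] by simp
    moreover have "l2norm L (Dx L 1 (\<lambda>x. u x - d x)) = l2norm L (\<lambda>x. Dx L 1 u x - Dx L 1 d x)"
      using Hm1_diff[OF L u d(1)] u d(1) by (intro l2norm_cong Dx1_L2 L2_diff)
    ultimately have "h1norm L (\<lambda>x. u x - d x) \<le> 4 / (real n + 1)"
      using h1norm_le_add[of L "\<lambda>x. u x - d x"] s(2) t(2) d(2,3) by simp
    then show "\<exists>d\<in>D. h1norm L (\<lambda>x. u x - d x) < \<epsilon>" using dD \<open>4 / (real n + 1) < \<epsilon>\<close> by force
  qed
qed

lemma space_H1_borel[simp]: "space (H1_borel L) = Hm L 1"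
  unfolding H1_borel_def by (rule space_measure_of) auto

lemma H1_ball_sets:
  "f \<in> Hm L 1 \<Longrightarrow> {u \<in> Hm L 1. h1norm L (\<lambda>x. u x - f x) < r} \<in> sets (H1_borel L)"
  unfolding H1_borel_def by (subst sets_measure_of) auto

text \<open>In a separable space, open sets are countable unions of balls, and the balls generate \<open>H1_borel\<close>.\<close>

lemma H1_borel_measurable_continuous:
  fixes \<Phi> :: "(real \<Rightarrow> 'a::euclidean_space) \<Rightarrow> real"
  assumes L: "L > 0" and e: "orthonormal_basis L e"
    and cont: "\<And>u \<epsilon>. u \<in> Hm L 1 \<Longrightarrow> \<epsilon> > 0 \<Longrightarrow>
      \<exists>\<delta>>0. \<forall>v\<in>Hm L 1. h1norm L (\<lambda>x. v x - u x) < \<delta> \<longrightarrow> \<bar>\<Phi> v - \<Phi> u\<bar> < \<epsilon>"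
  shows "\<Phi> \<in> borel_measurable (H1_borel L)"
proof (rule borel_measurableI)
  fix S :: "real set" assume S: "open S"
  obtain D :: "(real \<Rightarrow> 'a) set" where D: "countable D" "D \<subseteq> Hm L 1"
    "\<And>u \<epsilon>. u \<in> Hm L 1 \<Longrightarrow> \<epsilon> > 0 \<Longrightarrow> \<exists>d\<in>D. h1norm L (\<lambda>x. u x - d x) < \<epsilon>"
    using H1_separable[OF L e] by metis
  define B where "B d r = {u \<in> Hm L 1. h1norm L (\<lambda>x. u x - d x) < r}" for d :: "real \<Rightarrow> 'a" and r
  define I where "I = {(d, q) \<in> D \<times> \<rat>. B d q \<subseteq> \<Phi> -` S}"
  have "countable I" unfolding I_def using D(1) countable_rat
    by (intro countable_subset[OF _ countable_SIGMA[of D "\<lambda>_. \<rat>"]]) auto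
  have "\<Phi> -` S \<inter> Hm L 1 = (\<Union>(d, q)\<in>I. B d q)"
  proof (intro equalityI subsetI)
    fix u assume u: "u \<in> \<Phi> -` S \<inter> Hm L 1"
    then obtain \<epsilon> where \<epsilon>: "\<epsilon> > 0" "\<And>y. \<bar>y - \<Phi> u\<bar> < \<epsilon> \<Longrightarrow> y \<in> S"
      using S unfolding open_dist by (auto simp: dist_real_def)
    obtain \<delta> where \<delta>: "\<delta> > 0" "\<And>v. v \<in> Hm L 1 \<Longrightarrow> h1norm L (\<lambda>x. v x - u x) < \<delta> \<Longrightarrow> \<bar>\<Phi> v - \<Phi> u\<bar> < \<epsilon>"
      using cont[of u \<epsilon>] u \<epsilon>(1) by blast
    obtain q where q: "q \<in> \<rat>" "0 < q" "q < \<delta> / 2" using Rats_dense_in_real[of 0 "\<delta> / 2"] \<delta> by auto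
    obtain d where d: "d \<in> D" "h1norm L (\<lambda>x. u x - d x) < q" using D(3)[of u q] u q by blast
    have dH: "d \<in> Hm L 1" using d D by auto
    have "B d q \<subseteq> \<Phi> -` S"
    proof
      fix v assume v: "v \<in> B d q"
      then have vH: "v \<in> Hm L 1" "h1norm L (\<lambda>x. v x - d x) < q" by (auto simp: B_def)
      have "h1norm L (\<lambda>x. v x - u x) \<le> h1norm L (\<lambda>x. v x - d x) + h1norm L (\<lambda>x. d x - u x)"
        using h1norm_triangle_diff[OF L vH(1) dH] u by simp
      also have "h1norm L (\<lambda>x. d x - u x) = h1norm L (\<lambda>x. u x - d x)"
        using h1norm_minus_commute[OF L dH] u by simp
      finally have "h1norm L (\<lambda>x. v x - u x) < \<delta>" using d vH q by simp
      then show "v \<in> \<Phi> -` S" using \<delta>(2)[OF vH(1)] \<epsilon>(2) by auto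
    qed
    then have "(d, q) \<in> I" using d q by (auto simp: I_def)
    moreover have "u \<in> B d q" using u d by (auto simp: B_def)
    ultimately show "u \<in> (\<Union>(d, q)\<in>I. B d q)" by blast
  qed (auto simp: I_def B_def)
  also have "\<dots> \<in> sets (H1_borel L)"
    using D(2) by (intro sets.countable_UN'[OF \<open>countable I\<close>]) (auto simp: I_def B_def intro: H1_ball_sets)
  finally show "\<Phi> -` S \<inter> space (H1_borel L) \<in> sets (H1_borel L)" by simp
qed

section \<open>Integration by parts and the sup bound\<close>

lemma L2_cong:
  fixes u v :: "real \<Rightarrow> 'a::{banach,second_countable_topology}"
  assumes "u \<in> L2 L" "aeq L u v" "v \<in> borel_measurable (Om L)" shows "v \<in> L2 L"
proof -
  have "integrable (Om L) (\<lambda>x. (norm (v x))\<^sup>2)"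
  proof (rule Bochner_Integration.integrable_cong_AE_imp[OF L2_norm_sq[OF assms(1)]])
    show "(\<lambda>x. (norm (v x))\<^sup>2) \<in> borel_measurable (Om L)" using assms(3) by measurable
    show "AE x in Om L. (norm (u x))\<^sup>2 = (norm (v x))\<^sup>2" using assms(2) unfolding aeq_def by eventually_elim simp
  qed
  then show ?thesis using assms(3) by (simp add: L2_def)
qed

lemma periodic_AC_cong:
  fixes F f :: "real \<Rightarrow> 'a::euclidean_space"
  assumes F: "periodic_AC L F f" and f: "aeq L f f'" "f' \<in> L2 L"
  shows "periodic_AC L F f'"
proof -
  have eq: "(\<integral>y. indicator {..x} y *\<^sub>R f y \<partial>Om L) = (\<integral>y. indicator {..x} y *\<^sub>R f' y \<partial>Om L)" for x
    using f(1) integrable_indicator_atMost[OF L2_integrable[OF periodic_AC_L2[OF F]]]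
      integrable_indicator_atMost[OF L2_integrable[OF f(2)]]
    unfolding aeq_def by (intro integral_cong_AE borel_measurable_integrable) (auto elim: eventually_mono)
  show ?thesis using F f(2) unfolding periodic_AC_def eq by blast
qed

lemma periodic_AC_bounded_linear:
  fixes F f :: "real \<Rightarrow> 'a::euclidean_space" and T :: "'a \<Rightarrow> 'b::euclidean_space"
  assumes F: "periodic_AC L F f" and T: "bounded_linear T"
  shows "periodic_AC L (\<lambda>x. T (F x)) (\<lambda>x. T (f x))"
proof -
  interpret T: bounded_linear T by (rule T)
  have *: "(\<integral>y. indicator {..x} y *\<^sub>R T (f y) \<partial>Om L) = T (\<integral>y. indicator {..x} y *\<^sub>R f y \<partial>Om L)" for x
    using integral_bounded_linear[OF T integrable_indicator_atMost[OF L2_integrable[OF periodic_AC_L2[OF F]], of x]]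
    by (simp add: T.scaleR)
  show ?thesis unfolding periodic_AC_def *
  proof (intro conjI ballI)
    show "(\<lambda>x. T (f x)) \<in> L2 L" by (rule L2_bounded_linear[OF T periodic_AC_L2[OF F]])
    show "T (F L) = T (F 0)" using F by (simp only: periodic_AC_def)
    show "T (F x) = T (F 0) + T (\<integral>y. indicator {..x} y *\<^sub>R f y \<partial>Om L)" if "x \<in> {0..L}" for x
      unfolding T.add[symmetric] using periodic_AC_eq[OF F that] by simp
  qed
qed

lemma periodic_AC_add:
  fixes F f :: "real \<Rightarrow> 'a::euclidean_space"
  assumes F: "periodic_AC L F f" and G: "periodic_AC L G g"
  shows "periodic_AC L (\<lambda>x. F x + G x) (\<lambda>x. f x + g x)"
  unfolding periodic_AC_def
proof (intro conjI ballI)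
  show "(\<lambda>x. f x + g x) \<in> L2 L" by (rule L2_add[OF periodic_AC_L2[OF F] periodic_AC_L2[OF G]])
  show "F L + G L = F 0 + G 0" using F G by (simp only: periodic_AC_def)
  fix x assume x: "x \<in> {0..L}"
  show "F x + G x = F 0 + G 0 + (\<integral>y. indicator {..x} y *\<^sub>R (f y + g y) \<partial>Om L)"
    using integrable_indicator_atMost[OF L2_integrable[OF periodic_AC_L2[OF F]], of x]
      integrable_indicator_atMost[OF L2_integrable[OF periodic_AC_L2[OF G]], of x]
      periodic_AC_eq[OF F x] periodic_AC_eq[OF G x] by (simp add: scaleR_add_right)
qed

lemma periodic_AC_by_parts:
  fixes F f G g :: "real \<Rightarrow> 'a::euclidean_space"
  assumes L: "L > 0" and F: "periodic_AC L F f" and G: "periodic_AC L G g"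
  shows "l2ip L F g = - l2ip L f G"
proof -
  have "(\<integral>x. F x \<bullet> g x + f x \<bullet> G x \<partial>Om L) = 0"
    by (rule periodic_AC_integral_zero[OF periodic_AC_prod[OF bounded_bilinear_inner F G] L])
  moreover have "integrable (Om L) (\<lambda>x. F x \<bullet> g x)" "integrable (Om L) (\<lambda>x. f x \<bullet> G x)"
    by (rule l2ip_integrable periodic_AC_L2[OF F] periodic_AC_L2[OF G] periodic_AC_in_L2[OF F] periodic_AC_in_L2[OF G])+
  ultimately show ?thesis by (simp add: l2ip_def)
qed

lemma H1_by_parts:
  fixes u v :: "real \<Rightarrow> 'a::euclidean_space"
  assumes L: "L > 0" and u: "u \<in> Hm L 1" and v: "v \<in> Hm L 1"
  shows "l2ip L u (Dx L 1 v) = - l2ip L (Dx L 1 u) v"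
proof -
  obtain F where F: "aeq L u F" "periodic_AC L F (Dx L 1 u)"
    by (rule has_wderiv_periodic_AC[OF L Dx1_has_wderiv[OF u]])
  obtain G where G: "aeq L v G" "periodic_AC L G (Dx L 1 v)"
    by (rule has_wderiv_periodic_AC[OF L Dx1_has_wderiv[OF v]])
  have "l2ip L u (Dx L 1 v) = l2ip L F (Dx L 1 v)"
    by (rule l2ip_cong) (simp_all add: u v F Hm_L2[OF u] Dx1_L2 periodic_AC_in_L2[OF F(2)])
  also have "\<dots> = - l2ip L (Dx L 1 u) G" by (rule periodic_AC_by_parts[OF L F(2) G(2)])
  also have "l2ip L (Dx L 1 u) G = l2ip L (Dx L 1 u) v"
    by (rule l2ip_cong) (simp_all add: u v G aeq_sym[OF G(1)] Hm_L2[OF v] Dx1_L2 periodic_AC_in_L2[OF G(2)])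
  finally show ?thesis .
qed

text \<open>The oscillation of \<open>|u|\<^sup>2\<close> is at most the integral of the absolute value of its derivative; compare the value at \<open>x\<close> with the mean.\<close>

lemma periodic_AC_sup_bound:
  fixes u u1 :: "real \<Rightarrow> 'a::euclidean_space"
  assumes L: "L > 0" and u: "periodic_AC L u u1" and x: "x \<in> {0..L}"
  shows "(norm (u x))\<^sup>2 \<le> (l2norm L u)\<^sup>2 / L + 2 * l2norm L u * l2norm L u1"
proof -
  define q where "q x = u x \<bullet> u x" for x
  define r where "r x = u x \<bullet> u1 x + u1 x \<bullet> u x" for x
  have q: "periodic_AC L q r" unfolding q_def[abs_def] r_def[abs_def]
    by (rule periodic_AC_prod[OF bounded_bilinear_inner u u])
  note uL = periodic_AC_in_L2[OF u] and u1L = periodic_AC_L2[OF u]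
  have ri: "integrable (Om L) r" by (rule L2_integrable[OF periodic_AC_L2[OF q]])
  have r_le: "(\<integral>x. \<bar>r x\<bar> \<partial>Om L) \<le> 2 * l2norm L u * l2norm L u1"
  proof -
    have "(\<integral>x. \<bar>r x\<bar> \<partial>Om L) \<le> (\<integral>x. 2 * (norm (u x) * norm (u1 x)) \<partial>Om L)"
    proof (rule integral_mono[OF integrable_abs[OF ri]])
      show "integrable (Om L) (\<lambda>x. 2 * (norm (u x) * norm (u1 x)))" using L2_norm_prod[OF uL u1L] by simp
      show "\<bar>r x\<bar> \<le> 2 * (norm (u x) * norm (u1 x))" for x
        using Cauchy_Schwarz_ineq2[of "u x" "u1 x"] by (simp add: r_def inner_commute)
    qed
    also have "\<dots> \<le> 2 * (l2norm L u * l2norm L u1)" using L2_norm_prod_le[OF uL u1L] by simp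
    finally show ?thesis by simp
  qed
  have le: "q x \<le> q y + 2 * l2norm L u * l2norm L u1" if y: "y \<in> {0..L}" for y
  proof -
    have "q x - q y = (\<integral>z. indicator {..x} z *\<^sub>R r z \<partial>Om L) - (\<integral>z. indicator {..y} z *\<^sub>R r z \<partial>Om L)"
      using periodic_AC_eq[OF q x] periodic_AC_eq[OF q y] by simp
    also have "\<dots> = (\<integral>z. indicator {..x} z *\<^sub>R r z - indicator {..y} z *\<^sub>R r z \<partial>Om L)"
      by (rule Bochner_Integration.integral_diff[symmetric]) (rule integrable_indicator_atMost[OF ri])+
    also have "\<dots> \<le> (\<integral>z. \<bar>r z\<bar> \<partial>Om L)"
      by (rule integral_mono[OF Bochner_Integration.integrable_diff[OF integrable_indicator_atMost[OF ri] integrable_indicator_atMost[OF ri]] integrable_abs[OF ri]])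
        (auto simp: indicator_def)
    finally show ?thesis using r_le by simp
  qed
  have "(\<integral>y. q x \<partial>Om L) \<le> (\<integral>y. q y + 2 * l2norm L u * l2norm L u1 \<partial>Om L)"
    using L2_integrable[OF periodic_AC_in_L2[OF q]] le by (intro integral_mono) (auto simp: space_restrict_space)
  also have "\<dots> = (\<integral>y. q y \<partial>Om L) + 2 * l2norm L u * l2norm L u1 * L"
    using L2_integrable[OF periodic_AC_in_L2[OF q]] measure_Om[of L] L by simp
  also have "(\<integral>y. q y \<partial>Om L) = (l2norm L u)\<^sup>2"
    by (simp add: l2norm_sq l2ip_def q_def)
  finally have "L * q x \<le> (l2norm L u)\<^sup>2 + 2 * l2norm L u * l2norm L u1 * L"
    using measure_Om[of L] L by simp
  then have "q x \<le> ((l2norm L u)\<^sup>2 + 2 * l2norm L u * l2norm L u1 * L) / L"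
    using L by (simp add: pos_le_divide_eq mult.commute)
  then show ?thesis using L by (simp add: q_def power2_norm_eq_inner add_divide_distrib)
qed

text \<open>Integrating by parts repeatedly requires a representative of every derivative but the last that is itself absolutely continuous.\<close>

lemma Hm_chain:
  fixes u :: "real \<Rightarrow> 'a::euclidean_space"
  assumes L: "L > 0" and u: "u \<in> Hm L 2"
  obtains w w1 where "aeq L u w" "aeq L (Dx L 1 u) w1" "periodic_AC L w w1" "periodic_AC L w1 (Dx L 2 u)"
proof -
  have 1: "has_wderiv L 1 u (Dx L 1 u)" and 2: "has_wderiv L (Suc 1) u (Dx L 2 u)"
    using Dx_has_wderiv[OF u, of 1] Dx_has_wderiv[OF u, of 2] by (simp_all add: numeral_2_eq_2 One_nat_def)
  obtain w where w: "aeq L u w" "periodic_AC L w (Dx L 1 u)" by (rule has_wderiv_periodic_AC[OF L 1])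
  obtain w1 where w1: "aeq L (Dx L 1 u) w1" "periodic_AC L w1 (Dx L 2 u)"
    by (rule has_wderiv_periodic_AC[OF L has_wderiv_chain[OF 1 2]])
  show thesis
    by (rule that[OF w(1) w1(1) periodic_AC_cong[OF w(2) w1(1) periodic_AC_in_L2[OF w1(2)]] w1(2)])
qed

lemma Hm3_chain:
  fixes u :: "real \<Rightarrow> 'a::euclidean_space"
  assumes L: "L > 0" and u: "u \<in> Hm L 3"
  obtains w w1 w2 where "aeq L u w" "aeq L (Dx L 1 u) w1" "periodic_AC L w w1" "periodic_AC L w1 w2" "periodic_AC L w2 (Dx L 3 u)"
proof -
  have 1: "has_wderiv L 1 u (Dx L 1 u)" and 2: "has_wderiv L (Suc 1) u (Dx L 2 u)" and 3: "has_wderiv L (Suc (Suc 1)) u (Dx L 3 u)"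
    using Dx_has_wderiv[OF u, of 1] Dx_has_wderiv[OF u, of 2] Dx_has_wderiv[OF u, of 3]
    by (simp_all add: numeral_2_eq_2 numeral_3_eq_3 One_nat_def)
  have u2: "u \<in> Hm L 2" using u by (simp add: Hm_def)
  obtain w w1 where w: "aeq L u w" "aeq L (Dx L 1 u) w1" "periodic_AC L w w1" "periodic_AC L w1 (Dx L 2 u)"
    by (rule Hm_chain[OF L u2])
  have "has_wderiv L 1 (Dx L 2 u) (Dx L 3 u)"
    by (rule has_wderiv_chain[OF has_wderiv_chain[OF 1 2] has_wderiv_chain[OF 1 3]])
  then obtain w2 where w2: "aeq L (Dx L 2 u) w2" "periodic_AC L w2 (Dx L 3 u)"
    by (rule has_wderiv_periodic_AC[OF L])
  show thesis
    by (rule that[OF w(1-3) periodic_AC_cong[OF w(4) w2(1) periodic_AC_in_L2[OF w2(2)]] w2(2)])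
qed

section \<open>The deterministic step\<close>

lemma bounded_linear_times_ii: "bounded_linear (\<lambda>z. \<i> * z)"
  by (rule bounded_linear_mult_right)

lemma inner_ii_self: "(\<i> * z) \<bullet> z = 0" "z \<bullet> (\<i> * z) = 0" "(\<i> * z) \<bullet> (\<i> * w) = z \<bullet> w"
  by (auto simp: inner_complex_def)

text \<open>Complex functions are treated with the real inner product \<open>a \<bullet> b = Re (a b\<^sup>*)\<close>, in which multiplication by \<open>\<i>\<close> is
  skew. The potential \<open>w\<close> is real, so its contribution \<open>- \<i> w u\<close> is pointwise orthogonal to \<open>u\<close>; against \<open>\<i> u'\<close> it gives \<open>- w r / 2\<close>,
  of which only the part of \<open>v\<close> survives, because \<open>q r\<close> is the derivative of \<open>q\<^sup>2 / 2\<close>. In the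
  conservation laws the dispersive terms integrate to zero, as derivatives of \<open>(\<i> u') \<bullet> u\<close>, \<open>u' \<bullet> u'\<close>, \<open>v'\<^sup>2\<close> and the like.\<close>

lemma CN_vector_field:
  fixes u u1 u2 :: "real \<Rightarrow> complex" and v v1 v2 v3 :: "real \<Rightarrow> real"
    and \<beta> \<gamma>1 \<gamma>2 :: real
  assumes L: "L > 0" and u: "periodic_AC L u u1" "periodic_AC L u1 u2"
    and v: "periodic_AC L v v1" "periodic_AC L v1 v2" "periodic_AC L v2 v3"
  defines "q \<equiv> \<lambda>x. u x \<bullet> u x" and "r \<equiv> \<lambda>x. u x \<bullet> u1 x + u1 x \<bullet> u x"
  defines "w \<equiv> \<lambda>x. \<gamma>1 * v x + \<beta> * q x"
  defines "F \<equiv> \<lambda>x. \<i> * u2 x - \<i> * (w x *\<^sub>R u x)"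
  defines "G \<equiv> \<lambda>x. - v3 x + \<gamma>2 * r x - v x * v1 x"
  shows "F \<in> L2 L" "G \<in> L2 L" "l2ip L F u = 0"
    "l2ip L F (\<lambda>x. \<i> * u1 x) = - (\<gamma>1 / 2) * l2ip L v r"
    "l2ip L F (\<lambda>x. \<i> * u x) = - (l2norm L u1)\<^sup>2 - \<gamma>1 * l2ip L v q - \<beta> * l2ip L q q"
    "(\<integral>x. G x \<partial>Om L) = 0"
    "l2ip L v G = \<gamma>2 * l2ip L v r"
proof -
  have q: "periodic_AC L q r" unfolding q_def r_def
    by (rule periodic_AC_prod[OF bounded_bilinear_inner u(1) u(1)])
  have vv: "periodic_AC L (\<lambda>x. v x * v x) (\<lambda>x. v x * v1 x + v1 x * v x)"
    by (rule periodic_AC_prod[OF bounded_bilinear_mult v(1) v(1)])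
  have w: "periodic_AC L w (\<lambda>x. \<gamma>1 * v1 x + \<beta> * r x)"
    unfolding w_def by (rule periodic_AC_add[OF periodic_AC_bounded_linear[OF v(1) bounded_linear_mult_right]
      periodic_AC_bounded_linear[OF q bounded_linear_mult_right]])
  have wu: "periodic_AC L (\<lambda>x. w x *\<^sub>R u x) (\<lambda>x. w x *\<^sub>R u1 x + (\<gamma>1 * v1 x + \<beta> * r x) *\<^sub>R u x)"
    by (rule periodic_AC_prod[OF bounded_bilinear_scaleR w u(1)])
  note iL = L2_bounded_linear[OF bounded_linear_times_ii]
  note uL = periodic_AC_in_L2[OF u(1)] and u1L = periodic_AC_in_L2[OF u(2)] and u2L = periodic_AC_L2[OF u(2)]
  note vL = periodic_AC_in_L2[OF v(1)] and v1L = periodic_AC_in_L2[OF v(2)] and v2L = periodic_AC_in_L2[OF v(3)] and v3L = periodic_AC_L2[OF v(3)]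
  note qL = periodic_AC_in_L2[OF q] and rL = periodic_AC_L2[OF q] and wL = periodic_AC_in_L2[OF w]
  note wuL = periodic_AC_in_L2[OF wu]
  have vv1L: "(\<lambda>x. v x * v1 x) \<in> L2 L"
    using L2_scaleR[OF periodic_AC_L2[OF vv], of "1/2"] by (simp add: mult.commute)
  note ip = l2ip_integrable
  show "F \<in> L2 L" unfolding F_def by (rule L2_diff[OF iL[OF u2L] iL[OF wuL]])
  show "G \<in> L2 L" unfolding G_def
    using L2_diff[OF L2_add[OF L2_scaleR[OF v3L, of "-1"] L2_scaleR[OF rL, of \<gamma>2]] vv1L] by simp
  show "l2ip L F u = 0"
  proof -
    have "l2ip L F u = l2ip L (\<lambda>x. \<i> * u2 x) u" unfolding l2ip_def F_def
      by (intro Bochner_Integration.integral_cong refl) (simp add: inner_diff_left inner_ii_self)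
    also have "\<dots> = - l2ip L (\<lambda>x. \<i> * u1 x) u1"
      using periodic_AC_by_parts[OF L periodic_AC_bounded_linear[OF u(2) bounded_linear_times_ii] u(1)] by simp
    also have "l2ip L (\<lambda>x. \<i> * u1 x) u1 = 0" unfolding l2ip_def by (simp add: inner_ii_self)
    finally show ?thesis by simp
  qed
  have qr: "l2ip L q r = 0"
    using periodic_AC_by_parts[OF L q q] by (simp add: l2ip_commute[of L r q])
  have wr: "l2ip L w r = \<gamma>1 * l2ip L v r"
  proof -
    have "l2ip L w r = (\<integral>x. \<gamma>1 * (v x \<bullet> r x) + \<beta> * (q x \<bullet> r x) \<partial>Om L)"
      unfolding l2ip_def w_def by (intro Bochner_Integration.integral_cong refl) (simp add: algebra_simps)
    also have "\<dots> = \<gamma>1 * l2ip L v r + \<beta> * l2ip L q r"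
      using ip[OF vL rL] ip[OF qL rL] by (simp add: l2ip_def)
    finally show ?thesis using qr by simp
  qed
  have u2u1: "l2ip L u2 u1 = 0"
    using periodic_AC_by_parts[OF L u(2) u(2)] by (simp add: l2ip_commute[of L u1 u2])
  show "l2ip L F (\<lambda>x. \<i> * u1 x) = - (\<gamma>1 / 2) * l2ip L v r"
  proof -
    have "l2ip L F (\<lambda>x. \<i> * u1 x) = (\<integral>x. u2 x \<bullet> u1 x - (1/2) * (w x \<bullet> r x) \<partial>Om L)" unfolding l2ip_def F_def r_def
      by (intro Bochner_Integration.integral_cong refl) (simp add: inner_diff_left inner_ii_self inner_commute[of "u1 _"])
    also have "\<dots> = l2ip L u2 u1 - (1/2) * l2ip L w r"
      using ip[OF u2L u1L] ip[OF wL rL] unfolding l2ip_def by simp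
    finally show ?thesis using wr u2u1 by simp
  qed
  show "l2ip L F (\<lambda>x. \<i> * u x) = - (l2norm L u1)\<^sup>2 - \<gamma>1 * l2ip L v q - \<beta> * l2ip L q q"
  proof -
    have "l2ip L F (\<lambda>x. \<i> * u x) = (\<integral>x. u2 x \<bullet> u x - (\<gamma>1 * (v x \<bullet> q x) + \<beta> * (q x \<bullet> q x)) \<partial>Om L)" unfolding l2ip_def F_def
      by (intro Bochner_Integration.integral_cong refl) (simp add: inner_diff_left inner_ii_self w_def q_def algebra_simps)
    also have "\<dots> = l2ip L u2 u - (\<gamma>1 * l2ip L v q + \<beta> * l2ip L q q)"
      using ip[OF u2L uL] ip[OF vL qL] ip[OF qL qL] unfolding l2ip_def by simp
    also have "l2ip L u2 u = - (l2norm L u1)\<^sup>2"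
      using periodic_AC_by_parts[OF L u(2) u(1)] by (simp add: l2norm_sq)
    finally show ?thesis by simp
  qed
  have v0: "(\<integral>x. v x * v1 x \<partial>Om L) = 0"
    using periodic_AC_by_parts[OF L v(1) v(1)] by (simp add: l2ip_def mult.commute)
  show "(\<integral>x. G x \<partial>Om L) = 0"
    unfolding G_def
    using L2_integrable[OF v3L] L2_integrable[OF rL] L2_integrable[OF vv1L] v0
      periodic_AC_integral_zero[OF v(3) L] periodic_AC_integral_zero[OF q L] by simp
  show "l2ip L v G = \<gamma>2 * l2ip L v r"
  proof -
    have "l2ip L v G = (\<integral>x. - (v x \<bullet> v3 x) + \<gamma>2 * (v x \<bullet> r x) - v x \<bullet> (v x * v1 x) \<partial>Om L)"
      unfolding l2ip_def G_def by (intro Bochner_Integration.integral_cong refl) (simp add: algebra_simps)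
    also have "\<dots> = - l2ip L v v3 + \<gamma>2 * l2ip L v r - l2ip L v (\<lambda>x. v x * v1 x)"
      using ip[OF vL v3L] ip[OF vL rL] ip[OF vL vv1L] unfolding l2ip_def by simp
    also have "l2ip L v v3 = - l2ip L v1 v2" by (rule periodic_AC_by_parts[OF L v(1) v(3)])
    also have "l2ip L v1 v2 = 0"
      using periodic_AC_by_parts[OF L v(2) v(2)] by (simp add: l2ip_commute[of L v2 v1])
    also have "l2ip L v (\<lambda>x. v x * v1 x) = 0"
    proof -
      have "l2ip L v (\<lambda>x. v x * v1 x + v1 x * v x) = - l2ip L v1 (\<lambda>x. v x * v x)"
        by (rule periodic_AC_by_parts[OF L v(1) vv])
      moreover have "l2ip L v (\<lambda>x. v x * v1 x + v1 x * v x) = (\<integral>x. 2 * (v x \<bullet> (v x * v1 x)) \<partial>Om L)"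
        unfolding l2ip_def by (intro Bochner_Integration.integral_cong refl) (simp add: algebra_simps)
      moreover have "\<dots> = 2 * l2ip L v (\<lambda>x. v x * v1 x)" unfolding l2ip_def by simp
      moreover have "l2ip L v1 (\<lambda>x. v x * v x) = l2ip L v (\<lambda>x. v x * v1 x)"
        unfolding l2ip_def by (intro Bochner_Integration.integral_cong refl) (simp add: algebra_simps)
      ultimately show ?thesis by simp
    qed
    finally show ?thesis by simp
  qed
qed

text \<open>The polarized form of the momentum \<open>\<integral> Im (u \<partial>\<^sub>x u\<^sup>*)\<close>, since \<open>Im (a b\<^sup>*) = a \<bullet> (\<i> b)\<close>.\<close>

definition momentum_form :: "real \<Rightarrow> (real \<Rightarrow> complex) \<Rightarrow> (real \<Rightarrow> complex) \<Rightarrow> real" where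
  "momentum_form L u v = l2ip L u (\<lambda>x. \<i> * Dx L 1 v x)"

text \<open>Integration by parts and the skewness of multiplication by \<open>\<i>\<close> each contribute a sign.\<close>

lemma momentum_form_commute:
  assumes L: "L > 0" and u: "u \<in> Hm L 1" and v: "v \<in> Hm L 1"
  shows "momentum_form L u v = momentum_form L v u"
proof -
  have "momentum_form L u v = - l2ip L (\<lambda>x. \<i> * u x) (Dx L 1 v)"
    unfolding momentum_form_def l2ip_def by (simp add: inner_complex_def flip: Bochner_Integration.integral_minus)
  also have "\<dots> = l2ip L (Dx L 1 (\<lambda>x. \<i> * u x)) v"
    using H1_by_parts[OF L Hm1_bounded_linear(1)[OF L u bounded_linear_times_ii] v] by simp
  also have "\<dots> = l2ip L (\<lambda>x. \<i> * Dx L 1 u x) v"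
    by (rule l2ip_cong) (simp_all add: Hm1_bounded_linear[OF L u bounded_linear_times_ii] Dx1_L2 u
      L2_bounded_linear[OF bounded_linear_times_ii] Hm_L2[OF v])
  finally show ?thesis by (simp add: momentum_form_def l2ip_commute)
qed

text \<open>Rewriting the step in terms of absolutely continuous midpoints. In particular the weak derivative of \<open>|u|\<^sup>2\<close> that occurs in the
  scheme exists and is given by the product rule.\<close>

lemma CN_step_AC:
  assumes L: "L > 0" and step: "CN_step L \<gamma>1 \<gamma>2 \<beta> h U V U' V'" and h: "h > 0"
  obtains u u1 u2 :: "real \<Rightarrow> complex" and v v1 v2 v3 :: "real \<Rightarrow> real"
  where "periodic_AC L u u1" "periodic_AC L u1 u2"
    "periodic_AC L v v1" "periodic_AC L v1 v2" "periodic_AC L v2 v3"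
    "aeq L (\<lambda>x. (U x + U' x) / 2) u" "aeq L (\<lambda>x. (V x + V' x) / 2) v"
    "aeq L (\<lambda>x. U' x - U x) (\<lambda>x. h *\<^sub>R (\<i> * u2 x - \<i> * ((\<gamma>1 * v x + \<beta> * (u x \<bullet> u x)) *\<^sub>R u x)))"
    "aeq L (\<lambda>x. V' x - V x) (\<lambda>x. h *\<^sub>R (- v3 x + \<gamma>2 * (u x \<bullet> u1 x + u1 x \<bullet> u x) - v x * v1 x))"
proof -
  define Um where "Um x = (U x + U' x) / 2" for x
  define Vm where "Vm x = (V x + V' x) / 2" for x
  have Um2: "Um \<in> Hm L 2" and Vm3: "Vm \<in> Hm L 3"
    and eqU: "AE x in Om L. (U' x - U x) / of_real h = \<i> * Dx L 2 Um x
          - \<i> * (of_real \<gamma>1 * Um x * of_real (Vm x) + of_real \<beta> * of_real ((cmod (Um x))\<^sup>2) * Um x)"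
    and eqV: "AE x in Om L. (V' x - V x) / h =
          - Dx L 3 Vm x + \<gamma>2 * Dx L 1 (\<lambda>y. (cmod (Um y))\<^sup>2) x - Vm x * Dx L 1 Vm x"
    using step unfolding CN_step_def Let_def Um_def[abs_def] Vm_def[abs_def] by blast+
  obtain u u1 where u: "aeq L Um u" "aeq L (Dx L 1 Um) u1" "periodic_AC L u u1" "periodic_AC L u1 (Dx L 2 Um)"
    by (rule Hm_chain[OF L Um2])
  obtain v v1 v2 where v: "aeq L Vm v" "aeq L (Dx L 1 Vm) v1" "periodic_AC L v v1" "periodic_AC L v1 v2" "periodic_AC L v2 (Dx L 3 Vm)"
    by (rule Hm3_chain[OF L Vm3])
  define r where "r x = u x \<bullet> u1 x + u1 x \<bullet> u x" for x
  have q: "periodic_AC L (\<lambda>x. u x \<bullet> u x) r" unfolding r_def[abs_def]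
    by (rule periodic_AC_prod[OF bounded_bilinear_inner u(3) u(3)])
  have qeq: "aeq L (\<lambda>x. u x \<bullet> u x) (\<lambda>y. (cmod (Um y))\<^sup>2)"
    using u(1) unfolding aeq_def by eventually_elim (simp add: power2_norm_eq_inner)
  have "(\<lambda>y. (cmod (Um y))\<^sup>2) \<in> L2 L"
    by (rule L2_cong[OF periodic_AC_in_L2[OF q] qeq]) (use L2_meas[OF Hm_L2[OF Um2]] in measurable)
  then have "has_wderiv L 1 (\<lambda>y. (cmod (Um y))\<^sup>2) r"
    by (intro has_wderiv_cong[OF periodic_AC_has_wderiv[OF L q] L qeq]) (auto intro: periodic_AC_L2[OF q])
  then have Dq: "aeq L (Dx L 1 (\<lambda>y. (cmod (Um y))\<^sup>2)) r" by (rule Dx_aeq[OF L])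
  show thesis
  proof (rule that[OF u(3,4) v(3-5)])
    show "aeq L (\<lambda>x. (U x + U' x) / 2) u" using u(1) by (simp add: Um_def[abs_def])
    show "aeq L (\<lambda>x. (V x + V' x) / 2) v" using v(1) by (simp add: Vm_def[abs_def])
    show "aeq L (\<lambda>x. U' x - U x) (\<lambda>x. h *\<^sub>R (\<i> * Dx L 2 Um x - \<i> * ((\<gamma>1 * v x + \<beta> * (u x \<bullet> u x)) *\<^sub>R u x)))"
      using eqU u(1) v(1) unfolding aeq_def
    proof eventually_elim
      fix x assume 1: "(U' x - U x) / of_real h = \<i> * Dx L 2 Um x
          - \<i> * (of_real \<gamma>1 * Um x * of_real (Vm x) + of_real \<beta> * of_real ((cmod (Um x))\<^sup>2) * Um x)"
        and 2: "Um x = u x" "Vm x = v x"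
      have "U' x - U x = of_real h * ((U' x - U x) / of_real h)" using h by simp
      also have "\<dots> = h *\<^sub>R (\<i> * Dx L 2 Um x - \<i> * ((\<gamma>1 * v x + \<beta> * (u x \<bullet> u x)) *\<^sub>R u x))"
        unfolding 1 2 power2_norm_eq_inner by (simp add: scaleR_conv_of_real algebra_simps)
      finally show "U' x - U x = h *\<^sub>R (\<i> * Dx L 2 Um x - \<i> * ((\<gamma>1 * v x + \<beta> * (u x \<bullet> u x)) *\<^sub>R u x))" .
    qed
    show "aeq L (\<lambda>x. V' x - V x) (\<lambda>x. h *\<^sub>R (- Dx L 3 Vm x + \<gamma>2 * (u x \<bullet> u1 x + u1 x \<bullet> u x) - v x * v1 x))"
      using eqV v(1,2) Dq unfolding aeq_def
    proof eventually_elim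
      fix x assume 1: "(V' x - V x) / h =
          - Dx L 3 Vm x + \<gamma>2 * Dx L 1 (\<lambda>y. (cmod (Um y))\<^sup>2) x - Vm x * Dx L 1 Vm x"
        and 2: "Vm x = v x" "Dx L 1 Vm x = v1 x" "Dx L 1 (\<lambda>y. (cmod (Um y))\<^sup>2) x = r x"
      have "V' x - V x = h * ((V' x - V x) / h)" using h by simp
      then show "V' x - V x = h *\<^sub>R (- Dx L 3 Vm x + \<gamma>2 * (u x \<bullet> u1 x + u1 x \<bullet> u x) - v x * v1 x)"
        unfolding 1 2 r_def by simp
    qed
  qed
qed

lemma l2ip_scaleR_right: "l2ip L u (\<lambda>x. c *\<^sub>R w x) = c * l2ip L u w"
  by (simp add: l2ip_def)

lemma l2ip_diff_left:
  assumes "u \<in> L2 L" "v \<in> L2 L" "w \<in> L2 L"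
  shows "l2ip L (\<lambda>x. u x - v x) w = l2ip L u w - l2ip L v w"
  using l2ip_integrable[OF assms(1,3)] l2ip_integrable[OF assms(2,3)]
  by (simp add: l2ip_def inner_diff_left)

lemma l2ip_add_right:
  assumes "u \<in> L2 L" "v \<in> L2 L" "w \<in> L2 L"
  shows "l2ip L w (\<lambda>x. u x + v x) = l2ip L w u + l2ip L w v"
  using l2ip_add_left[OF assms] by (simp add: l2ip_commute)

text \<open>The sum of the two states is twice the midpoint, so the change of a square norm is an inner product with the midpoint.\<close>

lemma l2norm_sq_diff:
  fixes u v :: "real \<Rightarrow> 'a::euclidean_space"
  assumes "u \<in> L2 L" "v \<in> L2 L"
  shows "(l2norm L v)\<^sup>2 - (l2norm L u)\<^sup>2 = l2ip L (\<lambda>x. v x - u x) (\<lambda>x. u x + v x)"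
  using assms by (simp add: l2norm_sq l2ip_diff_left l2ip_add_right L2_add l2ip_commute)

text \<open>The scalar inequality behind the a priori bound. Here \<open>a\<close> bounds the norm of the midpoint \<open>u\<close>, \<open>d\<close> is the norm of \<open>u'\<close>, \<open>y\<close> that of the midpoint \<open>v\<close>,
  \<open>b\<close> that of \<open>V\<close>, and \<open>S\<close> a sup bound for \<open>u\<close>. With \<open>E = 1 + b + a\<^sup>2\<close> and \<open>z = a d\<close>, multiplying the bound on \<open>d\<^sup>2\<close> by \<open>a\<^sup>2\<close> gives
  \<open>z\<^sup>2 \<le> P E\<^sup>4 + Q E\<^sup>2 z\<close>, so \<open>z\<close> is at most a multiple of \<open>E\<^sup>2\<close> and, by the last hypothesis, \<open>y\<close> at most a multiple of \<open>E\<close>.\<close>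

lemma midpoint_bound_real:
  fixes a b d y S A G B \<kappa> l :: real
  assumes nn: "0 \<le> a" "0 \<le> b" "0 \<le> d" "0 \<le> y" "0 \<le> S" "0 \<le> A" "0 \<le> G" "0 \<le> B" "0 \<le> \<kappa>" "0 \<le> l"
    and d: "d\<^sup>2 \<le> A * a\<^sup>2 + G * (S * a * y) + B * (S\<^sup>2 * a\<^sup>2)"
    and S: "S\<^sup>2 \<le> l * a\<^sup>2 + 2 * a * d"
    and y: "y\<^sup>2 \<le> b * y + \<kappa> * (a * d)"
  shows "y \<le> sqrt (1 + 2 * \<kappa> * (A + B * l + G * l + G + 2 * B + 2 * G + 2 * G * \<kappa> + 1)) * (1 + b + a\<^sup>2)"
proof -
  define E where "E = 1 + b + a\<^sup>2"
  define z where "z = a * d"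
  have E: "1 \<le> E" "a\<^sup>2 \<le> E" "b \<le> E" using nn by (auto simp: E_def)
  have z0: "0 \<le> z" using nn by (simp add: z_def)
  have y2: "y\<^sup>2 \<le> E\<^sup>2 + 2 * \<kappa> * z"
  proof -
    have "2 * (b * y) \<le> b\<^sup>2 + y\<^sup>2" using sum_squares_bound[of b y] by simp
    moreover have "b\<^sup>2 \<le> E\<^sup>2" using E nn by (intro power_mono) auto
    ultimately show ?thesis using y by (simp add: z_def)
  qed
  have S2: "S\<^sup>2 \<le> l * E + 2 * z"
  proof -
    have "l * a\<^sup>2 \<le> l * E" using E nn by (intro mult_left_mono) auto
    then show ?thesis using S by (simp add: z_def)
  qed
  have E2: "E \<le> E\<^sup>2" "E\<^sup>2 \<le> E^4" "E^3 \<le> E^4"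
    using E power_increasing[of 1 2 E] power_increasing[of 2 4 E] power_increasing[of 3 4 E] by auto
  have Ea: "(a\<^sup>2)\<^sup>2 \<le> E\<^sup>2" using E by (intro power_mono) auto
  have SA: "S\<^sup>2 * (a\<^sup>2)\<^sup>2 \<le> l * E^3 + 2 * z * E\<^sup>2"
  proof -
    have "S\<^sup>2 * (a\<^sup>2)\<^sup>2 \<le> (l * E + 2 * z) * E\<^sup>2"
      using S2 Ea nn z0 E by (intro mult_mono) auto
    then show ?thesis by (simp add: algebra_simps power2_eq_square power3_eq_cube)
  qed
  have SAy: "2 * (S * a * y * a\<^sup>2) \<le> l * E^3 + 2 * z * E\<^sup>2 + E * (E\<^sup>2 + 2 * \<kappa> * z)"
  proof -
    have "2 * ((S * a\<^sup>2) * (a * y)) \<le> (S * a\<^sup>2)\<^sup>2 + (a * y)\<^sup>2" using sum_squares_bound[of "S * a\<^sup>2" "a * y"] by simp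
    moreover have "(S * a\<^sup>2)\<^sup>2 = S\<^sup>2 * (a\<^sup>2)\<^sup>2" by (simp add: power_mult_distrib)
    moreover have "(a * y)\<^sup>2 \<le> E * (E\<^sup>2 + 2 * \<kappa> * z)"
      unfolding power_mult_distrib using E y2 by (intro mult_mono) auto
    moreover have "(S * a\<^sup>2) * (a * y) = S * a * y * a\<^sup>2" by (simp only: ac_simps)
    ultimately show ?thesis using SA by linarith
  qed
  have zz: "z\<^sup>2 \<le> A * (a\<^sup>2)\<^sup>2 + G * (S * a * y * a\<^sup>2) + B * (S\<^sup>2 * (a\<^sup>2)\<^sup>2)"
  proof -
    have "z\<^sup>2 = d\<^sup>2 * a\<^sup>2" by (simp add: z_def power_mult_distrib)
    also have "\<dots> \<le> (A * a\<^sup>2 + G * (S * a * y) + B * (S\<^sup>2 * a\<^sup>2)) * a\<^sup>2" using d by (intro mult_right_mono) auto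
    finally show ?thesis by (simp add: algebra_simps power2_eq_square)
  qed
  have "G * (S * a * y * a\<^sup>2) \<le> G * (l * E^3 + 2 * z * E\<^sup>2 + E * (E\<^sup>2 + 2 * \<kappa> * z))"
  proof (rule mult_left_mono)
    have "0 \<le> S * a * y * a\<^sup>2" using nn by simp
    then show "S * a * y * a\<^sup>2 \<le> l * E^3 + 2 * z * E\<^sup>2 + E * (E\<^sup>2 + 2 * \<kappa> * z)" using SAy by linarith
  qed (use nn in simp)
  moreover have "B * (S\<^sup>2 * (a\<^sup>2)\<^sup>2) \<le> B * (l * E^3 + 2 * z * E\<^sup>2)" using SA nn by (intro mult_left_mono) auto
  moreover have "A * (a\<^sup>2)\<^sup>2 \<le> A * E\<^sup>2" using Ea nn by (intro mult_left_mono) auto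
  ultimately have "z\<^sup>2 \<le> A * E\<^sup>2 + G * (l * E^3 + 2 * z * E\<^sup>2 + E * (E\<^sup>2 + 2 * \<kappa> * z)) + B * (l * E^3 + 2 * z * E\<^sup>2)"
    using zz by linarith
  also have "\<dots> = A * E\<^sup>2 + (G * l + G + B * l) * E^3 + (2 * G + 2 * B) * (z * E\<^sup>2) + 2 * G * \<kappa> * (E * z)"
    by (simp add: algebra_simps power2_eq_square power3_eq_cube)
  also have "\<dots> \<le> A * E^4 + (G * l + G + B * l) * E^4 + (2 * G + 2 * B) * (z * E\<^sup>2) + 2 * G * \<kappa> * (z * E\<^sup>2)"
    using E2 nn z0 E by (intro add_mono mult_left_mono) (auto simp: mult.commute[of E] intro!: mult_left_mono)
  finally have key: "z\<^sup>2 \<le> (A + B * l + G * l + G) * E^4 + (2 * B + 2 * G + 2 * G * \<kappa>) * (E\<^sup>2 * z)"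
    by (simp add: algebra_simps)
  define K where "K = A + B * l + G * l + G + 2 * B + 2 * G + 2 * G * \<kappa> + 1"
  have zK: "z \<le> K * E\<^sup>2"
  proof (rule ccontr)
    assume "\<not> z \<le> K * E\<^sup>2"
    then have z: "z > K * E\<^sup>2" by simp
    let ?P = "A + B * l + G * l + G" and ?Q = "2 * B + 2 * G + 2 * G * \<kappa>"
    have PQ: "0 \<le> ?P" "0 \<le> ?Q" using nn by auto
    have K: "K = ?P + ?Q + 1" by (simp add: K_def)
    have "E\<^sup>2 > 0" using E by (simp add: power2_eq_square)
    have zE: "z > E\<^sup>2"
    proof -
      have "1 * E\<^sup>2 \<le> K * E\<^sup>2" using PQ K by (intro mult_right_mono) auto
      then show ?thesis using z by simp
    qed
    have "?P * E^4 \<le> ?P * (E\<^sup>2 * z)"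
    proof (rule mult_left_mono[OF _ PQ(1)])
      have "E^4 = E\<^sup>2 * E\<^sup>2" by (simp add: power_add[symmetric])
      also have "\<dots> \<le> E\<^sup>2 * z" using zE by (intro mult_left_mono) auto
      finally show "E^4 \<le> E\<^sup>2 * z" .
    qed
    then have "z\<^sup>2 \<le> (?P + ?Q) * (E\<^sup>2 * z)" using key by (simp add: algebra_simps)
    also have "\<dots> < K * (E\<^sup>2 * z)"
      using \<open>E\<^sup>2 > 0\<close> less_trans[OF \<open>E\<^sup>2 > 0\<close> zE] unfolding K by (intro mult_strict_right_mono mult_pos_pos) auto
    also have "\<dots> < z * z"
      using mult_strict_right_mono[OF z less_trans[OF \<open>E\<^sup>2 > 0\<close> zE]] by (simp only: mult.assoc)
    finally show False by (simp add: power2_eq_square)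
  qed
  have "y\<^sup>2 \<le> E\<^sup>2 + 2 * \<kappa> * (K * E\<^sup>2)"
    using y2 zK nn by (smt (verit) mult_left_mono mult_nonneg_nonneg)
  also have "\<dots> = (1 + 2 * \<kappa> * K) * E\<^sup>2" by (simp add: algebra_simps)
  finally have "sqrt (y\<^sup>2) \<le> sqrt ((1 + 2 * \<kappa> * K) * E\<^sup>2)" by (rule real_sqrt_le_mono)
  then show ?thesis using nn E by (simp add: real_sqrt_mult E_def K_def)
qed

text \<open>The forms are evaluated at sum and difference of the two states, which are \<open>2 u\<close> and \<open>h F\<close> (or \<open>2 v\<close> and \<open>h G\<close>).\<close>

lemma CN_step_conserved:
  assumes L: "L > 0" and h: "h > 0" and step: "CN_step L \<gamma>1 \<gamma>2 \<beta> h U V U' V'" and g: "\<gamma>1 * \<gamma>2 > 0"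
    and U: "U \<in> Hm L 1" and V: "V \<in> Hm L 1" and U': "U' \<in> Hm L 1" and V': "V' \<in> Hm L 1"
  shows "l2norm L U' = l2norm L U"
    and "(\<integral>x. V' x \<partial>Om L) = (\<integral>x. V x \<partial>Om L)"
    and "momentum_form L U' U' + \<gamma>1 / (2 * \<gamma>2) * (l2norm L V')\<^sup>2
       = momentum_form L U U + \<gamma>1 / (2 * \<gamma>2) * (l2norm L V)\<^sup>2"
proof -
  obtain u u1 u2 :: "real \<Rightarrow> complex" and v v1 v2 v3 :: "real \<Rightarrow> real"
    where u: "periodic_AC L u u1" "periodic_AC L u1 u2"
    and v: "periodic_AC L v v1" "periodic_AC L v1 v2" "periodic_AC L v2 v3"
    and um: "aeq L (\<lambda>x. (U x + U' x) / 2) u" and vm: "aeq L (\<lambda>x. (V x + V' x) / 2) v"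
    and dU: "aeq L (\<lambda>x. U' x - U x) (\<lambda>x. h *\<^sub>R (\<i> * u2 x - \<i> * ((\<gamma>1 * v x + \<beta> * (u x \<bullet> u x)) *\<^sub>R u x)))"
    and dV: "aeq L (\<lambda>x. V' x - V x) (\<lambda>x. h *\<^sub>R (- v3 x + \<gamma>2 * (u x \<bullet> u1 x + u1 x \<bullet> u x) - v x * v1 x))"
    by (rule CN_step_AC[OF L step h])
  define F where "F x = \<i> * u2 x - \<i> * ((\<gamma>1 * v x + \<beta> * (u x \<bullet> u x)) *\<^sub>R u x)" for x
  define G where "G x = - v3 x + \<gamma>2 * (u x \<bullet> u1 x + u1 x \<bullet> u x) - v x * v1 x" for x
  define r where "r x = u x \<bullet> u1 x + u1 x \<bullet> u x" for x
  have VF: "F \<in> L2 L" "G \<in> L2 L" "l2ip L F u = 0"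
      "l2ip L F (\<lambda>x. \<i> * u1 x) = - (\<gamma>1 / 2) * l2ip L v r"
      "(\<integral>x. G x \<partial>Om L) = 0"
      "l2ip L v G = \<gamma>2 * l2ip L v r"
    unfolding F_def[abs_def] G_def[abs_def] r_def[abs_def] by (rule CN_vector_field[OF L u v])+
  have dU: "aeq L (\<lambda>x. U' x - U x) (\<lambda>x. h *\<^sub>R F x)" using dU by (simp add: F_def[abs_def])
  have dV: "aeq L (\<lambda>x. V' x - V x) (\<lambda>x. h *\<^sub>R G x)" using dV by (simp add: G_def[abs_def])
  have sU: "aeq L (\<lambda>x. U x + U' x) (\<lambda>x. 2 *\<^sub>R u x)"
    using um unfolding aeq_def by eventually_elim (auto simp: scaleR_conv_of_real)
  have sV: "aeq L (\<lambda>x. V x + V' x) (\<lambda>x. 2 *\<^sub>R v x)"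
    using vm unfolding aeq_def by eventually_elim auto
  note UL = Hm_L2[OF U] and U'L = Hm_L2[OF U'] and VL = Hm_L2[OF V] and V'L = Hm_L2[OF V']
  note uL = periodic_AC_in_L2[OF u(1)] and u1L = periodic_AC_in_L2[OF u(2)] and vL = periodic_AC_in_L2[OF v(1)]
  have FL: "(\<lambda>x. h *\<^sub>R F x) \<in> L2 L" and GL: "(\<lambda>x. h *\<^sub>R G x) \<in> L2 L"
    by (rule L2_scaleR VF(1,2))+
  have "(l2norm L U')\<^sup>2 - (l2norm L U)\<^sup>2 = l2ip L (\<lambda>x. h *\<^sub>R F x) (\<lambda>x. 2 *\<^sub>R u x)"
    unfolding l2norm_sq_diff[OF UL U'L]
    by (rule l2ip_cong[OF L2_diff[OF U'L UL] FL L2_add[OF UL U'L] L2_scaleR[OF uL] dU sU])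
  also have "\<dots> = 0" using VF(3) by (simp add: l2ip_scaleR_left l2ip_scaleR_right del: scaleR_conv_of_real real_scaleR_def)
  finally show "l2norm L U' = l2norm L U" by (simp add: power2_eq_iff_nonneg)
  have "(\<integral>x. V' x \<partial>Om L) - (\<integral>x. V x \<partial>Om L) = (\<integral>x. V' x - V x \<partial>Om L)"
    using L2_integrable[OF VL] L2_integrable[OF V'L] by simp
  also have "\<dots> = (\<integral>x. h *\<^sub>R G x \<partial>Om L)"
    by (rule aeq_integral[OF L2_meas[OF L2_diff[OF V'L VL]] L2_meas[OF GL] dV])
  also have "\<dots> = 0" using VF(5) by simp
  finally show "(\<integral>x. V' x \<partial>Om L) = (\<integral>x. V x \<partial>Om L)" by simp
  have eV: "(l2norm L V')\<^sup>2 - (l2norm L V)\<^sup>2 = 2 * h * \<gamma>2 * l2ip L v r"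
  proof -
    have "(l2norm L V')\<^sup>2 - (l2norm L V)\<^sup>2 = l2ip L (\<lambda>x. h *\<^sub>R G x) (\<lambda>x. 2 *\<^sub>R v x)"
      unfolding l2norm_sq_diff[OF VL V'L]
      by (rule l2ip_cong[OF L2_diff[OF V'L VL] GL L2_add[OF VL V'L] L2_scaleR[OF vL] dV sV])
    also have "\<dots> = 2 * h * l2ip L v G" by (simp only: l2ip_scaleR_left l2ip_scaleR_right l2ip_commute[of L G v])
    finally show ?thesis using VF(6) by simp
  qed
  have eU: "momentum_form L U' U' - momentum_form L U U = - (h * \<gamma>1 * l2ip L v r)"
  proof -
    note iL = L2_bounded_linear[OF bounded_linear_times_ii]
    have D: "aeq L (\<lambda>x. Dx L 1 U x + Dx L 1 U' x) (\<lambda>x. 2 *\<^sub>R u1 x)"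
    proof -
      have "aeq L (Dx L 1 (\<lambda>x. U x + U' x)) (Dx L 1 (\<lambda>x. 2 *\<^sub>R u x))"
        by (rule Hm1_cong(2)[OF L Hm1_add(1)[OF L U U'] L2_scaleR[OF uL] sU])
      also have "aeq L \<dots> (\<lambda>x. 2 *\<^sub>R u1 x)"
        by (rule Dx_aeq[OF L periodic_AC_has_wderiv[OF L periodic_AC_bounded_linear[OF u(1) bounded_linear_scaleR_right]]])
      finally show ?thesis using aeq_trans[OF aeq_sym[OF Hm1_add(2)[OF L U U']]] by blast
    qed
    note m = momentum_form_def
    have DL: "(\<lambda>x. \<i> * Dx L 1 U x) \<in> L2 L" "(\<lambda>x. \<i> * Dx L 1 U' x) \<in> L2 L"
      by (rule iL[OF Dx1_L2[OF U]] iL[OF Dx1_L2[OF U']])+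
    have "momentum_form L U' U' - momentum_form L U U
        = (momentum_form L U' U + momentum_form L U' U') - (momentum_form L U U + momentum_form L U U')"
      using momentum_form_commute[OF L U U'] by simp
    also have "\<dots> = l2ip L (\<lambda>x. U' x - U x) (\<lambda>x. \<i> * Dx L 1 U x + \<i> * Dx L 1 U' x)"
      unfolding m using DL UL U'L by (simp add: l2ip_add_right l2ip_diff_left L2_diff)
    also have "\<dots> = l2ip L (\<lambda>x. h *\<^sub>R F x) (\<lambda>x. 2 *\<^sub>R (\<i> * u1 x))"
    proof (rule l2ip_cong[OF L2_diff[OF U'L UL] FL L2_add[OF DL] L2_scaleR[OF iL[OF u1L]] dU])
      show "aeq L (\<lambda>x. \<i> * Dx L 1 U x + \<i> * Dx L 1 U' x) (\<lambda>x. 2 *\<^sub>R (\<i> * u1 x))"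
        using aeq_comp[OF D, of "\<lambda>z. \<i> * z"] by (simp add: distrib_left)
    qed
    also have "\<dots> = 2 * h * l2ip L F (\<lambda>x. \<i> * u1 x)" by (simp only: l2ip_scaleR_left l2ip_scaleR_right)
    finally show ?thesis using VF(4) by simp
  qed
  have "\<gamma>2 \<noteq> 0" using g by auto
  then have "\<gamma>1 / (2 * \<gamma>2) * ((l2norm L V')\<^sup>2 - (l2norm L V)\<^sup>2) = h * \<gamma>1 * l2ip L v r"
    unfolding eV by (simp add: field_simps)
  then show "momentum_form L U' U' + \<gamma>1 / (2 * \<gamma>2) * (l2norm L V')\<^sup>2
       = momentum_form L U U + \<gamma>1 / (2 * \<gamma>2) * (l2norm L V)\<^sup>2"
    using eU by (simp add: right_diff_distrib)
qed

text \<open>Testing the first equation with \<open>\<i> u\<close> bounds the norm of \<open>u'\<close> by the potential energy and the data (\<open>dineq\<close> below).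
  Estimating \<open>\<integral> v (|u|\<^sup>2)'\<close> directly would put into the second equation a term of the same order as the square norm of \<open>v\<close>, with a
  large factor. The momentum identity, which is the first equation tested with \<open>\<i> u'\<close>, expresses this integral by the data and \<open>u'\<close> linearly
  instead (\<open>yineq\<close>), and this closes the estimate by \<open>midpoint_bound_real\<close>.\<close>

lemma CN_step_bound:
  fixes \<gamma>1 \<gamma>2 \<beta> :: real
  assumes L: "L > 0" and h: "h > 0" and g: "\<gamma>1 * \<gamma>2 > 0"
  obtains C where "0 \<le> C"
    "\<And>U V U' V'. CN_step L \<gamma>1 \<gamma>2 \<beta> h U V U' V' \<Longrightarrow> U \<in> Hm L 1 \<Longrightarrow> V \<in> Hm L 1 \<Longrightarrow> U' \<in> Hm L 1 \<Longrightarrow> V' \<in> Hm L 1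
      \<Longrightarrow> l2norm L V' \<le> C * (1 + l2norm L V + (l2norm L U)\<^sup>2)"
proof -
  define \<kappa> where "\<kappa> = \<bar>\<gamma>2 / \<gamma>1\<bar> * 4"
  define C0 where "C0 = sqrt (1 + 2 * \<kappa> * (2 / h + \<bar>\<beta>\<bar> * (1 / L) + \<bar>\<gamma>1\<bar> * (1 / L) + \<bar>\<gamma>1\<bar> + 2 * \<bar>\<beta>\<bar> + 2 * \<bar>\<gamma>1\<bar> + 2 * \<bar>\<gamma>1\<bar> * \<kappa> + 1))"
  have C0: "C0 \<ge> 0" unfolding C0_def \<kappa>_def using L h by (intro real_sqrt_ge_zero add_nonneg_nonneg mult_nonneg_nonneg) auto
  show thesis
  proof (rule that[of "2 * C0 + 1"])
    show "0 \<le> 2 * C0 + 1" using C0 by simp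
    fix U U' :: "real \<Rightarrow> complex" and V V' :: "real \<Rightarrow> real"
    assume step: "CN_step L \<gamma>1 \<gamma>2 \<beta> h U V U' V'"
      and U: "U \<in> Hm L 1" and V: "V \<in> Hm L 1" and U': "U' \<in> Hm L 1" and V': "V' \<in> Hm L 1"
    obtain u u1 u2 :: "real \<Rightarrow> complex" and v v1 v2 v3 :: "real \<Rightarrow> real"
      where u: "periodic_AC L u u1" "periodic_AC L u1 u2"
      and v: "periodic_AC L v v1" "periodic_AC L v1 v2" "periodic_AC L v2 v3"
      and um: "aeq L (\<lambda>x. (U x + U' x) / 2) u" and vm: "aeq L (\<lambda>x. (V x + V' x) / 2) v"
      and dU: "aeq L (\<lambda>x. U' x - U x) (\<lambda>x. h *\<^sub>R (\<i> * u2 x - \<i> * ((\<gamma>1 * v x + \<beta> * (u x \<bullet> u x)) *\<^sub>R u x)))"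
      and dV: "aeq L (\<lambda>x. V' x - V x) (\<lambda>x. h *\<^sub>R (- v3 x + \<gamma>2 * (u x \<bullet> u1 x + u1 x \<bullet> u x) - v x * v1 x))"
      by (rule CN_step_AC[OF L step h])
    define F where "F x = \<i> * u2 x - \<i> * ((\<gamma>1 * v x + \<beta> * (u x \<bullet> u x)) *\<^sub>R u x)" for x
    define G where "G x = - v3 x + \<gamma>2 * (u x \<bullet> u1 x + u1 x \<bullet> u x) - v x * v1 x" for x
    define r where "r x = u x \<bullet> u1 x + u1 x \<bullet> u x" for x
    define q where "q x = u x \<bullet> u x" for x
    have VF: "F \<in> L2 L" "G \<in> L2 L" "l2ip L v G = \<gamma>2 * l2ip L v r"
      "l2ip L F (\<lambda>x. \<i> * u1 x) = - (\<gamma>1 / 2) * l2ip L v r"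
      "l2ip L F (\<lambda>x. \<i> * u x) = - (l2norm L u1)\<^sup>2 - \<gamma>1 * l2ip L v q - \<beta> * l2ip L q q"
      unfolding F_def[abs_def] G_def[abs_def] r_def[abs_def] q_def[abs_def] by (rule CN_vector_field[OF L u v])+
    have dU: "aeq L (\<lambda>x. U' x - U x) (\<lambda>x. h *\<^sub>R F x)" using dU by (simp add: F_def[abs_def])
    have dV: "aeq L (\<lambda>x. V' x - V x) (\<lambda>x. h *\<^sub>R G x)" using dV by (simp add: G_def[abs_def])
    note UL = Hm_L2[OF U] and U'L = Hm_L2[OF U'] and VL = Hm_L2[OF V] and V'L = Hm_L2[OF V']
    note uL = periodic_AC_in_L2[OF u(1)] and u1L = periodic_AC_in_L2[OF u(2)] and vL = periodic_AC_in_L2[OF v(1)]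
    note iL = L2_bounded_linear[OF bounded_linear_times_ii]
    have qAC: "periodic_AC L q r" unfolding q_def[abs_def] r_def[abs_def]
      by (rule periodic_AC_prod[OF bounded_bilinear_inner u(1) u(1)])
    note qL = periodic_AC_in_L2[OF qAC]
    have uU: "aeq L (\<lambda>x. u x - U x) (\<lambda>x. (h / 2) *\<^sub>R F x)"
      using um dU unfolding aeq_def
    proof eventually_elim
      fix x assume "(U x + U' x) / 2 = u x" "U' x - U x = h *\<^sub>R F x"
      moreover have "(U x + U' x) / 2 - U x = (1/2) *\<^sub>R (U' x - U x)" by (simp add: scaleR_conv_of_real field_simps)
      ultimately show "u x - U x = (h / 2) *\<^sub>R F x" by simp
    qed
    have vV: "aeq L (\<lambda>x. v x - V x) (\<lambda>x. (h / 2) *\<^sub>R G x)"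
      using vm dV unfolding aeq_def
    proof eventually_elim
      fix x assume "(V x + V' x) / 2 = v x" "V' x - V x = h *\<^sub>R G x"
      moreover have "(V x + V' x) / 2 - V x = (1/2) *\<^sub>R (V' x - V x)" by (simp add: field_simps)
      ultimately show "v x - V x = (h / 2) *\<^sub>R G x" by simp
    qed
    define a where "a = l2norm L U"
    define b where "b = l2norm L V"
    define d where "d = l2norm L u1"
    define y where "y = l2norm L v"
    define S where "S = sqrt (1 / L * a\<^sup>2 + 2 * a * d)"
    have nn: "0 \<le> a" "0 \<le> b" "0 \<le> d" "0 \<le> y" by (simp_all add: a_def b_def d_def y_def)
    have ua: "l2norm L u \<le> a"
    proof -
      have "l2norm L u = l2norm L (\<lambda>x. (1/2) *\<^sub>R (U x + U' x))"
      proof (rule l2norm_cong[OF uL L2_scaleR[OF L2_add[OF UL U'L]]])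
        show "aeq L u (\<lambda>x. (1/2) *\<^sub>R (U x + U' x))"
          using um unfolding aeq_def by eventually_elim (auto simp: scaleR_conv_of_real)
      qed
      also have "\<dots> \<le> (1/2) * (l2norm L U + l2norm L U')"
        unfolding l2norm_scaleR using l2norm_triangle[OF UL U'L] by simp
      also have "\<dots> = a" using CN_step_conserved(1)[OF L h step g U V U' V'] by (simp add: a_def)
      finally show ?thesis .
    qed
    have S2: "S\<^sup>2 = 1 / L * a\<^sup>2 + 2 * a * d" and S0: "0 \<le> S" using nn L by (simp_all add: S_def)
    have sup: "norm (u x) \<le> S" if "x \<in> {0..L}" for x
    proof -
      have "(norm (u x))\<^sup>2 \<le> (l2norm L u)\<^sup>2 / L + 2 * l2norm L u * l2norm L u1"
        by (rule periodic_AC_sup_bound[OF L u(1) that])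
      also have "\<dots> \<le> a\<^sup>2 / L + 2 * a * d" unfolding d_def
        using ua L nn by (intro add_mono divide_right_mono power_mono mult_right_mono mult_left_mono) auto
      also have "\<dots> = S\<^sup>2" using S2 by simp
      finally show ?thesis using S0 by (rule power2_le_imp_le)
    qed
    have qn: "l2norm L q \<le> S * a"
    proof -
      have "(l2norm L q)\<^sup>2 \<le> (S * l2norm L u)\<^sup>2"
      proof -
        have "(\<integral>x. (norm (q x))\<^sup>2 \<partial>Om L) \<le> (\<integral>x. S\<^sup>2 * (norm (u x))\<^sup>2 \<partial>Om L)"
        proof (rule integral_mono[OF L2_norm_sq[OF qL]])
          show "integrable (Om L) (\<lambda>x. S\<^sup>2 * (norm (u x))\<^sup>2)" using L2_norm_sq[OF uL] by simp
          fix x assume "x \<in> space (Om L)"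
          then have "norm (u x) \<le> S" by (intro sup) (auto simp: space_restrict_space)
          then have "norm (u x) * norm (u x) \<le> S * norm (u x)" by (intro mult_right_mono) auto
          then have "\<bar>q x\<bar> \<le> S * norm (u x)" by (simp add: q_def power2_norm_eq_inner[symmetric] power2_eq_square)
          then have "\<bar>q x\<bar>\<^sup>2 \<le> (S * norm (u x))\<^sup>2" by (intro power_mono) auto
          then show "(norm (q x))\<^sup>2 \<le> S\<^sup>2 * (norm (u x))\<^sup>2" by (simp add: power_mult_distrib)
        qed
        then show ?thesis by (simp add: l2norm_sq_eq power_mult_distrib)
      qed
      then have "l2norm L q \<le> S * l2norm L u" by (rule power2_le_imp_le) (use S0 in simp)
      also have "\<dots> \<le> S * a" using ua S0 by (rule mult_left_mono)
      finally show ?thesis .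
    qed
    have dineq: "d\<^sup>2 \<le> 2 / h * a\<^sup>2 + \<bar>\<gamma>1\<bar> * (S * a * y) + \<bar>\<beta>\<bar> * (S\<^sup>2 * a\<^sup>2)"
    proof -
      have "l2ip L (\<lambda>x. u x - U x) (\<lambda>x. \<i> * u x) = l2ip L (\<lambda>x. (h / 2) *\<^sub>R F x) (\<lambda>x. \<i> * u x)"
        by (rule l2ip_cong[OF L2_diff[OF uL UL] L2_scaleR[OF VF(1)] iL[OF uL] iL[OF uL] uU aeq_refl])
      also have "\<dots> = h / 2 * (- d\<^sup>2 - \<gamma>1 * l2ip L v q - \<beta> * l2ip L q q)"
        unfolding l2ip_scaleR_left VF(5) by (simp add: d_def)
      also have "l2ip L (\<lambda>x. u x - U x) (\<lambda>x. \<i> * u x) = - l2ip L U (\<lambda>x. \<i> * u x)"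
        unfolding l2ip_diff_left[OF uL UL iL[OF uL]] by (simp add: l2ip_def[of L u] inner_ii_self)
      finally have "d\<^sup>2 = 2 / h * l2ip L U (\<lambda>x. \<i> * u x) - \<gamma>1 * l2ip L v q - \<beta> * l2ip L q q"
        using h by (simp add: field_simps)
      also have "\<dots> \<le> 2 / h * a\<^sup>2 + \<bar>\<gamma>1\<bar> * (S * a * y) + \<bar>\<beta>\<bar> * (S\<^sup>2 * a\<^sup>2)"
      proof -
        have "l2ip L U (\<lambda>x. \<i> * u x) \<le> l2norm L U * l2norm L (\<lambda>x. \<i> * u x)"
          using l2ip_le[OF UL iL[OF uL]] by simp
        also have "l2norm L (\<lambda>x. \<i> * u x) = l2norm L u" by (simp add: l2norm_def norm_mult)
        also have "l2norm L U * l2norm L u \<le> a\<^sup>2" unfolding a_def[symmetric] power2_eq_square using ua nn by (intro mult_left_mono)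
        finally have 1: "2 / h * l2ip L U (\<lambda>x. \<i> * u x) \<le> 2 / h * a\<^sup>2" using h by (intro mult_left_mono) auto
        have "\<bar>l2ip L v q\<bar> \<le> y * (S * a)"
          using order_trans[OF l2ip_le[OF vL qL] mult_left_mono[OF qn]] by (simp add: y_def)
        then have "\<bar>\<gamma>1 * l2ip L v q\<bar> \<le> \<bar>\<gamma>1\<bar> * (S * a * y)"
          unfolding abs_mult by (intro mult_left_mono) (auto simp: ac_simps)
        then have 2: "- (\<gamma>1 * l2ip L v q) \<le> \<bar>\<gamma>1\<bar> * (S * a * y)" by linarith
        have "\<bar>l2ip L q q\<bar> \<le> (S * a) * (S * a)"
          using order_trans[OF l2ip_le[OF qL qL] mult_mono[OF qn qn]] S0 nn by simp
        then have "\<bar>\<beta> * l2ip L q q\<bar> \<le> \<bar>\<beta>\<bar> * (S\<^sup>2 * a\<^sup>2)"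
          unfolding abs_mult by (intro mult_left_mono) (auto simp: power2_eq_square ac_simps)
        then have 3: "- (\<beta> * l2ip L q q) \<le> \<bar>\<beta>\<bar> * (S\<^sup>2 * a\<^sup>2)" by linarith
        show ?thesis using 1 2 3 by linarith
      qed
      finally show ?thesis .
    qed
    have yineq: "y\<^sup>2 \<le> b * y + \<kappa> * (a * d)"
    proof -
      have "l2ip L (\<lambda>x. v x - V x) v = l2ip L (\<lambda>x. (h / 2) *\<^sub>R G x) v"
        by (rule l2ip_cong[OF L2_diff[OF vL VL] L2_scaleR[OF VF(2)] vL vL vV aeq_refl])
      also have "\<dots> = h / 2 * (\<gamma>2 * l2ip L v r)"
        unfolding l2ip_scaleR_left l2ip_commute[of L G v] VF(3) ..
      finally have 1: "y\<^sup>2 = l2ip L V v + h / 2 * (\<gamma>2 * l2ip L v r)"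
        unfolding l2ip_diff_left[OF vL VL vL] by (simp add: y_def l2norm_sq)
      have "l2ip L (\<lambda>x. u x - U x) (\<lambda>x. \<i> * u1 x) = l2ip L (\<lambda>x. (h / 2) *\<^sub>R F x) (\<lambda>x. \<i> * u1 x)"
        by (rule l2ip_cong[OF L2_diff[OF uL UL] L2_scaleR[OF VF(1)] iL[OF u1L] iL[OF u1L] uU aeq_refl])
      also have "\<dots> = h / 2 * (- (\<gamma>1 / 2) * l2ip L v r)"
        unfolding l2ip_scaleR_left VF(4) ..
      finally have 2: "h / 2 * (\<gamma>2 * l2ip L v r) = - (\<gamma>2 / \<gamma>1 * 2) * l2ip L (\<lambda>x. u x - U x) (\<lambda>x. \<i> * u1 x)"
        using g by (auto simp: field_simps)
      have "\<bar>l2ip L (\<lambda>x. u x - U x) (\<lambda>x. \<i> * u1 x)\<bar> \<le> l2norm L (\<lambda>x. u x - U x) * l2norm L (\<lambda>x. \<i> * u1 x)"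
        by (rule l2ip_le[OF L2_diff[OF uL UL] iL[OF u1L]])
      also have "l2norm L (\<lambda>x. \<i> * u1 x) = d" by (simp add: l2norm_def norm_mult d_def)
      also have "l2norm L (\<lambda>x. u x - U x) * d \<le> (2 * a) * d"
      proof (rule mult_right_mono[OF _ nn(3)])
        have "l2norm L (\<lambda>x. u x - U x) \<le> l2norm L u + l2norm L (\<lambda>x. (-1) *\<^sub>R U x)"
          using l2norm_triangle[OF uL L2_scaleR[OF UL, of "-1"]] by simp
        then show "l2norm L (\<lambda>x. u x - U x) \<le> 2 * a" using ua unfolding l2norm_scaleR by (simp add: a_def)
      qed
      finally have "\<bar>l2ip L (\<lambda>x. u x - U x) (\<lambda>x. \<i> * u1 x)\<bar> \<le> 2 * a * d" .
      then have 3: "\<bar>\<gamma>2 / \<gamma>1 * 2\<bar> * \<bar>l2ip L (\<lambda>x. u x - U x) (\<lambda>x. \<i> * u1 x)\<bar> \<le> \<bar>\<gamma>2 / \<gamma>1 * 2\<bar> * (2 * a * d)"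
        by (rule mult_left_mono) simp
      have 4: "- (\<gamma>2 / \<gamma>1 * 2) * l2ip L (\<lambda>x. u x - U x) (\<lambda>x. \<i> * u1 x)
          \<le> \<bar>\<gamma>2 / \<gamma>1 * 2\<bar> * \<bar>l2ip L (\<lambda>x. u x - U x) (\<lambda>x. \<i> * u1 x)\<bar>"
        unfolding abs_mult[symmetric] mult_minus_left by (rule abs_ge_minus_self)
      have "h / 2 * (\<gamma>2 * l2ip L v r) \<le> \<bar>\<gamma>2 / \<gamma>1 * 2\<bar> * (2 * a * d)"
        unfolding 2 by (rule order_trans[OF 4 3])
      also have "\<dots> = \<kappa> * (a * d)" by (simp add: \<kappa>_def abs_mult)
      finally have "h / 2 * (\<gamma>2 * l2ip L v r) \<le> \<kappa> * (a * d)" .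
      moreover have "l2ip L V v \<le> b * y" using l2ip_le[OF VL vL] by (simp add: b_def y_def)
      ultimately show ?thesis unfolding 1 by linarith
    qed
    have "y \<le> C0 * (1 + b + a\<^sup>2)"
      unfolding C0_def
      by (rule midpoint_bound_real[OF nn S0 _ _ _ _ _ dineq _ yineq]) (use L h S2 in \<open>auto simp: \<kappa>_def\<close>)
    moreover have "l2norm L V' \<le> 2 * y + b"
    proof -
      have "l2norm L V' = l2norm L (\<lambda>x. 2 *\<^sub>R v x + (-1) *\<^sub>R V x)"
      proof (rule l2norm_cong[OF V'L L2_add[OF L2_scaleR[OF vL] L2_scaleR[OF VL]]])
        show "aeq L V' (\<lambda>x. 2 *\<^sub>R v x + (-1) *\<^sub>R V x)" using vm unfolding aeq_def by eventually_elim auto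
      qed
      also have "\<dots> \<le> l2norm L (\<lambda>x. 2 *\<^sub>R v x) + l2norm L (\<lambda>x. (-1) *\<^sub>R V x)"
        by (rule l2norm_triangle[OF L2_scaleR[OF vL] L2_scaleR[OF VL]])
      finally show ?thesis unfolding l2norm_scaleR by (simp add: y_def b_def)
    qed
    moreover have "(2 * C0 + 1) * (1 + b + a\<^sup>2) = 2 * (C0 * (1 + b + a\<^sup>2)) + (1 + b + a\<^sup>2)" by (simp only: distrib_right mult_1 mult.assoc)
    ultimately show "l2norm L V' \<le> (2 * C0 + 1) * (1 + l2norm L V + (l2norm L U)\<^sup>2)"
      unfolding a_def[symmetric] b_def[symmetric] using zero_le_power2[of a] by linarith
  qed
qed

section \<open>Independence of the past from later increments\<close>

context prob_space
begin

lemma indep_set_sym: "indep_set A B \<Longrightarrow> indep_set B A"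
  unfolding indep_sets2_eq by (metis Int_commute mult.commute)

lemma indep_var_swap: "indep_var S X T Y \<Longrightarrow> indep_var T Y S X"
  by (auto simp: indep_var_eq indep_set_sym)

lemma std_brownian_motion_meas: "std_brownian_motion M B \<Longrightarrow> 0 \<le> t \<Longrightarrow> B t \<in> borel_measurable M"
  by (simp add: std_brownian_motion_def)

text \<open>Over a finite grid, the past values are almost surely partial sums of increments, as the motion starts at \<open>0\<close>; the increments over
  the grid and the later increment are independent by assumption.\<close>

lemma brownian_past_indep_increment:
  assumes B: "std_brownian_motion M B" and S: "finite S" "S \<subseteq> {0..t}" and t: "0 \<le> t" "t < t'"
    and A: "\<And>s. A s \<in> sets borel" and C: "C \<in> sets borel"
  shows "prob {\<omega> \<in> space M. (\<forall>s\<in>S. B s \<omega> \<in> A s) \<and> B t' \<omega> - B t \<omega> \<in> C}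
    = prob {\<omega> \<in> space M. \<forall>s\<in>S. B s \<omega> \<in> A s} * prob {\<omega> \<in> space M. B t' \<omega> - B t \<omega> \<in> C}"
proof -
  note Bm = std_brownian_motion_meas[OF B]
  have Bt[measurable]: "B t \<in> borel_measurable M" "B t' \<in> borel_measurable M" using Bm t by auto
  have Bs: "B s \<in> borel_measurable M" if "s \<in> S" for s using Bm that S by auto
  have B0: "AE \<omega> in M. B 0 \<omega> = 0" using B by (simp add: std_brownian_motion_def)
  define xs where "xs = sorted_list_of_set (insert 0 S)"
  have xs: "set xs = insert 0 S" "sorted xs" using S set_sorted_list_of_set[of "insert 0 S"] sorted_sorted_list_of_set[of "insert 0 S"]
    by (simp_all only: xs_def finite_insert)
  define n where "n = length xs"
  have n0: "0 < n" using xs(1) by (cases xs) (auto simp: n_def)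
  have xsb: "xs ! j \<in> {0..t}" if "j < n" for j
    using nth_mem[of j xs] that xs(1) S t by (auto simp: n_def)
  \<comment> \<open>the grid \<open>S\<close> with \<open>0\<close> added, followed by \<open>t\<close> and then constantly \<open>t'\<close>, so that the increment number \<open>n\<close> is the later one\<close>
  define \<tau> where "\<tau> j = (if j < n then xs ! j else if j = n then t else t')" for j
  have \<tau>0: "\<tau> 0 = 0"
  proof -
    obtain j where j: "j < n" "xs ! j = 0" using xs(1) by (metis in_set_conv_nth insertI1 n_def)
    then have "xs ! 0 \<le> 0" using sorted_nth_mono[OF xs(2), of 0 j] by (simp add: n_def)
    then show ?thesis using xsb[OF n0] n0 by (simp add: \<tau>_def)
  qed
  have "mono \<tau>"
  proof (rule monoI)
    fix i j :: nat assume "i \<le> j"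
    then show "\<tau> i \<le> \<tau> j"
      using sorted_nth_mono[OF xs(2), of i j] xsb[of i] t by (auto simp: \<tau>_def n_def)
  qed
  define I where "I j \<omega> = B (\<tau> (Suc j)) \<omega> - B (\<tau> j) \<omega>" for j \<omega>
  have I: "indep_vars (\<lambda>_. borel) I UNIV"
    using B \<open>mono \<tau>\<close> \<tau>0 unfolding std_brownian_motion_def I_def[abs_def] by simp
  have In: "I n \<omega> = B t' \<omega> - B t \<omega>" for \<omega> by (simp add: I_def \<tau>_def)
  have "\<forall>s\<in>S. \<exists>j<n. xs ! j = s" using xs(1) by (metis in_set_conv_nth insertI2 n_def)
  then obtain k where k: "\<And>s. s \<in> S \<Longrightarrow> k s < n" "\<And>s. s \<in> S \<Longrightarrow> xs ! (k s) = s" by metis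
  have tel: "B (\<tau> m) \<omega> = B (\<tau> 0) \<omega> + (\<Sum>j<m. I j \<omega>)" for m \<omega>
    by (induction m) (simp_all add: I_def)
  have Bsum: "B s \<omega> = B 0 \<omega> + (\<Sum>j<k s. I j \<omega>)" if "s \<in> S" for s \<omega>
    using tel[of "k s" \<omega>] k[OF that] \<tau>0 by (simp add: \<tau>_def)
  have ind: "indep_var (PiM {..<n} (\<lambda>_. borel)) (\<lambda>\<omega>. restrict (\<lambda>i. I i \<omega>) {..<n})
      (PiM {n} (\<lambda>_. borel)) (\<lambda>\<omega>. restrict (\<lambda>i. I i \<omega>) {n})"
    by (rule indep_var_restrict[OF I]) auto
  define Xa where "Xa = {f \<in> space (PiM {..<n} (\<lambda>_. borel :: real measure)). \<forall>s\<in>S. (\<Sum>j<k s. f j) \<in> A s}"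
  define Xb where "Xb = {f \<in> space (PiM {n} (\<lambda>_. borel :: real measure)). f n \<in> C}"
  have Xa: "Xa \<in> sets (PiM {..<n} (\<lambda>_. borel))" unfolding Xa_def
  proof (rule sets.sets_Collect_finite_All[OF _ S(1)])
    fix s assume s: "s \<in> S"
    have "(\<lambda>f. \<Sum>j<k s. f j) \<in> borel_measurable (PiM {..<n} (\<lambda>_. borel :: real measure))"
      using k(1)[OF s] by (intro borel_measurable_sum measurable_component_singleton) auto
    from measurable_sets[OF this A[of s]]
    show "{f \<in> space (PiM {..<n} (\<lambda>_. borel)). (\<Sum>j<k s. f j) \<in> A s} \<in> sets (PiM {..<n} (\<lambda>_. borel))"
      by (simp add: vimage_def Int_def conj_commute)
  qed
  have Xb: "Xb \<in> sets (PiM {n} (\<lambda>_. borel))"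
  proof -
    have "(\<lambda>f. f n) \<in> borel_measurable (PiM {n} (\<lambda>_. borel :: real measure))" by measurable
    from measurable_sets[OF this C] show ?thesis by (simp add: Xb_def vimage_def Int_def conj_commute)
  qed
  let ?R = "\<lambda>\<omega>. restrict (\<lambda>i. I i \<omega>) {..<n}" and ?Q = "\<lambda>\<omega>. restrict (\<lambda>i. I i \<omega>) {n}"
  have Rin: "?R \<omega> \<in> Xa \<longleftrightarrow> (\<forall>s\<in>S. (\<Sum>j<k s. I j \<omega>) \<in> A s)" for \<omega>
  proof -
    have "(\<Sum>j<k s. ?R \<omega> j) = (\<Sum>j<k s. I j \<omega>)" if "s \<in> S" for s
      using k(1)[OF that] by (intro sum.cong) auto
    then show ?thesis by (auto simp: Xa_def space_PiM)
  qed
  have Qin: "?Q \<omega> \<in> Xb \<longleftrightarrow> B t' \<omega> - B t \<omega> \<in> C" for \<omega> by (auto simp: Xb_def space_PiM In)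
  have e1: "AE \<omega> in M. (\<forall>s\<in>S. B s \<omega> \<in> A s) \<longleftrightarrow> ?R \<omega> \<in> Xa"
    using B0 by eventually_elim (simp add: Rin Bsum)
  have GM: "{\<omega> \<in> space M. \<forall>s\<in>S. B s \<omega> \<in> A s} \<in> sets M"
  proof (rule sets.sets_Collect_finite_All[OF _ S(1)])
    fix s assume "s \<in> S"
    from measurable_sets[OF Bs[OF this] A[of s]] show "{\<omega> \<in> space M. B s \<omega> \<in> A s} \<in> sets M"
      by (simp add: vimage_def Int_def conj_commute)
  qed
  have HM: "{\<omega> \<in> space M. B t' \<omega> - B t \<omega> \<in> C} \<in> sets M"
    using C by measurable
  have RM: "?R -` Xa \<inter> space M \<in> sets M" and QM: "?Q -` Xb \<inter> space M \<in> sets M"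
    using ind Xa Xb by (auto simp: indep_var_eq intro: measurable_sets)
  have "prob {\<omega> \<in> space M. (\<forall>s\<in>S. B s \<omega> \<in> A s) \<and> B t' \<omega> - B t \<omega> \<in> C}
      = prob ((\<lambda>\<omega>. (?R \<omega>, ?Q \<omega>)) -` (Xa \<times> Xb) \<inter> space M)"
  proof (rule finite_measure_eq_AE)
    show "AE x in M. x \<in> {\<omega> \<in> space M. (\<forall>s\<in>S. B s \<omega> \<in> A s) \<and> B t' \<omega> - B t \<omega> \<in> C}
        \<longleftrightarrow> x \<in> (\<lambda>\<omega>. (?R \<omega>, ?Q \<omega>)) -` (Xa \<times> Xb) \<inter> space M"
      using e1 by eventually_elim (auto simp: Qin)
    have "{\<omega> \<in> space M. (\<forall>s\<in>S. B s \<omega> \<in> A s) \<and> B t' \<omega> - B t \<omega> \<in> C}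
      = {\<omega> \<in> space M. \<forall>s\<in>S. B s \<omega> \<in> A s} \<inter> {\<omega> \<in> space M. B t' \<omega> - B t \<omega> \<in> C}" by auto
    then show "{\<omega> \<in> space M. (\<forall>s\<in>S. B s \<omega> \<in> A s) \<and> B t' \<omega> - B t \<omega> \<in> C} \<in> sets M" using GM HM by auto
    have "(\<lambda>\<omega>. (?R \<omega>, ?Q \<omega>)) -` (Xa \<times> Xb) \<inter> space M = (?R -` Xa \<inter> space M) \<inter> (?Q -` Xb \<inter> space M)" by auto
    then show "(\<lambda>\<omega>. (?R \<omega>, ?Q \<omega>)) -` (Xa \<times> Xb) \<inter> space M \<in> sets M" using RM QM by auto
  qed
  also have "\<dots> = prob (?R -` Xa \<inter> space M) * prob (?Q -` Xb \<inter> space M)"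
    by (rule indep_varD[OF ind Xa Xb])
  also have "prob (?R -` Xa \<inter> space M) = prob {\<omega> \<in> space M. \<forall>s\<in>S. B s \<omega> \<in> A s}"
    by (rule finite_measure_eq_AE[OF _ RM GM]) (use e1 in eventually_elim, auto)
  also have "?Q -` Xb \<inter> space M = {\<omega> \<in> space M. B t' \<omega> - B t \<omega> \<in> C}" using Qin by auto
  finally show ?thesis .
qed

text \<open>The coordinate processes are independent, and within each of them past and increment are; so all probabilities factorize.\<close>

lemma wiener_past_indep_increment:
  assumes W: "cylindrical_wiener L M e B" and S: "finite S" "S \<subseteq> {0..t}" and t: "0 \<le> t" "t < t'"
    and J: "finite J" and A: "\<And>i s. A i s \<in> sets borel" and C: "\<And>i. C i \<in> sets borel"
  shows "prob {\<omega> \<in> space M. (\<forall>i\<in>J. \<forall>s\<in>S. B i s \<omega> \<in> A i s) \<and> (\<forall>i\<in>J. B i t' \<omega> - B i t \<omega> \<in> C i)}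
    = prob {\<omega> \<in> space M. \<forall>i\<in>J. \<forall>s\<in>S. B i s \<omega> \<in> A i s} * prob {\<omega> \<in> space M. \<forall>i\<in>J. B i t' \<omega> - B i t \<omega> \<in> C i}"
proof (cases "J = {}")
  case True
  then show ?thesis by (simp add: prob_space)
next
  case False
  have BM: "std_brownian_motion M (B i)" for i using W by (simp add: cylindrical_wiener_def)
  let ?P = "PiM {0..} (\<lambda>_. borel :: real measure)"
  let ?X = "\<lambda>i \<omega>. \<lambda>t\<in>{0..}. B i t \<omega>"
  have ind: "indep_vars (\<lambda>_. ?P) ?X UNIV" using W by (simp add: cylindrical_wiener_def)
  define G where "G i = {f \<in> space ?P. \<forall>s\<in>S. f s \<in> A i s}" for i
  define H where "H i = {f \<in> space ?P. f t' - f t \<in> C i}" for i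
  have G: "G i \<in> sets ?P" for i unfolding G_def
  proof (rule sets.sets_Collect_finite_All[OF _ S(1)])
    fix s assume "s \<in> S"
    then have "(\<lambda>f. f s) \<in> borel_measurable ?P" using S by (intro measurable_component_singleton) auto
    from measurable_sets[OF this A[of i s]] show "{f \<in> space ?P. f s \<in> A i s} \<in> sets ?P"
      by (simp add: vimage_def Int_def conj_commute)
  qed
  have H: "H i \<in> sets ?P" for i
  proof -
    have "(\<lambda>f. f t' - f t) \<in> borel_measurable ?P"
      using t by (intro borel_measurable_diff measurable_component_singleton) auto
    from measurable_sets[OF this C[of i]] show ?thesis by (simp add: H_def vimage_def Int_def conj_commute)
  qed
  have Gin: "?X i -` G i \<inter> space M = {\<omega> \<in> space M. \<forall>s\<in>S. B i s \<omega> \<in> A i s}" for i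
    using S by (auto simp: G_def space_PiM)
  have Gin': "?X i \<omega> \<in> G i \<longleftrightarrow> (\<forall>s\<in>S. B i s \<omega> \<in> A i s)" for i \<omega>
    using S by (auto simp: G_def space_PiM)
  have Hin': "?X i \<omega> \<in> H i \<longleftrightarrow> B i t' \<omega> - B i t \<omega> \<in> C i" for i \<omega>
    using t by (auto simp: H_def space_PiM)
  have Hin: "?X i -` H i \<inter> space M = {\<omega> \<in> space M. B i t' \<omega> - B i t \<omega> \<in> C i}" for i
    using t by (auto simp: H_def space_PiM)
  have prod: "prob {\<omega> \<in> space M. \<forall>i\<in>J. ?X i \<omega> \<in> E i} = (\<Prod>i\<in>J. prob (?X i -` E i \<inter> space M))"
    if "\<And>i. E i \<in> sets ?P" for E
  proof -
    have "{\<omega> \<in> space M. \<forall>i\<in>J. ?X i \<omega> \<in> E i} = (\<Inter>i\<in>J. ?X i -` E i \<inter> space M)" using False by auto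
    then show ?thesis using indep_varsD[OF ind False J _ that] by simp
  qed
  have "prob {\<omega> \<in> space M. (\<forall>i\<in>J. \<forall>s\<in>S. B i s \<omega> \<in> A i s) \<and> (\<forall>i\<in>J. B i t' \<omega> - B i t \<omega> \<in> C i)}
     = prob {\<omega> \<in> space M. \<forall>i\<in>J. ?X i \<omega> \<in> G i \<inter> H i}"
    by (intro arg_cong[where f=prob]) (auto simp only: Gin' Hin' Int_iff)
  also have "\<dots> = (\<Prod>i\<in>J. prob (?X i -` (G i \<inter> H i) \<inter> space M))" by (rule prod) (use G H in auto)
  also have "\<dots> = (\<Prod>i\<in>J. prob (?X i -` G i \<inter> space M) * prob (?X i -` H i \<inter> space M))"
  proof (rule prod.cong[OF refl])
    fix i
    have "?X i -` (G i \<inter> H i) \<inter> space M = {\<omega> \<in> space M. (\<forall>s\<in>S. B i s \<omega> \<in> A i s) \<and> B i t' \<omega> - B i t \<omega> \<in> C i}"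
      by (auto simp only: Gin' Hin' Int_iff vimage_eq)
    then show "prob (?X i -` (G i \<inter> H i) \<inter> space M) = prob (?X i -` G i \<inter> space M) * prob (?X i -` H i \<inter> space M)"
      using brownian_past_indep_increment[where A="A i" and C="C i" and B="B i", OF BM S t A C] unfolding Gin Hin by simp
  qed
  also have "\<dots> = (\<Prod>i\<in>J. prob (?X i -` G i \<inter> space M)) * (\<Prod>i\<in>J. prob (?X i -` H i \<inter> space M))"
    by (rule prod.distrib)
  also have "(\<Prod>i\<in>J. prob (?X i -` G i \<inter> space M)) = prob {\<omega> \<in> space M. \<forall>i\<in>J. ?X i \<omega> \<in> G i}" by (rule prod[symmetric]) (rule G)
  also have "{\<omega> \<in> space M. \<forall>i\<in>J. ?X i \<omega> \<in> G i} = {\<omega> \<in> space M. \<forall>i\<in>J. \<forall>s\<in>S. B i s \<omega> \<in> A i s}" by (simp only: Gin')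
  also have "(\<Prod>i\<in>J. prob (?X i -` H i \<inter> space M)) = prob {\<omega> \<in> space M. \<forall>i\<in>J. ?X i \<omega> \<in> H i}" by (rule prod[symmetric]) (rule H)
  also have "{\<omega> \<in> space M. \<forall>i\<in>J. ?X i \<omega> \<in> H i} = {\<omega> \<in> space M. \<forall>i\<in>J. B i t' \<omega> - B i t \<omega> \<in> C i}" by (simp only: Hin')
  finally show ?thesis .
qed

lemma indep_wiener_sym: "indep_wiener M B1 B2 \<Longrightarrow> indep_wiener M B2 B1"
  unfolding indep_wiener_def by (rule indep_var_swap)

lemma wiener_filtration_sym: "wiener_filtration M B1 B2 t = wiener_filtration M B2 B1 t"
  unfolding wiener_filtration_def by (simp add: insert_commute)

text \<open>The past of the second process is independent of everything that concerns the first one, its increment included.\<close>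

lemma two_wiener_past_indep_increment:
  assumes W1: "cylindrical_wiener L M e1 B1" and W2: "cylindrical_wiener L M e2 B2" and ind: "indep_wiener M B1 B2"
    and S: "finite S" "S \<subseteq> {0..t}" and t: "0 \<le> t" "t < t'"
    and J: "finite J" and A1: "\<And>i s. A1 i s \<in> sets borel" and A2: "\<And>i s. A2 i s \<in> sets borel" and C: "\<And>i. C i \<in> sets borel"
  shows "prob ({\<omega> \<in> space M. \<forall>i\<in>J. \<forall>s\<in>S. B1 i s \<omega> \<in> A1 i s \<and> B2 i s \<omega> \<in> A2 i s} \<inter> {\<omega> \<in> space M. \<forall>i\<in>J. B1 i t' \<omega> - B1 i t \<omega> \<in> C i})
    = prob {\<omega> \<in> space M. \<forall>i\<in>J. \<forall>s\<in>S. B1 i s \<omega> \<in> A1 i s \<and> B2 i s \<omega> \<in> A2 i s} * prob {\<omega> \<in> space M. \<forall>i\<in>J. B1 i t' \<omega> - B1 i t \<omega> \<in> C i}"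
proof -
  let ?P = "PiM (UNIV \<times> {0..}) (\<lambda>_. borel :: real measure) :: (nat \<times> real \<Rightarrow> real) measure"
  let ?X = "\<lambda>B \<omega>. \<lambda>(i, t)\<in>UNIV \<times> {0..}. B i t \<omega>"
  have ind: "indep_var ?P (?X B1) ?P (?X B2)" using ind by (simp add: indep_wiener_def)
  define G where "G A = {f \<in> space ?P. \<forall>i\<in>J. \<forall>s\<in>S. f (i, s) \<in> A i s}" for A :: "nat \<Rightarrow> real \<Rightarrow> real set"
  define H where "H = {f \<in> space ?P. \<forall>i\<in>J. f (i, t') - f (i, t) \<in> C i}"
  have G: "G A \<in> sets ?P" if A: "\<And>i s. A i s \<in> sets borel" for A unfolding G_def
  proof (intro sets.sets_Collect_finite_All J S(1))
    fix i s assume "s \<in> S"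
    then have "(\<lambda>f. f (i, s)) \<in> borel_measurable ?P" using S by (intro measurable_component_singleton) auto
    from measurable_sets[OF this A[of i s]] show "{f \<in> space ?P. f (i, s) \<in> A i s} \<in> sets ?P"
      by (simp add: vimage_def Int_def conj_commute)
  qed
  have G1: "G A1 \<in> sets ?P" and G2: "G A2 \<in> sets ?P" by (rule G, rule A1, rule G, rule A2)
  have H: "H \<in> sets ?P" unfolding H_def
  proof (intro sets.sets_Collect_finite_All J)
    fix i
    have "(\<lambda>f. f (i, t') - f (i, t)) \<in> borel_measurable ?P"
      using t by (intro borel_measurable_diff measurable_component_singleton) auto
    from measurable_sets[OF this C[of i]] show "{f \<in> space ?P. f (i, t') - f (i, t) \<in> C i} \<in> sets ?P"
      by (simp add: vimage_def Int_def conj_commute)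
  qed
  have Gin: "?X B -` G A \<inter> space M = {\<omega> \<in> space M. \<forall>i\<in>J. \<forall>s\<in>S. B i s \<omega> \<in> A i s}" for A and B :: "nat \<Rightarrow> real \<Rightarrow> 'a \<Rightarrow> real"
    using S by (auto simp: G_def space_PiM)
  have Hin: "?X B -` H \<inter> space M = {\<omega> \<in> space M. \<forall>i\<in>J. B i t' \<omega> - B i t \<omega> \<in> C i}" for B :: "nat \<Rightarrow> real \<Rightarrow> 'a \<Rightarrow> real"
    using t by (auto simp: H_def space_PiM)
  let ?G1 = "{\<omega> \<in> space M. \<forall>i\<in>J. \<forall>s\<in>S. B1 i s \<omega> \<in> A1 i s}" and ?G2 = "{\<omega> \<in> space M. \<forall>i\<in>J. \<forall>s\<in>S. B2 i s \<omega> \<in> A2 i s}"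
    and ?H = "{\<omega> \<in> space M. \<forall>i\<in>J. B1 i t' \<omega> - B1 i t \<omega> \<in> C i}"
  have GG: "{\<omega> \<in> space M. \<forall>i\<in>J. \<forall>s\<in>S. B1 i s \<omega> \<in> A1 i s \<and> B2 i s \<omega> \<in> A2 i s} = ?G1 \<inter> ?G2" by auto
  have 1: "prob (?G1 \<inter> ?G2) = prob ?G1 * prob ?G2"
  proof -
    have "(\<lambda>\<omega>. (?X B1 \<omega>, ?X B2 \<omega>)) -` (G A1 \<times> G A2) \<inter> space M = (?X B1 -` G A1 \<inter> space M) \<inter> (?X B2 -` G A2 \<inter> space M)" by auto
    then show ?thesis using indep_varD[OF ind G1 G2] unfolding Gin by simp
  qed
  have 2: "prob ((?G1 \<inter> ?H) \<inter> ?G2) = prob (?G1 \<inter> ?H) * prob ?G2"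
  proof -
    have "(\<lambda>\<omega>. (?X B1 \<omega>, ?X B2 \<omega>)) -` ((G A1 \<inter> H) \<times> G A2) \<inter> space M
      = ((?X B1 -` G A1 \<inter> space M) \<inter> (?X B1 -` H \<inter> space M)) \<inter> (?X B2 -` G A2 \<inter> space M)" by auto
    moreover have "?X B1 -` (G A1 \<inter> H) \<inter> space M = (?X B1 -` G A1 \<inter> space M) \<inter> (?X B1 -` H \<inter> space M)" by auto
    moreover have "G A1 \<inter> H \<in> sets ?P" using G1 H by auto
    ultimately show ?thesis using indep_varD[OF ind _ G2, of "G A1 \<inter> H"] unfolding Gin Hin by simp
  qed
  have "?G1 \<inter> ?H = {\<omega> \<in> space M. (\<forall>i\<in>J. \<forall>s\<in>S. B1 i s \<omega> \<in> A1 i s) \<and> (\<forall>i\<in>J. B1 i t' \<omega> - B1 i t \<omega> \<in> C i)}" by auto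
  then have 3: "prob (?G1 \<inter> ?H) = prob ?G1 * prob ?H"
    using wiener_past_indep_increment[where B=B1 and A=A1 and C=C, OF W1 S t J A1 C] by simp
  have "(?G1 \<inter> ?G2) \<inter> ?H = (?G1 \<inter> ?H) \<inter> ?G2" by auto
  then show ?thesis unfolding GG using 1 2 3 by simp
qed

text \<open>Generated by finite intersections of events for the single increments, so that the generator is stable under intersections.\<close>

definition increment_algebra :: "(nat \<Rightarrow> real \<Rightarrow> 'a \<Rightarrow> real) \<Rightarrow> real \<Rightarrow> real \<Rightarrow> 'a measure" where
  "increment_algebra B t t' = sigma (space M)
     {{\<omega> \<in> space M. \<forall>i\<in>J. B i t' \<omega> - B i t \<omega> \<in> C i} | J C. finite J \<and> (\<forall>i. C i \<in> sets borel)}"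

text \<open>Cylinder events of both processes before time \<open>t\<close>, together with the null sets, form an intersection-stable generator of the
  augmented filtration. It is independent of the cylinder events of the increments, and independence passes to the generated algebras.
  Including the null sets in the generator takes care of the augmentation.\<close>

lemma filtration_indep_increments:
  assumes W1: "cylindrical_wiener L M e1 B1" and W2: "cylindrical_wiener L M e2 B2" and ind: "indep_wiener M B1 B2"
    and t: "0 \<le> t" "t < t'"
  shows "indep_set (sets (wiener_filtration M B1 B2 t)) (sets (increment_algebra B1 t t'))"
proof -
  define Ev where "Ev J S A1 A2 = {\<omega> \<in> space M. \<forall>i\<in>J. \<forall>s\<in>S. B1 i s \<omega> \<in> A1 i s \<and> B2 i s \<omega> \<in> A2 i s}"
    for J :: "nat set" and S :: "real set" and A1 A2 :: "nat \<Rightarrow> real \<Rightarrow> real set"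
  define PP where "PP = {Ev J S A1 A2 | J S A1 A2. finite J \<and> finite S \<and> S \<subseteq> {0..t} \<and> (\<forall>i s. A1 i s \<in> sets borel) \<and> (\<forall>i s. A2 i s \<in> sets borel)} \<union> null_sets M"
  define Hv where "Hv J C = {\<omega> \<in> space M. \<forall>i\<in>J. B1 i t' \<omega> - B1 i t \<omega> \<in> C i}" for J :: "nat set" and C :: "nat \<Rightarrow> real set"
  define HH where "HH = {Hv J C | J C. finite J \<and> (\<forall>i. C i \<in> sets borel)}"
  have m1: "B1 i s \<in> borel_measurable M" if "0 \<le> s" for i s
    using W1 that by (auto simp: cylindrical_wiener_def intro: std_brownian_motion_meas)
  have m2: "B2 i s \<in> borel_measurable M" if "0 \<le> s" for i s
    using W2 that by (auto simp: cylindrical_wiener_def intro: std_brownian_motion_meas)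
  have Ev_sets: "Ev J S A1 A2 \<in> sets M"
    if "finite J" "finite S" "S \<subseteq> {0..t}" "\<forall>i s. A1 i s \<in> sets borel" "\<forall>i s. A2 i s \<in> sets borel" for J S A1 A2
    unfolding Ev_def
  proof (intro sets.sets_Collect_finite_All sets.sets_Collect_conj that(1,2))
    fix i s assume "s \<in> S"
    then have s: "0 \<le> s" using that by auto
    show "{\<omega> \<in> space M. B1 i s \<omega> \<in> A1 i s} \<in> sets M"
      using measurable_sets[OF m1[OF s], of "A1 i s"] that by (simp add: vimage_def Int_def conj_commute)
    show "{\<omega> \<in> space M. B2 i s \<omega> \<in> A2 i s} \<in> sets M"
      using measurable_sets[OF m2[OF s], of "A2 i s"] that by (simp add: vimage_def Int_def conj_commute)
  qed
  have Hv_sets: "Hv J C \<in> sets M" if "finite J" "\<forall>i. C i \<in> sets borel" for J C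
    unfolding Hv_def
  proof (intro sets.sets_Collect_finite_All that(1))
    fix i
    have "(\<lambda>\<omega>. B1 i t' \<omega> - B1 i t \<omega>) \<in> borel_measurable M" using m1 t by (intro borel_measurable_diff) auto
    from measurable_sets[OF this, of "C i"] that show "{\<omega> \<in> space M. B1 i t' \<omega> - B1 i t \<omega> \<in> C i} \<in> sets M"
      by (simp add: vimage_def Int_def conj_commute)
  qed
  have "indep_set PP HH"
    unfolding indep_sets2_eq
  proof (intro conjI ballI)
    show "PP \<subseteq> events" unfolding PP_def using Ev_sets by auto
    show "HH \<subseteq> events" unfolding HH_def using Hv_sets by auto
    fix a b assume a: "a \<in> PP" and b: "b \<in> HH"
    obtain J' C where b': "b = Hv J' C" "finite J'" "\<forall>i. C i \<in> sets borel" using b by (auto simp: HH_def)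
    have bM: "b \<in> sets M" using b' Hv_sets by simp
    show "prob (a \<inter> b) = prob a * prob b"
    proof (cases "a \<in> null_sets M")
      case True
      then have "a \<inter> b \<in> null_sets M" using bM by (rule null_set_Int2)
      then show ?thesis using True by (simp add: measure_def null_sets_def)
    next
      case False
      then obtain J S A1 A2 where a': "a = Ev J S A1 A2" "finite J" "finite S" "S \<subseteq> {0..t}"
        "\<forall>i s. A1 i s \<in> sets borel" "\<forall>i s. A2 i s \<in> sets borel" using a by (auto simp: PP_def)
      define A1' where "A1' i s = (if i \<in> J then A1 i s else UNIV)" for i s
      define A2' where "A2' i s = (if i \<in> J then A2 i s else UNIV)" for i s
      define C' where "C' i = (if i \<in> J' then C i else UNIV)" for i
      have "a = {\<omega> \<in> space M. \<forall>i\<in>J \<union> J'. \<forall>s\<in>S. B1 i s \<omega> \<in> A1' i s \<and> B2 i s \<omega> \<in> A2' i s}"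
        unfolding a' Ev_def A1'_def A2'_def by auto
      moreover have "b = {\<omega> \<in> space M. \<forall>i\<in>J \<union> J'. B1 i t' \<omega> - B1 i t \<omega> \<in> C' i}"
        unfolding b' Hv_def C'_def by auto
      ultimately show ?thesis
        using two_wiener_past_indep_increment[OF W1 W2 ind a'(3,4) t, of "J \<union> J'" A1' A2' C'] a' b'
        by (simp add: A1'_def A2'_def C'_def)
    qed
  qed
  moreover have "Int_stable PP"
  proof (rule Int_stableI)
    fix a b assume a: "a \<in> PP" and b: "b \<in> PP"
    have M: "a \<in> sets M" "b \<in> sets M" using a b Ev_sets by (auto simp: PP_def)
    show "a \<inter> b \<in> PP"
    proof (cases "a \<in> null_sets M \<or> b \<in> null_sets M")
      case True
      then have "a \<inter> b \<in> null_sets M" using M null_set_Int1 null_set_Int2 by blast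
      then show ?thesis by (simp add: PP_def)
    next
      case False
      then obtain J S A1 A2 where a': "a = Ev J S A1 A2" "finite J" "finite S" "S \<subseteq> {0..t}"
        "\<forall>i s. A1 i s \<in> sets borel" "\<forall>i s. A2 i s \<in> sets borel" using a by (auto simp: PP_def)
      obtain J' S' A1' A2' where b': "b = Ev J' S' A1' A2'" "finite J'" "finite S'" "S' \<subseteq> {0..t}"
        "\<forall>i s. A1' i s \<in> sets borel" "\<forall>i s. A2' i s \<in> sets borel" using b False by (auto simp: PP_def)
      define D where "D A A' i s = (if i \<in> J \<and> s \<in> S then A i s else UNIV) \<inter> (if i \<in> J' \<and> s \<in> S' then A' i s else UNIV)"
        for A A' :: "nat \<Rightarrow> real \<Rightarrow> real set" and i s
      have "a \<inter> b = Ev (J \<union> J') (S \<union> S') (D A1 A1') (D A2 A2')"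
        unfolding a'(1) b'(1) Ev_def D_def by (auto split: if_splits)
      moreover have "\<forall>i s. D A1 A1' i s \<in> sets borel" "\<forall>i s. D A2 A2' i s \<in> sets borel"
        using a' b' by (auto simp: D_def)
      ultimately show ?thesis unfolding PP_def using a' b' by blast
    qed
  qed
  moreover have "Int_stable HH"
  proof (rule Int_stableI)
    fix a b assume "a \<in> HH" and "b \<in> HH"
    then obtain J C J' C' where a': "a = Hv J C" "finite J" "\<forall>i. C i \<in> sets borel"
      and b': "b = Hv J' C'" "finite J'" "\<forall>i. C' i \<in> sets borel" by (auto simp: HH_def)
    have "a \<inter> b = Hv (J \<union> J') (\<lambda>i. (if i \<in> J then C i else UNIV) \<inter> (if i \<in> J' then C' i else UNIV))"
      unfolding a' b' Hv_def by (auto split: if_splits)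
    moreover have "\<forall>i. (if i \<in> J then C i else UNIV) \<inter> (if i \<in> J' then C' i else UNIV) \<in> sets borel" using a' b' by auto
    ultimately show "a \<inter> b \<in> HH" unfolding HH_def using a' b' by blast
  qed
  ultimately have *: "indep_set (sigma_sets (space M) PP) (sigma_sets (space M) HH)" by (rule indep_set_sigma_sets)
  have HH: "sets (increment_algebra B1 t t') = sigma_sets (space M) HH"
    unfolding increment_algebra_def HH_def Hv_def by (rule sets_measure_of) auto
  let ?Gen = "{B i s -` A \<inter> space M | B i s A. B \<in> {B1, B2} \<and> 0 \<le> s \<and> s \<le> t \<and> A \<in> sets borel} \<union> null_sets M"
  have "sets (wiener_filtration M B1 B2 t) = sigma_sets (space M) ?Gen"
    unfolding wiener_filtration_def
    by (rule sets_measure_of) (auto dest: null_setsD2 sets.sets_into_space)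
  also have "\<dots> \<subseteq> sigma_sets (space M) PP"
  proof (rule sigma_sets_mono, rule subsetI)
    fix a assume "a \<in> ?Gen"
    then consider "a \<in> null_sets M" | B i s A where "B = B1 \<or> B = B2" "0 \<le> s" "s \<le> t" "A \<in> sets borel" "a = B i s -` A \<inter> space M" by blast
    then have "a \<in> PP"
    proof cases
      case 1 then show ?thesis by (simp add: PP_def)
    next
      case 2
      have "a = Ev {i} {s} (\<lambda>_ _. if B = B1 then A else UNIV) (\<lambda>_ _. if B = B1 then UNIV else A)"
        using 2 by (auto simp: Ev_def)
      then show ?thesis unfolding PP_def using 2 by (intro UnI1) (auto intro!: exI)
    qed
    then show "a \<in> sigma_sets (space M) PP" by auto
  qed
  finally show ?thesis using * unfolding HH indep_sets2_eq by blast
qed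

lemma indep_algebras_mult:
  fixes Y Z :: "'a \<Rightarrow> real"
  assumes ind: "indep_set (sets F) (sets G)" and sp: "space F = space M" "space G = space M"
    and Y: "Y \<in> borel_measurable F" and Z: "Z \<in> borel_measurable G"
    and i: "integrable M Y" "integrable M Z"
  shows "integrable M (\<lambda>\<omega>. Y \<omega> * Z \<omega>)" "expectation (\<lambda>\<omega>. Y \<omega> * Z \<omega>) = expectation Y * expectation Z"
proof -
  have "sigma_sets (space F) {Y -` A \<inter> space F |A. A \<in> sets borel} \<subseteq> sets F"
    by (rule sets.sigma_sets_subset) (use measurable_sets[OF Y] in auto)
  moreover have "sigma_sets (space G) {Z -` A \<inter> space G |A. A \<in> sets borel} \<subseteq> sets G"
    by (rule sets.sigma_sets_subset) (use measurable_sets[OF Z] in auto)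
  ultimately have "indep_var borel Y borel Z"
    unfolding indep_var_eq using ind i unfolding indep_sets2_eq sp by blast
  then show "integrable M (\<lambda>\<omega>. Y \<omega> * Z \<omega>)" "expectation (\<lambda>\<omega>. Y \<omega> * Z \<omega>) = expectation Y * expectation Z"
    using indep_var_integrable indep_var_lebesgue_integral i by blast+
qed

lemma increment_measurable:
  "(\<lambda>\<omega>. B i t' \<omega> - B i t \<omega>) \<in> borel_measurable (increment_algebra B t t')"
proof (rule measurableI)
  fix A :: "real set" assume A: "A \<in> sets borel"
  have "{\<omega> \<in> space M. \<forall>j\<in>{i}. B j t' \<omega> - B j t \<omega> \<in> A} \<in> sets (increment_algebra B t t')"
    unfolding increment_algebra_def using A by (subst sets_measure_of) (auto intro!: sigma_sets.Basic exI[of _ "{i}"])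
  moreover have "space (increment_algebra B t t') = space M" unfolding increment_algebra_def by (rule space_measure_of) auto
  ultimately show "(\<lambda>\<omega>. B i t' \<omega> - B i t \<omega>) -` A \<inter> space (increment_algebra B t t') \<in> sets (increment_algebra B t t')"
    by (simp add: vimage_def Int_def conj_commute)
qed simp

lemma space_increment_algebra[simp]: "space (increment_algebra B t t') = space M"
  unfolding increment_algebra_def by (rule space_measure_of) auto

lemma space_wiener_filtration[simp]: "space (wiener_filtration M B1 B2 t) = space M"
  unfolding wiener_filtration_def by (rule space_measure_of) (auto dest: null_setsD2 sets.sets_into_space)

lemma increment_moments:
  assumes W: "cylindrical_wiener L M e B" and t: "0 \<le> t" "t < t'"
  shows "integrable M (\<lambda>\<omega>. B i t' \<omega> - B i t \<omega>)" "expectation (\<lambda>\<omega>. B i t' \<omega> - B i t \<omega>) = 0"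
    "integrable M (\<lambda>\<omega>. (B i t' \<omega> - B i t \<omega>) * (B j t' \<omega> - B j t \<omega>))"
    "expectation (\<lambda>\<omega>. (B i t' \<omega> - B i t \<omega>) * (B j t' \<omega> - B j t \<omega>)) = (if i = j then t' - t else 0)"
proof -
  have \<sigma>: "sqrt (t' - t) > 0" using t by simp
  have d: "distributed M lborel (\<lambda>\<omega>. B i t' \<omega> - B i t \<omega>) (normal_density 0 (sqrt (t' - t)))" for i
    using W t by (auto simp: cylindrical_wiener_def std_brownian_motion_def)
  have i1: "integrable M (\<lambda>\<omega>. B i t' \<omega> - B i t \<omega>)" for i
    using distributed_integrable[OF d, of "\<lambda>x. x" i] integrable_normal_moment_nz_1[OF \<sigma>, of 0] by simp
  have e1: "expectation (\<lambda>\<omega>. B i t' \<omega> - B i t \<omega>) = 0" for i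
    using distributed_integral[OF d, of "\<lambda>x. x" i] integral_normal_moment_nz_1[OF \<sigma>, of 0] by simp
  have i2: "integrable M (\<lambda>\<omega>. (B i t' \<omega> - B i t \<omega>)\<^sup>2)" for i
    using distributed_integrable[OF d, of "\<lambda>x. x\<^sup>2" i] integrable_normal_moment[OF \<sigma>, of 0 2] by simp
  have e2: "expectation (\<lambda>\<omega>. (B i t' \<omega> - B i t \<omega>)\<^sup>2) = t' - t" for i
    using distributed_integral[OF d, of "\<lambda>x. x\<^sup>2" i] integral_normal_moment_even[OF \<sigma>, of 0 1] t by simp
  show "integrable M (\<lambda>\<omega>. B i t' \<omega> - B i t \<omega>)" "expectation (\<lambda>\<omega>. B i t' \<omega> - B i t \<omega>) = 0" by (rule i1 e1)+
  have "integrable M (\<lambda>\<omega>. (B i t' \<omega> - B i t \<omega>) * (B j t' \<omega> - B j t \<omega>))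
    \<and> expectation (\<lambda>\<omega>. (B i t' \<omega> - B i t \<omega>) * (B j t' \<omega> - B j t \<omega>)) = (if i = j then t' - t else 0)"
  proof (cases "i = j")
    case True
    then show ?thesis using i2[of j] e2[of j] by (simp add: power2_eq_square)
  next
    case False
    have W': "indep_vars (\<lambda>_. PiM {0..} (\<lambda>_. borel)) (\<lambda>i \<omega>. \<lambda>t\<in>{0..}. B i t \<omega>) UNIV"
      using W by (simp add: cylindrical_wiener_def)
    have "(\<lambda>f. f t' - f t) \<in> borel_measurable (PiM {0..} (\<lambda>_. borel :: real measure))"
      using t by (intro borel_measurable_diff measurable_component_singleton) auto
    then have "indep_vars (\<lambda>_. borel) (\<lambda>i \<omega>. (\<lambda>t\<in>{0..}. B i t \<omega>) t' - (\<lambda>t\<in>{0..}. B i t \<omega>) t) UNIV"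
      by (rule indep_vars_compose2[OF W', where Y="\<lambda>_ f. f t' - f t"])
    then have iv: "indep_vars (\<lambda>_. borel) (\<lambda>i \<omega>. B i t' \<omega> - B i t \<omega>) UNIV" using t by simp
    have "indep_var borel ((\<lambda>f. f i) \<circ> (\<lambda>\<omega>. restrict (\<lambda>i. B i t' \<omega> - B i t \<omega>) {i}))
        borel ((\<lambda>f. f j) \<circ> (\<lambda>\<omega>. restrict (\<lambda>i. B i t' \<omega> - B i t \<omega>) {j}))"
      by (rule indep_var_compose[OF indep_var_restrict[OF iv]]) (use False in auto)
    then have "indep_var borel (\<lambda>\<omega>. B i t' \<omega> - B i t \<omega>) borel (\<lambda>\<omega>. B j t' \<omega> - B j t \<omega>)" by (simp add: comp_def)
    from indep_var_integrable[OF this i1 i1] indep_var_lebesgue_integral[OF this i1 i1] show ?thesis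
      using e1 False by simp
  qed
  then show "integrable M (\<lambda>\<omega>. (B i t' \<omega> - B i t \<omega>) * (B j t' \<omega> - B j t \<omega>))"
    "expectation (\<lambda>\<omega>. (B i t' \<omega> - B i t \<omega>) * (B j t' \<omega> - B j t \<omega>)) = (if i = j then t' - t else 0)"
    by blast+
qed

end

section \<open>Bounded symmetric forms on the Sobolev space\<close>

text \<open>The inner products and the momentum are all treated as instances of bounded symmetric forms, so that the probabilistic part
  needs to be done only once.\<close>

locale h1_form =
  fixes L :: real and b :: "(real \<Rightarrow> 'b::euclidean_space) \<Rightarrow> (real \<Rightarrow> 'b) \<Rightarrow> real"
  assumes L: "L > 0"
    and add_left: "u \<in> Hm L 1 \<Longrightarrow> v \<in> Hm L 1 \<Longrightarrow> w \<in> Hm L 1 \<Longrightarrow> b (\<lambda>x. u x + v x) w = b u w + b v w"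
    and scale_left: "u \<in> Hm L 1 \<Longrightarrow> w \<in> Hm L 1 \<Longrightarrow> b (\<lambda>x. c *\<^sub>R u x) w = c * b u w"
    and sym: "u \<in> Hm L 1 \<Longrightarrow> v \<in> Hm L 1 \<Longrightarrow> b u v = b v u"
    and bound: "u \<in> Hm L 1 \<Longrightarrow> v \<in> Hm L 1 \<Longrightarrow> \<bar>b u v\<bar> \<le> h1norm L u * h1norm L v"
begin

lemma diff_left:
  assumes "u \<in> Hm L 1" "v \<in> Hm L 1" "w \<in> Hm L 1"
  shows "b (\<lambda>x. u x - v x) w = b u w - b v w"
  using add_left[OF assms(1) Hm1_scaleR(1)[OF L assms(2), of "-1"] assms(3)] scale_left[OF assms(2,3), of "-1"] by simp

lemma add_right:
  assumes u: "u \<in> Hm L 1" and v: "v \<in> Hm L 1" and w: "w \<in> Hm L 1"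
  shows "b w (\<lambda>x. u x + v x) = b w u + b w v"
  using add_left[OF u v w] sym[OF Hm1_add(1)[OF L u v] w] sym[OF u w] sym[OF v w] by simp

lemma diff_right:
  assumes u: "u \<in> Hm L 1" and v: "v \<in> Hm L 1" and w: "w \<in> Hm L 1"
  shows "b w (\<lambda>x. u x - v x) = b w u - b w v"
  using diff_left[OF u v w] sym[OF Hm1_diff(1)[OF L u v] w] sym[OF u w] sym[OF v w] by simp

lemma sum_left:
  fixes a :: "nat \<Rightarrow> real \<Rightarrow> 'b"
  assumes a: "\<And>i. i < m \<Longrightarrow> a i \<in> Hm L 1" and w: "w \<in> Hm L 1"
  shows "b (\<lambda>x. \<Sum>i<m. c i *\<^sub>R a i x) w = (\<Sum>i<m. c i * b (a i) w)"
  using a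
proof (induction m)
  case 0
  have "(\<lambda>x. 0 :: 'b) \<in> Hm L 1" using Hm1_sum[OF L, of 0 a] by simp
  then show ?case using scale_left[OF _ w, of "\<lambda>x. 0" 0] by simp
next
  case (Suc m)
  have H: "(\<lambda>x. \<Sum>i<m. c i *\<^sub>R a i x) \<in> Hm L 1" using Suc.prems by (intro Hm1_sum[OF L]) auto
  have am: "a m \<in> Hm L 1" using Suc.prems by simp
  show ?case using add_left[OF H Hm1_scaleR(1)[OF L am] w] scale_left[OF am w] Suc by simp
qed

lemma sum_right:
  fixes a :: "nat \<Rightarrow> real \<Rightarrow> 'b"
  assumes a: "\<And>i. i < m \<Longrightarrow> a i \<in> Hm L 1" and w: "w \<in> Hm L 1"
  shows "b w (\<lambda>x. \<Sum>i<m. c i *\<^sub>R a i x) = (\<Sum>i<m. c i * b w (a i))"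
proof -
  have "b w (\<lambda>x. \<Sum>i<m. c i *\<^sub>R a i x) = b (\<lambda>x. \<Sum>i<m. c i *\<^sub>R a i x) w"
    by (rule sym[OF w Hm1_sum[OF L a]])
  also have "\<dots> = (\<Sum>i<m. c i * b (a i) w)" by (rule sum_left[OF a w])
  also have "\<dots> = (\<Sum>i<m. c i * b w (a i))" using sym[OF w a] by (intro sum.cong) auto
  finally show ?thesis .
qed

lemma quadratic_add:
  assumes "u \<in> Hm L 1" "v \<in> Hm L 1"
  shows "b (\<lambda>x. u x + v x) (\<lambda>x. u x + v x) = b u u + 2 * b u v + b v v"
  using assms sym[OF assms] by (simp add: add_left add_right Hm1_add(1)[OF L])

lemma quadratic_cong:
  assumes "u \<in> Hm L 1" "v \<in> Hm L 1" "aeq L u v"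
  shows "b u u = b v v"
proof -
  have d: "(\<lambda>x. u x - v x) \<in> Hm L 1" by (rule Hm1_diff(1)[OF L assms(1,2)])
  have "aeq L (\<lambda>x. u x - v x) (\<lambda>x. u x - u x)" using assms(3) unfolding aeq_def by eventually_elim simp
  moreover have "(\<lambda>x. u x - u x) \<in> Hm L 1" by (rule Hm1_diff(1)[OF L assms(1,1)])
  ultimately have "h1norm L (\<lambda>x. u x - v x) = h1norm L (\<lambda>x. u x - u x)" using d by (intro h1norm_cong[OF L])
  also have "\<dots> = 0" using h1norm_scaleR[OF L assms(1), of 0] by simp
  finally have "b (\<lambda>x. u x - v x) w = 0" if "w \<in> Hm L 1" for w using bound[OF d that] by simp
  then have "b u w = b v w" if "w \<in> Hm L 1" for w using diff_left[OF assms(1,2) that] that by simp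
  then show ?thesis using sym assms by metis
qed

lemma measurable_left:
  assumes e: "orthonormal_basis L e" and f: "f \<in> Hm L 1"
  shows "b f \<in> borel_measurable (H1_borel L)"
proof (rule H1_borel_measurable_continuous[OF L e])
  fix u :: "real \<Rightarrow> 'b" and \<epsilon> :: real assume u: "u \<in> Hm L 1" and \<epsilon>: "\<epsilon> > 0"
  show "\<exists>\<delta>>0. \<forall>v\<in>Hm L 1. h1norm L (\<lambda>x. v x - u x) < \<delta> \<longrightarrow> \<bar>b f v - b f u\<bar> < \<epsilon>"
  proof (intro exI[of _ "\<epsilon> / (h1norm L f + 1)"] conjI ballI impI)
    have p: "0 < h1norm L f + 1" using h1norm_nonneg[of L f] by linarith
    then show "0 < \<epsilon> / (h1norm L f + 1)" using \<epsilon> by simp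
    fix v assume v: "v \<in> Hm L 1" and d: "h1norm L (\<lambda>x. v x - u x) < \<epsilon> / (h1norm L f + 1)"
    have "\<bar>b f v - b f u\<bar> \<le> h1norm L f * h1norm L (\<lambda>x. v x - u x)"
      using bound[OF f Hm1_diff(1)[OF L v u]] diff_right[OF v u f] by simp
    also have "\<dots> \<le> (h1norm L f + 1) * h1norm L (\<lambda>x. v x - u x)" by (intro mult_right_mono) auto
    also have "\<dots> < \<epsilon>" using d p by (simp add: field_simps)
    finally show "\<bar>b f v - b f u\<bar> < \<epsilon>" .
  qed
qed

lemma measurable_quadratic:
  assumes e: "orthonormal_basis L e"
  shows "(\<lambda>u. b u u) \<in> borel_measurable (H1_borel L)"
proof (rule H1_borel_measurable_continuous[OF L e])
  fix u :: "real \<Rightarrow> 'b" and \<epsilon> :: real assume u: "u \<in> Hm L 1" and \<epsilon>: "\<epsilon> > 0"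
  define k where "k = 2 * h1norm L u + 1"
  have k: "k > 0" using h1norm_nonneg[of L u] unfolding k_def by linarith
  show "\<exists>\<delta>>0. \<forall>v\<in>Hm L 1. h1norm L (\<lambda>x. v x - u x) < \<delta> \<longrightarrow> \<bar>b v v - b u u\<bar> < \<epsilon>"
  proof (intro exI[of _ "min 1 (\<epsilon> / k)"] conjI ballI impI)
    show "0 < min 1 (\<epsilon> / k)" using k \<epsilon> by simp
    fix v assume v: "v \<in> Hm L 1" and dmin: "h1norm L (\<lambda>x. v x - u x) < min 1 (\<epsilon> / k)"
    define d where "d = h1norm L (\<lambda>x. v x - u x)"
    have d: "d < 1" "d < \<epsilon> / k" "0 \<le> d" using dmin by (auto simp: d_def)
    have w: "(\<lambda>x. v x - u x) \<in> Hm L 1" by (rule Hm1_diff(1)[OF L v u])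
    have "b v v = b u u + 2 * b u (\<lambda>x. v x - u x) + b (\<lambda>x. v x - u x) (\<lambda>x. v x - u x)"
      using quadratic_add[OF u w] by simp
    then have "\<bar>b v v - b u u\<bar> \<le> 2 * \<bar>b u (\<lambda>x. v x - u x)\<bar> + \<bar>b (\<lambda>x. v x - u x) (\<lambda>x. v x - u x)\<bar>" by linarith
    also have "\<dots> \<le> 2 * (h1norm L u * d) + d * d"
      unfolding d_def by (intro add_mono mult_left_mono bound u w) auto
    also have "\<dots> \<le> 2 * (h1norm L u * d) + d * 1" using d by (intro add_left_mono mult_left_mono) auto
    also have "\<dots> = k * d" by (simp add: k_def algebra_simps)
    also have "\<dots> < \<epsilon>" using d k by (simp add: field_simps)
    finally show "\<bar>b v v - b u u\<bar> < \<epsilon>" .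
  qed
qed

end

text \<open>Derivatives can be moved to the second argument. This asymmetric bound is what the mixed term needs: of the random state only the norm in \<open>L2\<close> has
  a known moment, whereas the increment has moments in the Sobolev norm.\<close>

locale weak_h1_form = h1_form +
  assumes weak_bound: "u \<in> Hm L 1 \<Longrightarrow> v \<in> Hm L 1 \<Longrightarrow> \<bar>b u v\<bar> \<le> l2norm L u * h1norm L v"

lemma weak_h1_form_l2ip: "L > 0 \<Longrightarrow> weak_h1_form L (l2ip L)"
proof unfold_locales
  fix u v :: "real \<Rightarrow> 'a" assume uv: "u \<in> Hm L 1" "v \<in> Hm L 1"
  have "\<bar>l2ip L u v\<bar> \<le> l2norm L u * l2norm L v" by (rule l2ip_le[OF uv[THEN Hm_L2]])
  also have "\<dots> \<le> l2norm L u * h1norm L v" by (intro mult_left_mono l2norm_le_h1norm) simp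
  finally show *: "\<bar>l2ip L u v\<bar> \<le> l2norm L u * h1norm L v" .
  also have "\<dots> \<le> h1norm L u * h1norm L v" by (intro mult_right_mono l2norm_le_h1norm) simp
  finally show "\<bar>l2ip L u v\<bar> \<le> h1norm L u * h1norm L v" .
qed (auto intro: l2ip_add_left l2ip_scaleR_left l2ip_commute dest: Hm_L2)

lemma weak_h1_form_momentum: "L > 0 \<Longrightarrow> weak_h1_form L (momentum_form L)"
proof unfold_locales
  note iL = L2_bounded_linear[OF bounded_linear_times_ii]
  fix u v w :: "real \<Rightarrow> complex" and c assume L: "L > 0" and u: "u \<in> Hm L 1" and v: "v \<in> Hm L 1"
  have "\<bar>momentum_form L u v\<bar> \<le> l2norm L u * l2norm L (\<lambda>x. \<i> * Dx L 1 v x)"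
    unfolding momentum_form_def by (rule l2ip_le[OF Hm_L2[OF u] iL[OF Dx1_L2[OF v]]])
  also have "l2norm L (\<lambda>x. \<i> * Dx L 1 v x) = l2norm L (Dx L 1 v)" by (simp add: l2norm_def norm_mult)
  also have "l2norm L u * l2norm L (Dx L 1 v) \<le> l2norm L u * h1norm L v" by (intro mult_left_mono l2norm_Dx_le_h1norm) simp
  finally show "\<bar>momentum_form L u v\<bar> \<le> l2norm L u * h1norm L v" .
  also have "\<dots> \<le> h1norm L u * h1norm L v" by (intro mult_right_mono l2norm_le_h1norm) simp
  finally show "\<bar>momentum_form L u v\<bar> \<le> h1norm L u * h1norm L v" .
  show "momentum_form L u v = momentum_form L v u" by (rule momentum_form_commute[OF L u v])
  show "momentum_form L (\<lambda>x. c *\<^sub>R u x) v = c * momentum_form L u v"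
    unfolding momentum_form_def by (rule l2ip_scaleR_left)
  show "momentum_form L (\<lambda>x. u x + v x) w = momentum_form L u w + momentum_form L v w" if w: "w \<in> Hm L 1"
    unfolding momentum_form_def by (rule l2ip_add_left[OF Hm_L2[OF u] Hm_L2[OF v] iL[OF Dx1_L2[OF w]]])
qed

lemma h1_form_h1ip: "L > 0 \<Longrightarrow> h1_form L (h1ip L)"
proof unfold_locales
  fix u v w :: "real \<Rightarrow> 'a" and c assume L: "L > 0" and u: "u \<in> Hm L 1" and v: "v \<in> Hm L 1"
  show "\<bar>h1ip L u v\<bar> \<le> h1norm L u * h1norm L v" by (rule h1ip_le[OF u v])
  show "h1ip L u v = h1ip L v u" by (rule h1ip_commute)
  have "l2ip L (Dx L 1 (\<lambda>x. c *\<^sub>R u x)) (Dx L 1 v) = l2ip L (\<lambda>x. c *\<^sub>R Dx L 1 u x) (Dx L 1 v)"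
    by (rule l2ip_cong[OF Dx1_L2[OF Hm1_scaleR(1)[OF L u]] L2_scaleR[OF Dx1_L2[OF u]] Dx1_L2[OF v] Dx1_L2[OF v] Hm1_scaleR(2)[OF L u] aeq_refl])
  then show "h1ip L (\<lambda>x. c *\<^sub>R u x) v = c * h1ip L u v"
    unfolding h1ip_def l2ip_scaleR_left by (simp add: distrib_left)
  assume w: "w \<in> Hm L 1"
  have "l2ip L (Dx L 1 (\<lambda>x. u x + v x)) (Dx L 1 w) = l2ip L (\<lambda>x. Dx L 1 u x + Dx L 1 v x) (Dx L 1 w)"
    by (rule l2ip_cong[OF Dx1_L2[OF Hm1_add(1)[OF L u v]] L2_add[OF Dx1_L2[OF u] Dx1_L2[OF v]] Dx1_L2[OF w] Dx1_L2[OF w] Hm1_add(2)[OF L u v] aeq_refl])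
  then show "h1ip L (\<lambda>x. u x + v x) w = h1ip L u w + h1ip L v w"
    unfolding h1ip_def using l2ip_add_left[OF Hm_L2[OF u] Hm_L2[OF v] Hm_L2[OF w]] l2ip_add_left[OF Dx1_L2[OF u] Dx1_L2[OF v] Dx1_L2[OF w]] by simp
qed

lemma l2norm_H1_measurable:
  fixes e :: "nat \<Rightarrow> real \<Rightarrow> real"
  assumes L: "L > 0" and e: "orthonormal_basis L e"
  shows "(l2norm L :: (real \<Rightarrow> 'a::euclidean_space) \<Rightarrow> real) \<in> borel_measurable (H1_borel L)"
proof -
  interpret weak_h1_form L "l2ip L :: (real \<Rightarrow> 'a) \<Rightarrow> _" by (rule weak_h1_form_l2ip[OF L])
  have "(\<lambda>u. sqrt (l2ip L u u)) \<in> borel_measurable (H1_borel L :: (real \<Rightarrow> 'a) measure)"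
    using measurable_quadratic[OF e] by measurable
  also have "(\<lambda>u. sqrt (l2ip L u u)) = (l2norm L :: (real \<Rightarrow> 'a) \<Rightarrow> real)"
    by (simp add: l2norm_sq[symmetric] fun_eq_iff)
  finally show ?thesis .
qed

section \<open>Gaussian series with values in the Sobolev space\<close>

lemma integral_Cauchy_Schwarz:
  fixes f g :: "'w \<Rightarrow> real"
  assumes [measurable]: "f \<in> borel_measurable M" "g \<in> borel_measurable M"
    and f: "integrable M (\<lambda>x. (f x)\<^sup>2)" and g: "integrable M (\<lambda>x. (g x)\<^sup>2)"
  shows "integrable M (\<lambda>x. f x * g x)"
    "(\<integral>x. \<bar>f x * g x\<bar> \<partial>M) \<le> sqrt (\<integral>x. (f x)\<^sup>2 \<partial>M) * sqrt (\<integral>x. (g x)\<^sup>2 \<partial>M)"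
proof -
  show i: "integrable M (\<lambda>x. f x * g x)"
  proof (rule Bochner_Integration.integrable_bound)
    show "integrable M (\<lambda>x. (f x)\<^sup>2 + (g x)\<^sup>2)" using f g by simp
    show "AE x in M. norm (f x * g x) \<le> norm ((f x)\<^sup>2 + (g x)\<^sup>2)"
    proof (rule AE_I2)
      fix x
      have "2 * \<bar>f x\<bar> * \<bar>g x\<bar> \<le> \<bar>f x\<bar>\<^sup>2 + \<bar>g x\<bar>\<^sup>2" by (rule sum_squares_bound)
      moreover have "0 \<le> \<bar>f x\<bar> * \<bar>g x\<bar>" by simp
      ultimately show "norm (f x * g x) \<le> norm ((f x)\<^sup>2 + (g x)\<^sup>2)"
        unfolding real_norm_def power2_abs abs_mult by linarith
    qed
  qed measurable
  have "(\<integral>x. \<bar>f x * g x\<bar> \<partial>M)\<^sup>2 \<le> (\<integral>x. (f x)\<^sup>2 \<partial>M) * (\<integral>x. (g x)\<^sup>2 \<partial>M)"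
  proof (rule nonneg_quadratic_imp_le)
    fix t :: real
    have "0 \<le> (\<integral>x. (\<bar>f x\<bar> + t * \<bar>g x\<bar>)\<^sup>2 \<partial>M)" by simp
    also have "\<dots> = (\<integral>x. (f x)\<^sup>2 + 2 * t * \<bar>f x * g x\<bar> + t\<^sup>2 * (g x)\<^sup>2 \<partial>M)"
      by (simp add: power2_sum power_mult_distrib abs_mult algebra_simps)
    also have "\<dots> = (\<integral>x. (f x)\<^sup>2 \<partial>M) + 2 * t * (\<integral>x. \<bar>f x * g x\<bar> \<partial>M) + t\<^sup>2 * (\<integral>x. (g x)\<^sup>2 \<partial>M)"
      using f g integrable_abs[OF i] by simp
    finally show "0 \<le> (\<integral>x. (f x)\<^sup>2 \<partial>M) + 2 * t * (\<integral>x. \<bar>f x * g x\<bar> \<partial>M) + t\<^sup>2 * (\<integral>x. (g x)\<^sup>2 \<partial>M)" .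
  qed simp
  then have "sqrt ((\<integral>x. \<bar>f x * g x\<bar> \<partial>M)\<^sup>2) \<le> sqrt ((\<integral>x. (f x)\<^sup>2 \<partial>M) * (\<integral>x. (g x)\<^sup>2 \<partial>M))" by (rule real_sqrt_le_mono)
  then show "(\<integral>x. \<bar>f x * g x\<bar> \<partial>M) \<le> sqrt (\<integral>x. (f x)\<^sup>2 \<partial>M) * sqrt (\<integral>x. (g x)\<^sup>2 \<partial>M)"
    by (simp add: real_sqrt_mult)
qed

text \<open>The increment of the noise over one time step: \<open>X\<close> is the sum of the series of the \<open>\<Delta> i \<cdot> a i\<close>, the coefficients are measurable for \<open>G\<close>, and the
  state before the noise is measurable for the independent algebra \<open>F\<close>.\<close>

locale wiener_noise = prob_space M for M :: "'w measure" +
  fixes F G :: "'w measure" and L h :: real and e :: "nat \<Rightarrow> real \<Rightarrow> real"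
    and a :: "nat \<Rightarrow> real \<Rightarrow> 'b::euclidean_space" and \<Delta> :: "nat \<Rightarrow> 'w \<Rightarrow> real" and X :: "'w \<Rightarrow> real \<Rightarrow> 'b"
  assumes L: "L > 0" and e: "orthonormal_basis L e"
    and indep: "indep_set (sets F) (sets G)" and spF: "space F = space M" and spG: "space G = space M"
    and \<Delta>_meas: "\<And>i. \<Delta> i \<in> borel_measurable G"
    and \<Delta>_int: "\<And>i. integrable M (\<Delta> i)" and \<Delta>_exp: "\<And>i. expectation (\<Delta> i) = 0"
    and \<Delta>\<Delta>_int: "\<And>i j. integrable M (\<lambda>\<omega>. \<Delta> i \<omega> * \<Delta> j \<omega>)"
    and \<Delta>\<Delta>_exp: "\<And>i j. expectation (\<lambda>\<omega>. \<Delta> i \<omega> * \<Delta> j \<omega>) = (if i = j then h else 0)"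
    and a: "\<And>i. a i \<in> Hm L 1"
    and X: "X \<in> M \<rightarrow>\<^sub>M H1_borel L"
    and conv: "(\<lambda>m. \<integral>\<^sup>+ \<omega>. ennreal ((h1norm L (\<lambda>x. X \<omega> x - (\<Sum>i<m. \<Delta> i \<omega> *\<^sub>R a i x)))\<^sup>2) \<partial>M) \<longlonglongrightarrow> 0"
begin

definition partial_sum :: "nat \<Rightarrow> 'w \<Rightarrow> real \<Rightarrow> 'b" where "partial_sum m \<omega> = (\<lambda>x. \<Sum>i<m. \<Delta> i \<omega> *\<^sub>R a i x)"

definition series_error :: "nat \<Rightarrow> 'w \<Rightarrow> real" where "series_error m \<omega> = h1norm L (\<lambda>x. X \<omega> x - partial_sum m \<omega> x)"

sublocale h1: h1_form L "h1ip L :: (real \<Rightarrow> 'b) \<Rightarrow> _" by (rule h1_form_h1ip[OF L])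

lemma measurable_F_imp_M: "f \<in> F \<rightarrow>\<^sub>M N \<Longrightarrow> f \<in> M \<rightarrow>\<^sub>M N"
  using indep spF by (intro measurable_from_subalg[of M F]) (auto simp: subalgebra_def indep_sets2_eq)

lemma measurable_G_imp_M: "f \<in> G \<rightarrow>\<^sub>M N \<Longrightarrow> f \<in> M \<rightarrow>\<^sub>M N"
  using indep spG by (intro measurable_from_subalg[of M G]) (auto simp: subalgebra_def indep_sets2_eq)

lemma X_in_Hm1: "\<omega> \<in> space M \<Longrightarrow> X \<omega> \<in> Hm L 1"
  using measurable_space[OF X] by simp

lemma partial_sum_in_Hm1: "partial_sum m \<omega> \<in> Hm L 1"
  unfolding partial_sum_def by (rule Hm1_sum[OF L a])

lemma series_error_nonneg[simp]: "0 \<le> series_error m \<omega>" by (simp add: series_error_def)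

lemma form_partial_sums:
  assumes "h1_form L b"
  shows "b (partial_sum m \<omega>) (partial_sum k \<omega>) = (\<Sum>i<m. \<Sum>j<k. (\<Delta> i \<omega> * \<Delta> j \<omega>) * b (a i) (a j))"
proof -
  interpret b: h1_form L b by (rule assms)
  have "b (partial_sum m \<omega>) (partial_sum k \<omega>) = (\<Sum>i<m. \<Delta> i \<omega> * b (a i) (partial_sum k \<omega>))"
    unfolding partial_sum_def[of m] by (rule b.sum_left[OF a partial_sum_in_Hm1])
  also have "\<dots> = (\<Sum>i<m. \<Delta> i \<omega> * (\<Sum>j<k. \<Delta> j \<omega> * b (a i) (a j)))"
  proof (intro sum.cong refl arg_cong2[where f="(*)"])
    show "b (a i) (partial_sum k \<omega>) = (\<Sum>j<k. \<Delta> j \<omega> * b (a i) (a j))" for i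
      unfolding partial_sum_def by (rule b.sum_right[OF a a])
  qed
  finally show ?thesis by (simp add: sum_distrib_left mult.assoc)
qed

lemma form_partial_sums_meas:
  assumes "h1_form L b" shows "(\<lambda>\<omega>. b (partial_sum m \<omega>) (partial_sum k \<omega>)) \<in> borel_measurable G"
  unfolding form_partial_sums[OF assms] using \<Delta>_meas by measurable

lemma form_partial_sums_int:
  assumes "h1_form L b"
  shows "integrable M (\<lambda>\<omega>. b (partial_sum m \<omega>) (partial_sum m \<omega>))"
    "expectation (\<lambda>\<omega>. b (partial_sum m \<omega>) (partial_sum m \<omega>)) = (\<Sum>i<m. h * b (a i) (a i))"
proof -
  have i: "integrable M (\<lambda>\<omega>. (\<Delta> i \<omega> * \<Delta> j \<omega>) * b (a i) (a j))" for i j using \<Delta>\<Delta>_int by simp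
  show "integrable M (\<lambda>\<omega>. b (partial_sum m \<omega>) (partial_sum m \<omega>))"
    unfolding form_partial_sums[OF assms] by (intro Bochner_Integration.integrable_sum i)
  have "expectation (\<lambda>\<omega>. b (partial_sum m \<omega>) (partial_sum m \<omega>)) = (\<Sum>i<m. \<Sum>j<m. expectation (\<lambda>\<omega>. (\<Delta> i \<omega> * \<Delta> j \<omega>) * b (a i) (a j)))"
    unfolding form_partial_sums[OF assms] by (simp only: Bochner_Integration.integral_sum Bochner_Integration.integrable_sum i)
  also have "\<dots> = (\<Sum>i<m. \<Sum>j<m. if i = j then h * b (a i) (a i) else 0)"
    using \<Delta>\<Delta>_exp by (intro sum.cong refl) simp
  also have "\<dots> = (\<Sum>i<m. h * b (a i) (a i))" by (simp add: sum.delta)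
  finally show "expectation (\<lambda>\<omega>. b (partial_sum m \<omega>) (partial_sum m \<omega>)) = (\<Sum>i<m. h * b (a i) (a i))" .
qed

lemma h1norm_partial_sum_diff_meas: "(\<lambda>\<omega>. h1norm L (\<lambda>x. partial_sum k \<omega> x - partial_sum m \<omega> x)) \<in> borel_measurable G"
proof -
  note [measurable] = form_partial_sums_meas[OF h1.h1_form_axioms]
  have "h1norm L (\<lambda>x. partial_sum k \<omega> x - partial_sum m \<omega> x) = sqrt (h1ip L (partial_sum k \<omega>) (partial_sum k \<omega>) - h1ip L (partial_sum k \<omega>) (partial_sum m \<omega>) - (h1ip L (partial_sum m \<omega>) (partial_sum k \<omega>) - h1ip L (partial_sum m \<omega>) (partial_sum m \<omega>)))" for \<omega>
    using h1norm_sq[of L "\<lambda>x. partial_sum k \<omega> x - partial_sum m \<omega> x"] partial_sum_in_Hm1 Hm1_diff(1)[OF L partial_sum_in_Hm1 partial_sum_in_Hm1]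
    by (simp add: h1.diff_left h1.diff_right real_sqrt_unique)
  then show ?thesis by simp
qed

lemma h1ip_X_meas: "f \<in> Hm L 1 \<Longrightarrow> (\<lambda>\<omega>. h1ip L f (X \<omega>)) \<in> borel_measurable M"
  using measurable_compose[OF X h1.measurable_left[OF e]] .

lemma form_XX_meas: "h1_form L b \<Longrightarrow> (\<lambda>\<omega>. b (X \<omega>) (X \<omega>)) \<in> borel_measurable M"
  using measurable_compose[OF X h1_form.measurable_quadratic[OF _ e]] .

lemma series_error_sq: "\<omega> \<in> space M \<Longrightarrow>
  (series_error m \<omega>)\<^sup>2 = h1ip L (X \<omega>) (X \<omega>) - 2 * (\<Sum>i<m. \<Delta> i \<omega> * h1ip L (a i) (X \<omega>)) + h1ip L (partial_sum m \<omega>) (partial_sum m \<omega>)"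
proof -
  assume \<omega>: "\<omega> \<in> space M"
  have "(\<Sum>i<m. \<Delta> i \<omega> * h1ip L (a i) (X \<omega>)) = h1ip L (partial_sum m \<omega>) (X \<omega>)"
    unfolding partial_sum_def by (rule h1.sum_left[OF a X_in_Hm1[OF \<omega>], symmetric])
  then show ?thesis unfolding series_error_def h1norm_sq
    using X_in_Hm1[OF \<omega>] partial_sum_in_Hm1[of m \<omega>] Hm1_diff(1)[OF L X_in_Hm1[OF \<omega>] partial_sum_in_Hm1[of m \<omega>]] h1ip_commute[of L "X \<omega>" "partial_sum m \<omega>"]
    by (simp add: h1.diff_left h1.diff_right)
qed

lemma series_error_meas[measurable]: "series_error m \<in> borel_measurable M"
proof -
  note [measurable] = measurable_G_imp_M[OF \<Delta>_meas] h1ip_X_meas[OF a] form_XX_meas[OF h1.h1_form_axioms] measurable_G_imp_M[OF form_partial_sums_meas[OF h1.h1_form_axioms]]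
  have "(\<lambda>\<omega>. sqrt (h1ip L (X \<omega>) (X \<omega>) - 2 * (\<Sum>i<m. \<Delta> i \<omega> * h1ip L (a i) (X \<omega>)) + h1ip L (partial_sum m \<omega>) (partial_sum m \<omega>))) \<in> borel_measurable M"
    by measurable
  also have "?this \<longleftrightarrow> ?thesis"
    by (rule measurable_cong) (simp add: series_error_sq[symmetric])
  finally show ?thesis .
qed

lemma X_norm_meas[measurable]: "(\<lambda>\<omega>. h1norm L (X \<omega>)) \<in> borel_measurable M"
proof -
  have "(\<lambda>\<omega>. sqrt (h1ip L (X \<omega>) (X \<omega>))) \<in> borel_measurable M"
    using form_XX_meas[OF h1.h1_form_axioms] by measurable
  then show ?thesis by (simp add: h1norm_sq[symmetric])
qed

lemma nn_integral_series_error_tendsto: "(\<lambda>m. \<integral>\<^sup>+ \<omega>. ennreal ((series_error m \<omega>)\<^sup>2) \<partial>M) \<longlonglongrightarrow> 0"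
  using conv by (simp add: series_error_def partial_sum_def)

lemma partial_sum_norm_int: "integrable M (\<lambda>\<omega>. (h1norm L (partial_sum m \<omega>))\<^sup>2)"
  using form_partial_sums_int(1)[OF h1.h1_form_axioms] by (simp add: h1norm_sq)

lemma sq_le_of_le_add: "(0::real) \<le> x \<Longrightarrow> x \<le> y + z \<Longrightarrow> x\<^sup>2 \<le> 2 * y\<^sup>2 + 2 * z\<^sup>2"
proof -
  assume "0 \<le> x" "x \<le> y + z"
  then have "x\<^sup>2 \<le> (y + z)\<^sup>2" by (rule power_mono[rotated])
  also have "\<dots> \<le> 2 * y\<^sup>2 + 2 * z\<^sup>2" using sum_squares_bound[of y z] by (simp add: power2_sum)
  finally show "x\<^sup>2 \<le> 2 * y\<^sup>2 + 2 * z\<^sup>2" .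
qed

lemma partial_sum_norm_meas[measurable]: "(\<lambda>\<omega>. h1norm L (partial_sum m \<omega>)) \<in> borel_measurable M"
proof -
  have "(\<lambda>\<omega>. sqrt (h1ip L (partial_sum m \<omega>) (partial_sum m \<omega>))) \<in> borel_measurable M"
    using measurable_G_imp_M[OF form_partial_sums_meas[OF h1.h1_form_axioms]] by measurable
  then show ?thesis by (simp add: h1norm_sq[symmetric])
qed

lemma X_norm_int: "integrable M (\<lambda>\<omega>. (h1norm L (X \<omega>))\<^sup>2)"
proof -
  have "eventually (\<lambda>m. (\<integral>\<^sup>+ \<omega>. ennreal ((series_error m \<omega>)\<^sup>2) \<partial>M) < 1) sequentially"
    using order_tendstoD(2)[OF nn_integral_series_error_tendsto, of 1] by simp
  then obtain m where m: "(\<integral>\<^sup>+ \<omega>. ennreal ((series_error m \<omega>)\<^sup>2) \<partial>M) < 1" by (auto simp: eventually_sequentially)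
  have "integrable M (\<lambda>\<omega>. (series_error m \<omega>)\<^sup>2)"
    using less_trans[OF m ennreal_one_less_top] by (intro integrableI_bounded) auto
  then have i: "integrable M (\<lambda>\<omega>. 2 * (series_error m \<omega>)\<^sup>2 + 2 * (h1norm L (partial_sum m \<omega>))\<^sup>2)" using partial_sum_norm_int[of m] by simp
  show ?thesis
  proof (rule Bochner_Integration.integrable_bound[OF i])
    show "AE \<omega> in M. norm ((h1norm L (X \<omega>))\<^sup>2) \<le> norm (2 * (series_error m \<omega>)\<^sup>2 + 2 * (h1norm L (partial_sum m \<omega>))\<^sup>2)"
    proof (rule AE_I2)
      fix \<omega> assume \<omega>: "\<omega> \<in> space M"
      have "h1norm L (X \<omega>) \<le> series_error m \<omega> + h1norm L (partial_sum m \<omega>)"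
        using h1norm_triangle[OF L Hm1_diff(1)[OF L X_in_Hm1[OF \<omega>] partial_sum_in_Hm1] partial_sum_in_Hm1, of m \<omega> m \<omega>] by (simp add: series_error_def)
      from sq_le_of_le_add[OF h1norm_nonneg this]
      show "norm ((h1norm L (X \<omega>))\<^sup>2) \<le> norm (2 * (series_error m \<omega>)\<^sup>2 + 2 * (h1norm L (partial_sum m \<omega>))\<^sup>2)" by simp
    qed
  qed measurable
qed

lemma series_error_le: "\<omega> \<in> space M \<Longrightarrow> series_error m \<omega> \<le> h1norm L (X \<omega>) + h1norm L (partial_sum m \<omega>)"
  using h1norm_triangle[OF L X_in_Hm1 Hm1_scaleR(1)[OF L partial_sum_in_Hm1], of \<omega> "-1" m \<omega>] h1norm_scaleR[OF L partial_sum_in_Hm1, of "-1" m \<omega>]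
  by (simp add: series_error_def)

lemma series_error_sq_int: "integrable M (\<lambda>\<omega>. (series_error m \<omega>)\<^sup>2)"
proof (rule Bochner_Integration.integrable_bound)
  show "integrable M (\<lambda>\<omega>. 2 * (h1norm L (X \<omega>))\<^sup>2 + 2 * (h1norm L (partial_sum m \<omega>))\<^sup>2)" using X_norm_int partial_sum_norm_int by simp
  show "AE \<omega> in M. norm ((series_error m \<omega>)\<^sup>2) \<le> norm (2 * (h1norm L (X \<omega>))\<^sup>2 + 2 * (h1norm L (partial_sum m \<omega>))\<^sup>2)"
    using sq_le_of_le_add[OF series_error_nonneg series_error_le] by (intro AE_I2) simp
qed measurable

lemma series_error_sq_tendsto: "(\<lambda>m. expectation (\<lambda>\<omega>. (series_error m \<omega>)\<^sup>2)) \<longlonglongrightarrow> 0"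
proof -
  have "(\<integral>\<^sup>+ \<omega>. ennreal ((series_error m \<omega>)\<^sup>2) \<partial>M) = ennreal (expectation (\<lambda>\<omega>. (series_error m \<omega>)\<^sup>2))" for m
    by (rule nn_integral_eq_integral[OF series_error_sq_int]) simp
  then have "(\<lambda>m. ennreal (expectation (\<lambda>\<omega>. (series_error m \<omega>)\<^sup>2))) \<longlonglongrightarrow> ennreal 0" using nn_integral_series_error_tendsto by simp
  then show ?thesis by (rule tendsto_ennrealD) (auto intro: eventuallyI)
qed

lemma series_error_int: "integrable M (series_error m)"
  using integral_Cauchy_Schwarz(1)[OF series_error_meas _ series_error_sq_int, of "\<lambda>_. 1"] by simp

lemma series_error_exp_le: "expectation (series_error m) \<le> sqrt (expectation (\<lambda>\<omega>. (series_error m \<omega>)\<^sup>2))"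
  using integral_Cauchy_Schwarz(2)[OF series_error_meas _ series_error_sq_int, of "\<lambda>_. 1"] by (simp add: prob_space)

lemma series_error_tendsto: "(\<lambda>m. expectation (series_error m)) \<longlonglongrightarrow> 0"
proof (rule tendsto_sandwich[OF _ _ tendsto_const])
  show "(\<lambda>m. sqrt (expectation (\<lambda>\<omega>. (series_error m \<omega>)\<^sup>2))) \<longlonglongrightarrow> 0" using tendsto_real_sqrt[OF series_error_sq_tendsto] by simp
  show "eventually (\<lambda>m. 0 \<le> expectation (series_error m)) sequentially" by (intro always_eventually allI integral_nonneg_AE AE_I2 series_error_nonneg)
  show "eventually (\<lambda>m. expectation (series_error m) \<le> sqrt (expectation (\<lambda>\<omega>. (series_error m \<omega>)\<^sup>2))) sequentially"
    by (intro always_eventually allI series_error_exp_le)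
qed

text \<open>On partial sums, orthogonality of the coefficients leaves the diagonal terms. The limit is controlled by
  \<open>|b(S,S) - b(X,X)| \<le> 2 |X - S| |X| + |X - S|\<^sup>2\<close> and the Cauchy--Schwarz inequality.\<close>

lemma expectation_quadratic:
  assumes b: "h1_form L b"
  shows "integrable M (\<lambda>\<omega>. b (X \<omega>) (X \<omega>))" "(\<lambda>i. h * b (a i) (a i)) sums expectation (\<lambda>\<omega>. b (X \<omega>) (X \<omega>))"
proof -
  interpret b: h1_form L b by (rule b)
  note [measurable] = form_XX_meas[OF b] measurable_G_imp_M[OF form_partial_sums_meas[OF b]]
  show i: "integrable M (\<lambda>\<omega>. b (X \<omega>) (X \<omega>))"
  proof (rule Bochner_Integration.integrable_bound[OF X_norm_int])
    show "AE \<omega> in M. norm (b (X \<omega>) (X \<omega>)) \<le> norm ((h1norm L (X \<omega>))\<^sup>2)"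
      using b.bound[OF X_in_Hm1 X_in_Hm1] by (intro AE_I2) (simp add: power2_eq_square)
  qed measurable
  define B where "B m = 2 * (sqrt (expectation (\<lambda>\<omega>. (series_error m \<omega>)\<^sup>2)) * sqrt (expectation (\<lambda>\<omega>. (h1norm L (X \<omega>))\<^sup>2))) + expectation (\<lambda>\<omega>. (series_error m \<omega>)\<^sup>2)" for m
  have le: "\<bar>(\<Sum>i<m. h * b (a i) (a i)) - expectation (\<lambda>\<omega>. b (X \<omega>) (X \<omega>))\<bar> \<le> B m" for m
  proof -
    have iDX: "integrable M (\<lambda>\<omega>. series_error m \<omega> * h1norm L (X \<omega>))"
      by (rule integral_Cauchy_Schwarz(1)[OF _ _ series_error_sq_int X_norm_int]) measurable
    have DX: "expectation (\<lambda>\<omega>. series_error m \<omega> * h1norm L (X \<omega>)) \<le> sqrt (expectation (\<lambda>\<omega>. (series_error m \<omega>)\<^sup>2)) * sqrt (expectation (\<lambda>\<omega>. (h1norm L (X \<omega>))\<^sup>2))"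
      using integral_Cauchy_Schwarz(2)[OF _ _ series_error_sq_int X_norm_int, of m] by (simp add: abs_mult)
    have "(\<Sum>i<m. h * b (a i) (a i)) - expectation (\<lambda>\<omega>. b (X \<omega>) (X \<omega>)) = expectation (\<lambda>\<omega>. b (partial_sum m \<omega>) (partial_sum m \<omega>) - b (X \<omega>) (X \<omega>))"
      using form_partial_sums_int[OF b, of m] i by simp
    also have "\<bar>\<dots>\<bar> \<le> expectation (\<lambda>\<omega>. \<bar>b (partial_sum m \<omega>) (partial_sum m \<omega>) - b (X \<omega>) (X \<omega>)\<bar>)" by (rule integral_abs_bound)
    also have "\<dots> \<le> expectation (\<lambda>\<omega>. 2 * (series_error m \<omega> * h1norm L (X \<omega>)) + (series_error m \<omega>)\<^sup>2)"
    proof (rule integral_mono)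
      show "integrable M (\<lambda>\<omega>. \<bar>b (partial_sum m \<omega>) (partial_sum m \<omega>) - b (X \<omega>) (X \<omega>)\<bar>)" using form_partial_sums_int(1)[OF b, of m] i by simp
      show "integrable M (\<lambda>\<omega>. 2 * (series_error m \<omega> * h1norm L (X \<omega>)) + (series_error m \<omega>)\<^sup>2)" using iDX series_error_sq_int by simp
      fix \<omega> assume "\<omega> \<in> space M"
      then have x: "X \<omega> \<in> Hm L 1" by (rule X_in_Hm1)
      let ?d = "\<lambda>x. X \<omega> x - partial_sum m \<omega> x"
      have d: "?d \<in> Hm L 1" by (rule Hm1_diff(1)[OF L x partial_sum_in_Hm1])
      have "b (partial_sum m \<omega>) (partial_sum m \<omega>) - b (X \<omega>) (X \<omega>) = b ?d ?d - 2 * b ?d (X \<omega>)"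
        using x partial_sum_in_Hm1[of m \<omega>] d b.sym[OF x partial_sum_in_Hm1[of m \<omega>]] by (simp add: b.diff_left b.diff_right)
      moreover have "\<bar>b ?d ?d\<bar> \<le> (series_error m \<omega>)\<^sup>2" using b.bound[OF d d] by (simp add: series_error_def power2_eq_square)
      moreover have "\<bar>b ?d (X \<omega>)\<bar> \<le> series_error m \<omega> * h1norm L (X \<omega>)" using b.bound[OF d x] by (simp add: series_error_def)
      ultimately show "\<bar>b (partial_sum m \<omega>) (partial_sum m \<omega>) - b (X \<omega>) (X \<omega>)\<bar> \<le> 2 * (series_error m \<omega> * h1norm L (X \<omega>)) + (series_error m \<omega>)\<^sup>2" by linarith
    qed
    also have "\<dots> = 2 * expectation (\<lambda>\<omega>. series_error m \<omega> * h1norm L (X \<omega>)) + expectation (\<lambda>\<omega>. (series_error m \<omega>)\<^sup>2)"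
      using iDX series_error_sq_int by simp
    also have "\<dots> \<le> B m" unfolding B_def using DX by simp
    finally show ?thesis .
  qed
  have "B \<longlonglongrightarrow> 2 * (sqrt 0 * sqrt (expectation (\<lambda>\<omega>. (h1norm L (X \<omega>))\<^sup>2))) + 0"
    unfolding B_def[abs_def] by (intro tendsto_intros series_error_sq_tendsto)
  then have "B \<longlonglongrightarrow> 0" by simp
  then have "(\<lambda>m. (\<Sum>i<m. h * b (a i) (a i)) - expectation (\<lambda>\<omega>. b (X \<omega>) (X \<omega>))) \<longlonglongrightarrow> 0"
    by (rule Lim_null_comparison[rotated]) (use le in \<open>auto intro!: always_eventually\<close>)
  then show "(\<lambda>i. h * b (a i) (a i)) sums expectation (\<lambda>\<omega>. b (X \<omega>) (X \<omega>))"
    unfolding sums_def by (rule LIM_zero_cancel)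
qed

text \<open>The limit \<open>X\<close> is measurable only for the large algebra, so the error is not literally independent of \<open>Y\<close>. It is the almost sure limit along a
  subsequence of the distances between partial sums, which are independent of \<open>Y\<close>; Fatou's lemma passes to the limit.\<close>

lemma nn_integral_indep_series_error:
  assumes Y: "Y \<in> borel_measurable F" "integrable M Y" "\<And>\<omega>. 0 \<le> Y \<omega>"
  shows "(\<integral>\<^sup>+\<omega>. ennreal (Y \<omega> * series_error m \<omega>) \<partial>M) \<le> ennreal (expectation Y * expectation (series_error m))"
proof -
  note [measurable] = measurable_F_imp_M[OF Y(1)]
  have EY: "0 \<le> expectation Y" using Y(3) by (intro integral_nonneg_AE AE_I2)
  have "(\<lambda>n. \<integral>\<omega>. norm (series_error n \<omega>) \<partial>M) \<longlonglongrightarrow> 0" using series_error_tendsto by simp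
  then obtain r :: "nat \<Rightarrow> nat" where r: "strict_mono r" "AE \<omega> in M. (\<lambda>k. series_error (r k) \<omega>) \<longlonglongrightarrow> 0"
    using tendsto_L1_AE_subseq[of M series_error, OF series_error_int] by blast
  define R where "R k \<omega> = h1norm L (\<lambda>x. partial_sum (r k) \<omega> x - partial_sum m \<omega> x)" for k \<omega>
  have RG: "R k \<in> borel_measurable G" for k unfolding R_def[abs_def] by (rule h1norm_partial_sum_diff_meas)
  note [measurable] = measurable_G_imp_M[OF RG]
  have R0: "0 \<le> R k \<omega>" for k \<omega> by (simp add: R_def)
  have Rle: "R k \<omega> \<le> series_error (r k) \<omega> + series_error m \<omega>" and Rge: "series_error m \<omega> \<le> series_error (r k) \<omega> + R k \<omega>" if \<omega>: "\<omega> \<in> space M" for k \<omega>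
    using h1norm_triangle_diff[OF L partial_sum_in_Hm1[of "r k" \<omega>] X_in_Hm1[OF \<omega>] partial_sum_in_Hm1[of m \<omega>]] h1norm_minus_commute[OF L partial_sum_in_Hm1[of "r k" \<omega>] X_in_Hm1[OF \<omega>]]
      h1norm_triangle_diff[OF L X_in_Hm1[OF \<omega>] partial_sum_in_Hm1[of "r k" \<omega>] partial_sum_in_Hm1[of m \<omega>]]
    by (simp_all add: R_def series_error_def)
  have Ri: "integrable M (R k)" for k
  proof (rule Bochner_Integration.integrable_bound)
    show "integrable M (\<lambda>\<omega>. series_error (r k) \<omega> + series_error m \<omega>)" using series_error_int by simp
    show "AE \<omega> in M. norm (R k \<omega>) \<le> norm (series_error (r k) \<omega> + series_error m \<omega>)" using Rle R0 by (intro AE_I2) simp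
  qed measurable
  have le: "(\<integral>\<^sup>+\<omega>. ennreal (Y \<omega> * R k \<omega>) \<partial>M) \<le> ennreal (expectation Y * (expectation (series_error (r k)) + expectation (series_error m)))" for k
  proof -
    note YR = indep_algebras_mult[OF indep spF spG Y(1) RG Y(2) Ri, of k]
    have "(\<integral>\<^sup>+\<omega>. ennreal (Y \<omega> * R k \<omega>) \<partial>M) = ennreal (expectation Y * expectation (R k))"
      using nn_integral_eq_integral[OF YR(1)] YR(2) Y(3) R0 by simp
    also have "expectation (R k) \<le> expectation (\<lambda>\<omega>. series_error (r k) \<omega> + series_error m \<omega>)"
      by (rule integral_mono[OF Ri]) (use series_error_int Rle in auto)
    then have "ennreal (expectation Y * expectation (R k)) \<le> ennreal (expectation Y * (expectation (series_error (r k)) + expectation (series_error m)))"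
      using EY series_error_int by (intro ennreal_leI mult_left_mono) auto
    finally show ?thesis .
  qed
  have "(\<integral>\<^sup>+\<omega>. ennreal (Y \<omega> * series_error m \<omega>) \<partial>M) = (\<integral>\<^sup>+\<omega>. liminf (\<lambda>k. ennreal (Y \<omega> * R k \<omega>)) \<partial>M)"
  proof (rule nn_integral_cong_AE)
    show "AE \<omega> in M. ennreal (Y \<omega> * series_error m \<omega>) = liminf (\<lambda>k. ennreal (Y \<omega> * R k \<omega>))"
      using r(2) AE_space
    proof eventually_elim
      fix \<omega> assume D0: "(\<lambda>k. series_error (r k) \<omega>) \<longlonglongrightarrow> 0" and \<omega>: "\<omega> \<in> space M"
      have "(\<lambda>k. R k \<omega> - series_error m \<omega>) \<longlonglongrightarrow> 0"
        by (rule Lim_null_comparison[OF _ D0]) (use Rle[OF \<omega>] Rge[OF \<omega>] in \<open>auto intro!: always_eventually simp: abs_le_iff algebra_simps\<close>)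
      then have "(\<lambda>k. R k \<omega>) \<longlonglongrightarrow> series_error m \<omega>" by (rule LIM_zero_cancel)
      then have "(\<lambda>k. ennreal (Y \<omega> * R k \<omega>)) \<longlonglongrightarrow> ennreal (Y \<omega> * series_error m \<omega>)" by (intro tendsto_ennrealI tendsto_intros)
      from lim_imp_Liminf[OF _ this] show "ennreal (Y \<omega> * series_error m \<omega>) = liminf (\<lambda>k. ennreal (Y \<omega> * R k \<omega>))" by simp
    qed
  qed
  also have "\<dots> \<le> liminf (\<lambda>k. \<integral>\<^sup>+\<omega>. ennreal (Y \<omega> * R k \<omega>) \<partial>M)"
    by (rule nn_integral_liminf) measurable
  also have "\<dots> \<le> liminf (\<lambda>k. ennreal (expectation Y * (expectation (series_error (r k)) + expectation (series_error m))))"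
    by (intro Liminf_mono always_eventually allI le)
  also have "\<dots> = ennreal (expectation Y * expectation (series_error m))"
  proof (rule lim_imp_Liminf)
    have "(\<lambda>k. expectation (series_error (r k))) \<longlonglongrightarrow> 0" using LIMSEQ_subseq_LIMSEQ[OF series_error_tendsto r(1)] by (simp add: comp_def)
    then have "(\<lambda>k. ennreal (expectation Y * (expectation (series_error (r k)) + expectation (series_error m)))) \<longlonglongrightarrow> ennreal (expectation Y * (0 + expectation (series_error m)))"
      by (intro tendsto_ennrealI tendsto_intros)
    then show "(\<lambda>k. ennreal (expectation Y * (expectation (series_error (r k)) + expectation (series_error m)))) \<longlonglongrightarrow> ennreal (expectation Y * expectation (series_error m))" by simp
  qed simp
  finally show ?thesis .
qed

text \<open>For a partial sum in place of \<open>X\<close>, the expectation vanishes term by term, because each coefficient is centred and independent of \<open>Y\<close>. The remainder is at most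
  the norm of \<open>Y\<close> times the error of the series, and the expectation of this product is at most the product of the expectations, so that a first moment of \<open>Y\<close> suffices.
  The measurable version \<open>Z\<close> of the mixed term is part of the hypotheses; in the application it is obtained by polarization from the
  state after the noise.\<close>

lemma expectation_cross_term:
  assumes b: "weak_h1_form L b" and Y: "Y \<in> F \<rightarrow>\<^sub>M H1_borel L" and iY: "integrable M (\<lambda>\<omega>. l2norm L (Y \<omega>))"
    and Z: "Z \<in> borel_measurable M" and ZE: "AE \<omega> in M. Z \<omega> = b (Y \<omega>) (X \<omega>)"
  shows "integrable M Z" "expectation Z = 0"
proof -
  interpret b: weak_h1_form L b by (rule b)
  note [measurable] = Z
  have YH: "Y \<omega> \<in> Hm L 1" if "\<omega> \<in> space M" for \<omega> using measurable_space[OF Y, of \<omega>] that spF by simp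
  have nY: "(\<lambda>\<omega>. l2norm L (Y \<omega>)) \<in> borel_measurable F"
    by (rule measurable_compose[OF Y l2norm_H1_measurable[OF L e]])
  note [measurable] = measurable_F_imp_M[OF nY]
  have bY: "(\<lambda>\<omega>. b (Y \<omega>) (a i)) \<in> borel_measurable F" for i
  proof -
    have "(\<lambda>\<omega>. b (a i) (Y \<omega>)) \<in> borel_measurable F" by (rule measurable_compose[OF Y b.measurable_left[OF e a]])
    also have "?this \<longleftrightarrow> ?thesis" by (rule measurable_cong) (use YH spF b.sym[OF a] in auto)
    finally show ?thesis .
  qed
  have ibY: "integrable M (\<lambda>\<omega>. b (Y \<omega>) (a i))" for i
  proof (rule Bochner_Integration.integrable_bound)
    show "integrable M (\<lambda>\<omega>. l2norm L (Y \<omega>) * h1norm L (a i))" using iY by simp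
    show "(\<lambda>\<omega>. b (Y \<omega>) (a i)) \<in> borel_measurable M" by (rule measurable_F_imp_M[OF bY])
    show "AE \<omega> in M. norm (b (Y \<omega>) (a i)) \<le> norm (l2norm L (Y \<omega>) * h1norm L (a i))"
      using b.weak_bound[OF YH a] by (intro AE_I2) simp
  qed
  define c where "c m \<omega> = (\<Sum>i<m. b (Y \<omega>) (a i) * \<Delta> i \<omega>)" for m \<omega>
  note prod = indep_algebras_mult[OF indep spF spG bY \<Delta>_meas ibY \<Delta>_int]
  have ci: "integrable M (c m)" for m unfolding c_def[abs_def] by (intro Bochner_Integration.integrable_sum prod(1))
  have c0: "expectation (c m) = 0" for m
    unfolding c_def[abs_def] using prod \<Delta>_exp by (simp add: Bochner_Integration.integral_sum)
  have Zc: "AE \<omega> in M. \<bar>Z \<omega> - c m \<omega>\<bar> \<le> l2norm L (Y \<omega>) * series_error m \<omega>" for m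
    using ZE AE_space
  proof eventually_elim
    fix \<omega> assume z: "Z \<omega> = b (Y \<omega>) (X \<omega>)" and \<omega>: "\<omega> \<in> space M"
    have "c m \<omega> = b (Y \<omega>) (partial_sum m \<omega>)"
      unfolding c_def partial_sum_def b.sum_right[OF a YH[OF \<omega>]] by (simp add: mult.commute)
    then have "Z \<omega> - c m \<omega> = b (Y \<omega>) (\<lambda>x. X \<omega> x - partial_sum m \<omega> x)"
      using z b.diff_right[OF X_in_Hm1[OF \<omega>] partial_sum_in_Hm1 YH[OF \<omega>]] by simp
    then show "\<bar>Z \<omega> - c m \<omega>\<bar> \<le> l2norm L (Y \<omega>) * series_error m \<omega>"
      using b.weak_bound[OF YH[OF \<omega>] Hm1_diff(1)[OF L X_in_Hm1[OF \<omega>] partial_sum_in_Hm1]] by (simp add: series_error_def)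
  qed
  have YD: "integrable M (\<lambda>\<omega>. l2norm L (Y \<omega>) * series_error m \<omega>)" and EYD: "expectation (\<lambda>\<omega>. l2norm L (Y \<omega>) * series_error m \<omega>) \<le> expectation (\<lambda>\<omega>. l2norm L (Y \<omega>)) * expectation (series_error m)" for m
  proof -
    note le = nn_integral_indep_series_error[OF nY iY l2norm_nonneg, of m]
    show *: "integrable M (\<lambda>\<omega>. l2norm L (Y \<omega>) * series_error m \<omega>)"
      using le_less_trans[OF le ennreal_less_top] by (intro integrableI_bounded) auto
    have "ennreal (expectation (\<lambda>\<omega>. l2norm L (Y \<omega>) * series_error m \<omega>)) \<le> ennreal (expectation (\<lambda>\<omega>. l2norm L (Y \<omega>)) * expectation (series_error m))"
      using le nn_integral_eq_integral[OF *] by simp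
    moreover have "0 \<le> expectation (\<lambda>\<omega>. l2norm L (Y \<omega>)) * expectation (series_error m)"
      by (intro mult_nonneg_nonneg integral_nonneg_AE AE_I2) auto
    ultimately show "expectation (\<lambda>\<omega>. l2norm L (Y \<omega>) * series_error m \<omega>) \<le> expectation (\<lambda>\<omega>. l2norm L (Y \<omega>)) * expectation (series_error m)"
      by (simp add: ennreal_le_iff)
  qed
  show Zi: "integrable M Z"
  proof (rule Bochner_Integration.integrable_bound)
    show "integrable M (\<lambda>\<omega>. \<bar>c 0 \<omega>\<bar> + l2norm L (Y \<omega>) * series_error 0 \<omega>)" using ci[of 0] YD[of 0] by simp
    show "AE \<omega> in M. norm (Z \<omega>) \<le> norm (\<bar>c 0 \<omega>\<bar> + l2norm L (Y \<omega>) * series_error 0 \<omega>)"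
      using Zc[of 0] by eventually_elim simp
  qed measurable
  have le: "\<bar>expectation Z\<bar> \<le> expectation (\<lambda>\<omega>. l2norm L (Y \<omega>)) * expectation (series_error m)" for m
  proof -
    have "expectation Z = expectation (\<lambda>\<omega>. Z \<omega> - c m \<omega>)" using Zi ci c0 by simp
    also have "\<bar>\<dots>\<bar> \<le> expectation (\<lambda>\<omega>. \<bar>Z \<omega> - c m \<omega>\<bar>)" by (rule integral_abs_bound)
    also have "\<dots> \<le> expectation (\<lambda>\<omega>. l2norm L (Y \<omega>) * series_error m \<omega>)"
      by (rule integral_mono_AE[OF _ YD Zc]) (use Zi ci in simp)
    finally show ?thesis using EYD[of m] by simp
  qed
  have "(\<lambda>m. expectation (\<lambda>\<omega>. l2norm L (Y \<omega>)) * expectation (series_error m)) \<longlonglongrightarrow> expectation (\<lambda>\<omega>. l2norm L (Y \<omega>)) * 0"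
    by (intro tendsto_intros series_error_tendsto)
  then have "\<bar>expectation Z\<bar> \<le> expectation (\<lambda>\<omega>. l2norm L (Y \<omega>)) * 0"
    by (rule LIMSEQ_le_const) (use le in auto)
  then show "expectation Z = 0" by simp
qed

end

section \<open>One step of the scheme in expectation\<close>

context wiener_noise
begin

text \<open>By polarization, the mixed term of \<open>Y\<close> and \<open>X\<close> is half the excess of the quadratic functional of the sum over those of the two summands. The growth is
  stated for the difference, since \<open>b (Y \<omega>) (Y \<omega>)\<close> alone need not be integrable.\<close>

lemma quadratic_growth:
  assumes b: "weak_h1_form L b" and Y: "Y \<in> F \<rightarrow>\<^sub>M H1_borel L" and iY: "integrable M (\<lambda>\<omega>. l2norm L (Y \<omega>))"
    and W: "W \<in> M \<rightarrow>\<^sub>M H1_borel L" and WE: "AE \<omega> in M. aeq L (W \<omega>) (\<lambda>x. Y \<omega> x + X \<omega> x)"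
  shows "integrable M (\<lambda>\<omega>. b (W \<omega>) (W \<omega>) - b (Y \<omega>) (Y \<omega>))"
    "(\<lambda>i. h * b (a i) (a i)) sums expectation (\<lambda>\<omega>. b (W \<omega>) (W \<omega>) - b (Y \<omega>) (Y \<omega>))"
proof -
  interpret b: weak_h1_form L b by (rule b)
  note [measurable] = measurable_compose[OF W b.measurable_quadratic[OF e]]
    measurable_compose[OF measurable_F_imp_M[OF Y] b.measurable_quadratic[OF e]] form_XX_meas[OF b.h1_form_axioms]
  note quad = expectation_quadratic[OF b.h1_form_axioms]
  define Z where "Z \<omega> = (b (W \<omega>) (W \<omega>) - b (Y \<omega>) (Y \<omega>) - b (X \<omega>) (X \<omega>)) / 2" for \<omega>
  have Zm: "Z \<in> borel_measurable M" unfolding Z_def[abs_def] by measurable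
  have ZE: "AE \<omega> in M. Z \<omega> = b (Y \<omega>) (X \<omega>)"
    using WE AE_space
  proof eventually_elim
    fix \<omega> assume eq: "aeq L (W \<omega>) (\<lambda>x. Y \<omega> x + X \<omega> x)" and \<omega>: "\<omega> \<in> space M"
    have H: "W \<omega> \<in> Hm L 1" "Y \<omega> \<in> Hm L 1" "X \<omega> \<in> Hm L 1"
      using measurable_space[OF W \<omega>] measurable_space[OF measurable_F_imp_M[OF Y] \<omega>] X_in_Hm1[OF \<omega>] by auto
    have "b (W \<omega>) (W \<omega>) = b (\<lambda>x. Y \<omega> x + X \<omega> x) (\<lambda>x. Y \<omega> x + X \<omega> x)"
      by (rule b.quadratic_cong[OF H(1) Hm1_add(1)[OF L H(2,3)] eq])
    then show "Z \<omega> = b (Y \<omega>) (X \<omega>)" unfolding Z_def b.quadratic_add[OF H(2,3)] by simp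
  qed
  note Z = expectation_cross_term[OF b Y iY Zm ZE]
  have eq: "(\<lambda>\<omega>. b (W \<omega>) (W \<omega>) - b (Y \<omega>) (Y \<omega>)) = (\<lambda>\<omega>. 2 * Z \<omega> + b (X \<omega>) (X \<omega>))"
    by (auto simp: Z_def fun_eq_iff field_simps)
  show "integrable M (\<lambda>\<omega>. b (W \<omega>) (W \<omega>) - b (Y \<omega>) (Y \<omega>))" unfolding eq using Z quad by simp
  show "(\<lambda>i. h * b (a i) (a i)) sums expectation (\<lambda>\<omega>. b (W \<omega>) (W \<omega>) - b (Y \<omega>) (Y \<omega>))"
    unfolding eq using Z quad by simp
qed

lemma X_l2norm_integrable: "integrable M (\<lambda>\<omega>. l2norm L (X \<omega>))"
proof (rule Bochner_Integration.integrable_bound)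
  show "integrable M (\<lambda>\<omega>. 1 + (h1norm L (X \<omega>))\<^sup>2)" using X_norm_int by simp
  show "(\<lambda>\<omega>. l2norm L (X \<omega>)) \<in> borel_measurable M" by (rule measurable_compose[OF X l2norm_H1_measurable[OF L e]])
  show "AE \<omega> in M. norm (l2norm L (X \<omega>)) \<le> norm (1 + (h1norm L (X \<omega>))\<^sup>2)"
  proof (rule AE_I2)
    fix \<omega>
    have "2 * 1 * h1norm L (X \<omega>) \<le> 1\<^sup>2 + (h1norm L (X \<omega>))\<^sup>2" by (rule sum_squares_bound)
    then show "norm (l2norm L (X \<omega>)) \<le> norm (1 + (h1norm L (X \<omega>))\<^sup>2)"
      using l2norm_le_h1norm[of L "X \<omega>"] h1norm_nonneg[of L "X \<omega>"] by (simp del: h1norm_nonneg)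
  qed
qed

end

context prob_space
begin

lemma wiener_noise_increment:
  assumes L: "L > 0" and W1: "cylindrical_wiener L M e1 B1" and W2: "cylindrical_wiener L M e2 B2"
    and ind: "indep_wiener M B1 B2" and \<Phi>: "hilbert_schmidt_H1 L \<Phi>" and t: "0 \<le> t" "t < t'"
    and X: "wiener_increment L M e1 B1 \<Phi> t t' X"
  shows "wiener_noise M (wiener_filtration M B1 B2 t) (increment_algebra B1 t t') L (t' - t) e1
    (\<lambda>i. \<Phi> (e1 i)) (\<lambda>i \<omega>. B1 i t' \<omega> - B1 i t \<omega>) (X :: 'a \<Rightarrow> real \<Rightarrow> 'c::euclidean_space)"
proof unfold_locales
  have e: "orthonormal_basis L e1" using W1 by (simp add: cylindrical_wiener_def)
  then show "orthonormal_basis L e1" .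
  have "e1 i \<in> L2 L" for i using e by (simp add: orthonormal_basis_def)
  then show "\<Phi> (e1 i) \<in> Hm L 1" for i using \<Phi> by (simp add: hilbert_schmidt_H1_def)
  show "indep_set (sets (wiener_filtration M B1 B2 t)) (sets (increment_algebra B1 t t'))"
    by (rule filtration_indep_increments[OF W1 W2 ind t])
  show "X \<in> M \<rightarrow>\<^sub>M H1_borel L"
    "(\<lambda>m. \<integral>\<^sup>+ \<omega>. ennreal ((h1norm L (\<lambda>x. X \<omega> x - (\<Sum>i<m. (B1 i t' \<omega> - B1 i t \<omega>) *\<^sub>R \<Phi> (e1 i) x)))\<^sup>2) \<partial>M) \<longlonglongrightarrow> 0"
    using X by (auto simp: wiener_increment_def)
qed (use L increment_measurable increment_moments[OF W1 t] in auto)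

end

lemma const_Hm1: "L > 0 \<Longrightarrow> (\<lambda>_. c :: 'a::euclidean_space) \<in> Hm L 1"
proof -
  assume L: "L > 0"
  have "periodic_AC L (\<lambda>_. c) (\<lambda>_. 0)" by (simp add: periodic_AC_def L2_const)
  from has_wderiv_Hm1[OF periodic_AC_has_wderiv[OF L this]] show ?thesis .
qed

lemma momentum_energy_eq:
  assumes U: "U \<in> Hm L 1" and V: "V \<in> Hm L 1"
  shows "(\<integral>x. Im (U x * cnj (Dx L 1 U x)) + c * (V x)\<^sup>2 \<partial>Om L) = momentum_form L U U + c * (l2norm L V)\<^sup>2"
proof -
  have eq: "Im (U x * cnj (Dx L 1 U x)) = U x \<bullet> (\<i> * Dx L 1 U x)" for x
    by (simp add: inner_complex_def)
  have 1: "integrable (Om L) (\<lambda>x. U x \<bullet> (\<i> * Dx L 1 U x))"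
    by (rule l2ip_integrable[OF Hm_L2[OF U] L2_bounded_linear[OF bounded_linear_times_ii Dx1_L2[OF U]]])
  have 2: "integrable (Om L) (\<lambda>x. (V x)\<^sup>2)" using L2_norm_sq[OF Hm_L2[OF V]] by simp
  show ?thesis unfolding eq using 1 2 by (simp add: momentum_form_def l2ip_def l2norm_sq_eq)
qed

lemma momentum_form_eq_inner_C:
  assumes U: "U \<in> Hm L 1" shows "momentum_form L U U = - Im (inner_C L (Dx L 1 U) U)"
proof -
  have "U x \<bullet> (\<i> * Dx L 1 U x) = Im (U x * cnj (Dx L 1 U x))" for x by (simp add: inner_complex_def)
  then show ?thesis unfolding Im_inner_C_Dx[OF U] by (simp add: momentum_form_def l2ip_def)
qed

text \<open>The inner product is conjugate-linear in its second argument, which accounts for the sign. Summability follows from that of the squared Sobolev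
  norms.\<close>

lemma momentum_trace:
  assumes \<Phi>: "hilbert_schmidt_H1 L \<Phi>" and e: "orthonormal_basis L e"
  shows "(\<lambda>i. momentum_form L (\<Phi> (e i)) (\<Phi> (e i))) sums (- Im (trace_adj L e \<Phi> (Dx L 1 \<circ> \<Phi>)))"
proof -
  have H: "\<Phi> (e i) \<in> Hm L 1" for i
    using \<Phi> e by (simp add: hilbert_schmidt_H1_def orthonormal_basis_def)
  define z where "z i = inner_C L (Dx L 1 (\<Phi> (e i))) (\<Phi> (e i))" for i
  have le: "norm (z i) \<le> (h1norm L (\<Phi> (e i)))\<^sup>2" for i
  proof -
    let ?a = "\<Phi> (e i)"
    have "cmod (z i) \<le> (\<integral>x. cmod (Dx L 1 ?a x * cnj (?a x)) \<partial>Om L)" unfolding z_def inner_C_def by (rule integral_norm_bound)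
    also have "\<dots> = (\<integral>x. cmod (Dx L 1 ?a x) * cmod (?a x) \<partial>Om L)" by (simp add: norm_mult)
    also have "\<dots> \<le> l2norm L (Dx L 1 ?a) * l2norm L ?a" by (rule L2_norm_prod_le[OF Dx1_L2[OF H] Hm_L2[OF H]])
    also have "\<dots> \<le> h1norm L ?a * h1norm L ?a" by (intro mult_mono l2norm_le_h1norm l2norm_Dx_le_h1norm) auto
    finally show ?thesis by (simp add: power2_eq_square)
  qed
  have "summable (\<lambda>i. (h1norm L (\<Phi> (e i)))\<^sup>2)" using \<Phi> e by (simp add: hilbert_schmidt_H1_def)
  then have "summable z" by (rule summable_comparison_test') (rule le)
  then have "z sums trace_adj L e \<Phi> (Dx L 1 \<circ> \<Phi>)" unfolding trace_adj_def z_def by (simp add: summable_sums)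
  from sums_minus[OF bounded_linear.sums[OF bounded_linear_Im this]]
  show ?thesis by (simp add: z_def momentum_form_eq_inner_C[OF H])
qed

lemma hs_norm_sq_sums:
  fixes \<Phi> :: "(real \<Rightarrow> real) \<Rightarrow> (real \<Rightarrow> 'a::euclidean_space)"
  assumes \<Phi>: "hilbert_schmidt_H1 L \<Phi>" and e: "orthonormal_basis L e"
  shows "(\<lambda>i. l2ip L (\<Phi> (e i)) (\<Phi> (e i))) sums hs_norm_sq L e \<Phi>"
proof -
  have "summable (\<lambda>i. (h1norm L (\<Phi> (e i)))\<^sup>2)" using \<Phi> e by (simp add: hilbert_schmidt_H1_def)
  then have "summable (\<lambda>i. (l2norm L (\<Phi> (e i)))\<^sup>2)"
    by (rule summable_comparison_test'[of _ 0]) (auto intro!: power_mono l2norm_le_h1norm)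
  then show ?thesis unfolding hs_norm_sq_def l2norm_sq[symmetric] by (rule summable_sums)
qed

text \<open>What is carried from step to step: the second moment of the norm of \<open>U\<close>, the first moment of the norm of \<open>V\<close>, and the integrability of the mean of \<open>V\<close>
  and of the combination of momentum and energy. Momentum and square norm of \<open>V\<close> are never integrated separately; only their growth through
  the noise is.\<close>

lemma (in prob_space) splitting_step:
  fixes \<gamma>1 \<gamma>2 \<beta> :: real
  assumes L: "L > 0" and W1: "cylindrical_wiener L M e1 B1" and W2: "cylindrical_wiener L M e2 B2"
    and ind: "indep_wiener M B1 B2" and g: "\<gamma>1 * \<gamma>2 > 0"
    and \<Phi>1: "hilbert_schmidt_H1 L \<Phi>1" and \<Phi>2: "hilbert_schmidt_H1 L \<Phi>2" and t: "0 \<le> t" "t < t'"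
    and U: "U \<in> M \<rightarrow>\<^sub>M H1_borel L" and V: "V \<in> M \<rightarrow>\<^sub>M H1_borel L"
    and U': "U' \<in> wiener_filtration M B1 B2 t \<rightarrow>\<^sub>M H1_borel L" and V': "V' \<in> wiener_filtration M B1 B2 t \<rightarrow>\<^sub>M H1_borel L"
    and step: "AE \<omega> in M. CN_step L \<gamma>1 \<gamma>2 \<beta> (t' - t) (U \<omega>) (V \<omega>) (U' \<omega>) (V' \<omega>)"
    and X1: "wiener_increment L M e1 B1 \<Phi>1 t t' X1" and X2: "wiener_increment L M e2 B2 \<Phi>2 t t' X2"
    and U1: "U1 \<in> M \<rightarrow>\<^sub>M H1_borel L" and V1: "V1 \<in> M \<rightarrow>\<^sub>M H1_borel L"
    and U1E: "AE \<omega> in M. aeq L (U1 \<omega>) (\<lambda>x. U' \<omega> x + X1 \<omega> x)" and V1E: "AE \<omega> in M. aeq L (V1 \<omega>) (\<lambda>x. V' \<omega> x + X2 \<omega> x)"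
    and iU: "integrable M (\<lambda>\<omega>. (l2norm L (U \<omega>))\<^sup>2)" and iV: "integrable M (\<lambda>\<omega>. l2norm L (V \<omega>))"
    and iI: "integrable M (\<lambda>\<omega>. \<integral>x. V \<omega> x \<partial>Om L)"
    and iP: "integrable M (\<lambda>\<omega>. momentum_form L (U \<omega>) (U \<omega>) + \<gamma>1 / (2 * \<gamma>2) * (l2norm L (V \<omega>))\<^sup>2)"
  shows "integrable M (\<lambda>\<omega>. (l2norm L (U1 \<omega>))\<^sup>2)" "integrable M (\<lambda>\<omega>. l2norm L (V1 \<omega>))"
    "integrable M (\<lambda>\<omega>. \<integral>x. V1 \<omega> x \<partial>Om L)"
    "integrable M (\<lambda>\<omega>. momentum_form L (U1 \<omega>) (U1 \<omega>) + \<gamma>1 / (2 * \<gamma>2) * (l2norm L (V1 \<omega>))\<^sup>2)"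
    "expectation (\<lambda>\<omega>. (l2norm L (U1 \<omega>))\<^sup>2) = expectation (\<lambda>\<omega>. (l2norm L (U \<omega>))\<^sup>2) + hs_norm_sq L e1 \<Phi>1 * (t' - t)"
    "expectation (\<lambda>\<omega>. \<integral>x. V1 \<omega> x \<partial>Om L) = expectation (\<lambda>\<omega>. \<integral>x. V \<omega> x \<partial>Om L)"
    "expectation (\<lambda>\<omega>. momentum_form L (U1 \<omega>) (U1 \<omega>) + \<gamma>1 / (2 * \<gamma>2) * (l2norm L (V1 \<omega>))\<^sup>2)
      = expectation (\<lambda>\<omega>. momentum_form L (U \<omega>) (U \<omega>) + \<gamma>1 / (2 * \<gamma>2) * (l2norm L (V \<omega>))\<^sup>2)
        + (- Im (trace_adj L e1 \<Phi>1 (Dx L 1 \<circ> \<Phi>1)) + \<gamma>1 / (2 * \<gamma>2) * hs_norm_sq L e2 \<Phi>2) * (t' - t)"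
proof -
  define h where "h = t' - t"
  define c where "c = \<gamma>1 / (2 * \<gamma>2)"
  have h: "h > 0" using t by (simp add: h_def)
  have e1: "orthonormal_basis L e1" and e2: "orthonormal_basis L e2" using W1 W2 by (auto simp: cylindrical_wiener_def)
  let ?F = "wiener_filtration M B1 B2 t"
  interpret N1: wiener_noise M ?F "increment_algebra B1 t t'" L h e1 "\<lambda>i. \<Phi>1 (e1 i)" "\<lambda>i \<omega>. B1 i t' \<omega> - B1 i t \<omega>" X1
    unfolding h_def by (rule wiener_noise_increment[OF L W1 W2 ind \<Phi>1 t X1])
  interpret N2: wiener_noise M ?F "increment_algebra B2 t t'" L h e2 "\<lambda>i. \<Phi>2 (e2 i)" "\<lambda>i \<omega>. B2 i t' \<omega> - B2 i t \<omega>" X2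
    unfolding h_def wiener_filtration_sym[of B1]
    by (rule wiener_noise_increment[OF L W2 W1 indep_wiener_sym[OF ind] \<Phi>2 t X2])
  note U'M = N1.measurable_F_imp_M[OF U'] and V'M = N1.measurable_F_imp_M[OF V']
  have nC[measurable]: "(l2norm L :: (real \<Rightarrow> complex) \<Rightarrow> real) \<in> borel_measurable (H1_borel L)"
    and nR[measurable]: "(l2norm L :: (real \<Rightarrow> real) \<Rightarrow> real) \<in> borel_measurable (H1_borel L)"
    by (rule l2norm_H1_measurable[OF L e1])+
  note nU[measurable] = measurable_compose[OF U nC] measurable_compose[OF U'M nC] measurable_compose[OF U1 nC]
  note nV[measurable] = measurable_compose[OF V nR] measurable_compose[OF V'M nR] measurable_compose[OF V1 nR]
  interpret lC: weak_h1_form L "l2ip L :: (real \<Rightarrow> complex) \<Rightarrow> _" by (rule weak_h1_form_l2ip[OF L])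
  interpret lR: weak_h1_form L "l2ip L :: (real \<Rightarrow> real) \<Rightarrow> _" by (rule weak_h1_form_l2ip[OF L])
  interpret m: weak_h1_form L "momentum_form L" by (rule weak_h1_form_momentum[OF L])
  note mU[measurable] = measurable_compose[OF U m.measurable_quadratic[OF e1]]
    measurable_compose[OF U'M m.measurable_quadratic[OF e1]] measurable_compose[OF U1 m.measurable_quadratic[OF e1]]
  obtain C where C: "0 \<le> C" "\<And>U V U' V'. CN_step L \<gamma>1 \<gamma>2 \<beta> h U V U' V' \<Longrightarrow> U \<in> Hm L 1 \<Longrightarrow> V \<in> Hm L 1 \<Longrightarrow> U' \<in> Hm L 1 \<Longrightarrow> V' \<in> Hm L 1
      \<Longrightarrow> l2norm L V' \<le> C * (1 + l2norm L V + (l2norm L U)\<^sup>2)"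
    using CN_step_bound[OF L h g, of \<beta>] by metis
  have H: "U \<omega> \<in> Hm L 1" "V \<omega> \<in> Hm L 1" "U' \<omega> \<in> Hm L 1" "V' \<omega> \<in> Hm L 1" "U1 \<omega> \<in> Hm L 1" "V1 \<omega> \<in> Hm L 1"
    if "\<omega> \<in> space M" for \<omega>
    using that U V U'M V'M U1 V1 by (auto dest: measurable_space)
  have cons: "AE \<omega> in M. l2norm L (U' \<omega>) = l2norm L (U \<omega>) \<and> (\<integral>x. V' \<omega> x \<partial>Om L) = (\<integral>x. V \<omega> x \<partial>Om L)
    \<and> momentum_form L (U' \<omega>) (U' \<omega>) + c * (l2norm L (V' \<omega>))\<^sup>2 = momentum_form L (U \<omega>) (U \<omega>) + c * (l2norm L (V \<omega>))\<^sup>2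
    \<and> l2norm L (V' \<omega>) \<le> C * (1 + l2norm L (V \<omega>) + (l2norm L (U \<omega>))\<^sup>2)"
    using step AE_space
  proof eventually_elim
    fix \<omega> assume s: "CN_step L \<gamma>1 \<gamma>2 \<beta> (t' - t) (U \<omega>) (V \<omega>) (U' \<omega>) (V' \<omega>)" and \<omega>: "\<omega> \<in> space M"
    note s = s[folded h_def] and H = H[OF \<omega>]
    show "l2norm L (U' \<omega>) = l2norm L (U \<omega>) \<and> (\<integral>x. V' \<omega> x \<partial>Om L) = (\<integral>x. V \<omega> x \<partial>Om L)
      \<and> momentum_form L (U' \<omega>) (U' \<omega>) + c * (l2norm L (V' \<omega>))\<^sup>2 = momentum_form L (U \<omega>) (U \<omega>) + c * (l2norm L (V \<omega>))\<^sup>2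
      \<and> l2norm L (V' \<omega>) \<le> C * (1 + l2norm L (V \<omega>) + (l2norm L (U \<omega>))\<^sup>2)"
      unfolding c_def by (intro conjI CN_step_conserved[OF L h s g H(1-4)] C(2)[OF s H(1-4)])
  qed
  have iU'2: "integrable M (\<lambda>\<omega>. (l2norm L (U' \<omega>))\<^sup>2)" and eU'2: "expectation (\<lambda>\<omega>. (l2norm L (U' \<omega>))\<^sup>2) = expectation (\<lambda>\<omega>. (l2norm L (U \<omega>))\<^sup>2)"
  proof -
    have ae: "AE \<omega> in M. (l2norm L (U \<omega>))\<^sup>2 = (l2norm L (U' \<omega>))\<^sup>2" using cons by eventually_elim simp
    show "integrable M (\<lambda>\<omega>. (l2norm L (U' \<omega>))\<^sup>2)" by (rule integrable_cong_AE_imp[OF iU _ ae]) measurable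
    show "expectation (\<lambda>\<omega>. (l2norm L (U' \<omega>))\<^sup>2) = expectation (\<lambda>\<omega>. (l2norm L (U \<omega>))\<^sup>2)"
      by (rule integral_cong_AE[symmetric, OF _ _ ae]) measurable
  qed
  have iU': "integrable M (\<lambda>\<omega>. l2norm L (U' \<omega>))"
    using integral_Cauchy_Schwarz(1)[OF nU(2) _ iU'2, of "\<lambda>_. 1"] by simp
  have iV': "integrable M (\<lambda>\<omega>. l2norm L (V' \<omega>))"
  proof (rule Bochner_Integration.integrable_bound)
    show "integrable M (\<lambda>\<omega>. C * (1 + l2norm L (V \<omega>) + (l2norm L (U \<omega>))\<^sup>2))" using iU iV by simp
    show "AE \<omega> in M. norm (l2norm L (V' \<omega>)) \<le> norm (C * (1 + l2norm L (V \<omega>) + (l2norm L (U \<omega>))\<^sup>2))"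
      using cons by eventually_elim auto
  qed measurable
  note stepU = N1.quadratic_growth[OF weak_h1_form_l2ip[OF L] U' iU' U1 U1E]
  note stepM = N1.quadratic_growth[OF weak_h1_form_momentum[OF L] U' iU' U1 U1E]
  note stepV = N2.quadratic_growth[OF weak_h1_form_l2ip[OF L] V' iV' V1 V1E]
  have EU: "expectation (\<lambda>\<omega>. (l2norm L (U1 \<omega>))\<^sup>2 - (l2norm L (U' \<omega>))\<^sup>2) = h * hs_norm_sq L e1 \<Phi>1"
    using sums_unique2[OF stepU(2) sums_mult[OF hs_norm_sq_sums[OF \<Phi>1 e1]]] by (simp add: l2norm_sq)
  have EV: "expectation (\<lambda>\<omega>. (l2norm L (V1 \<omega>))\<^sup>2 - (l2norm L (V' \<omega>))\<^sup>2) = h * hs_norm_sq L e2 \<Phi>2"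
    using sums_unique2[OF stepV(2) sums_mult[OF hs_norm_sq_sums[OF \<Phi>2 e2]]] by (simp add: l2norm_sq)
  have EM: "expectation (\<lambda>\<omega>. momentum_form L (U1 \<omega>) (U1 \<omega>) - momentum_form L (U' \<omega>) (U' \<omega>)) = h * (- Im (trace_adj L e1 \<Phi>1 (Dx L 1 \<circ> \<Phi>1)))"
    by (rule sums_unique2[OF stepM(2) sums_mult[OF momentum_trace[OF \<Phi>1 e1]]])
  have dU: "integrable M (\<lambda>\<omega>. (l2norm L (U1 \<omega>))\<^sup>2 - (l2norm L (U' \<omega>))\<^sup>2)" using stepU(1) by (simp add: l2norm_sq)
  have dV: "integrable M (\<lambda>\<omega>. (l2norm L (V1 \<omega>))\<^sup>2 - (l2norm L (V' \<omega>))\<^sup>2)" using stepV(1) by (simp add: l2norm_sq)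
  show "integrable M (\<lambda>\<omega>. (l2norm L (U1 \<omega>))\<^sup>2)" using Bochner_Integration.integrable_add[OF dU iU'2] by simp
  then show "expectation (\<lambda>\<omega>. (l2norm L (U1 \<omega>))\<^sup>2) = expectation (\<lambda>\<omega>. (l2norm L (U \<omega>))\<^sup>2) + hs_norm_sq L e1 \<Phi>1 * (t' - t)"
    using EU eU'2 iU'2 by (simp add: h_def mult.commute)
  show "integrable M (\<lambda>\<omega>. l2norm L (V1 \<omega>))"
  proof (rule Bochner_Integration.integrable_bound)
    show "integrable M (\<lambda>\<omega>. l2norm L (V' \<omega>) + l2norm L (X2 \<omega>))" using iV' N2.X_l2norm_integrable by simp
    show "AE \<omega> in M. norm (l2norm L (V1 \<omega>)) \<le> norm (l2norm L (V' \<omega>) + l2norm L (X2 \<omega>))"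
      using V1E AE_space
    proof eventually_elim
      fix \<omega> assume eq: "aeq L (V1 \<omega>) (\<lambda>x. V' \<omega> x + X2 \<omega> x)" and \<omega>: "\<omega> \<in> space M"
      note K = Hm_L2[OF H(6)[OF \<omega>]] Hm_L2[OF H(4)[OF \<omega>]] Hm_L2[OF N2.X_in_Hm1[OF \<omega>]]
      have "l2norm L (V1 \<omega>) = l2norm L (\<lambda>x. V' \<omega> x + X2 \<omega> x)" by (rule l2norm_cong[OF K(1) L2_add[OF K(2,3)] eq])
      also have "\<dots> \<le> l2norm L (V' \<omega>) + l2norm L (X2 \<omega>)" by (rule l2norm_triangle[OF K(2,3)])
      finally show "norm (l2norm L (V1 \<omega>)) \<le> norm (l2norm L (V' \<omega>) + l2norm L (X2 \<omega>))" by simp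
    qed
  qed measurable
  have mean: "(\<integral>x. v x \<partial>Om L) = l2ip L (\<lambda>_. 1) v" for v :: "real \<Rightarrow> real" by (simp add: l2ip_def)
  have one: "(\<lambda>_. 1 :: real) \<in> Hm L 1" by (rule const_Hm1[OF L])
  note mmeas = measurable_compose[OF _ lR.measurable_left[OF e1 one], folded mean]
  note [measurable] = mmeas[OF V] mmeas[OF V'M] mmeas[OF V1]
  have I2: "integrable M (\<lambda>\<omega>. \<integral>x. X2 \<omega> x \<partial>Om L)" "expectation (\<lambda>\<omega>. \<integral>x. X2 \<omega> x \<partial>Om L) = 0"
  proof -
    \<comment> \<open>the mean of the increment is its product with the constant function, a deterministic state\<close>
    have "(\<lambda>_. \<lambda>_. 1) \<in> ?F \<rightarrow>\<^sub>M (H1_borel L :: (real \<Rightarrow> real) measure)" using one by simp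
    note cross = N2.expectation_cross_term[OF weak_h1_form_l2ip[OF L] this _ mmeas[OF N2.X]]
    show "integrable M (\<lambda>\<omega>. \<integral>x. X2 \<omega> x \<partial>Om L)" "expectation (\<lambda>\<omega>. \<integral>x. X2 \<omega> x \<partial>Om L) = 0"
      by (rule cross; simp add: mean)+
  qed
  have meanE: "AE \<omega> in M. (\<integral>x. V \<omega> x \<partial>Om L) + (\<integral>x. X2 \<omega> x \<partial>Om L) = (\<integral>x. V1 \<omega> x \<partial>Om L)"
    using V1E cons AE_space
  proof eventually_elim
    fix \<omega> assume eq: "aeq L (V1 \<omega>) (\<lambda>x. V' \<omega> x + X2 \<omega> x)" and \<omega>: "\<omega> \<in> space M"
      and co: "l2norm L (U' \<omega>) = l2norm L (U \<omega>) \<and> (\<integral>x. V' \<omega> x \<partial>Om L) = (\<integral>x. V \<omega> x \<partial>Om L)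
        \<and> momentum_form L (U' \<omega>) (U' \<omega>) + c * (l2norm L (V' \<omega>))\<^sup>2 = momentum_form L (U \<omega>) (U \<omega>) + c * (l2norm L (V \<omega>))\<^sup>2
        \<and> l2norm L (V' \<omega>) \<le> C * (1 + l2norm L (V \<omega>) + (l2norm L (U \<omega>))\<^sup>2)"
    note K = Hm_L2[OF H(6)[OF \<omega>]] Hm_L2[OF H(4)[OF \<omega>]] Hm_L2[OF N2.X_in_Hm1[OF \<omega>]]
    have "(\<integral>x. V1 \<omega> x \<partial>Om L) = (\<integral>x. V' \<omega> x + X2 \<omega> x \<partial>Om L)"
      by (rule aeq_integral[OF L2_meas[OF K(1)] L2_meas[OF L2_add[OF K(2,3)]] eq])
    also have "\<dots> = (\<integral>x. V' \<omega> x \<partial>Om L) + (\<integral>x. X2 \<omega> x \<partial>Om L)"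
      by (rule Bochner_Integration.integral_add[OF L2_integrable[OF K(2)] L2_integrable[OF K(3)]])
    finally show "(\<integral>x. V \<omega> x \<partial>Om L) + (\<integral>x. X2 \<omega> x \<partial>Om L) = (\<integral>x. V1 \<omega> x \<partial>Om L)" using co by simp
  qed
  note iS = Bochner_Integration.integrable_add[OF iI I2(1)]
  show "integrable M (\<lambda>\<omega>. \<integral>x. V1 \<omega> x \<partial>Om L)" by (rule integrable_cong_AE_imp[OF iS mmeas[OF V1] meanE])
  have "expectation (\<lambda>\<omega>. \<integral>x. V1 \<omega> x \<partial>Om L) = expectation (\<lambda>\<omega>. (\<integral>x. V \<omega> x \<partial>Om L) + (\<integral>x. X2 \<omega> x \<partial>Om L))"
    by (rule integral_cong_AE[symmetric, OF borel_measurable_integrable[OF iS] mmeas[OF V1] meanE])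
  then show "expectation (\<lambda>\<omega>. \<integral>x. V1 \<omega> x \<partial>Om L) = expectation (\<lambda>\<omega>. \<integral>x. V \<omega> x \<partial>Om L)"
    using I2 iI by simp
  let ?P = "\<lambda>U V \<omega>. momentum_form L (U \<omega>) (U \<omega>) + c * (l2norm L (V \<omega>))\<^sup>2"
  have iP': "integrable M (?P U' V')" and eP': "expectation (?P U' V') = expectation (?P U V)"
  proof -
    have ae: "AE \<omega> in M. ?P U V \<omega> = ?P U' V' \<omega>" using cons by eventually_elim simp
    show "integrable M (?P U' V')" by (rule integrable_cong_AE_imp[OF iP[folded c_def] _ ae]) measurable
    show "expectation (?P U' V') = expectation (?P U V)" by (rule integral_cong_AE[symmetric, OF _ _ ae]) measurable
  qed
  have eq: "?P U1 V1 = (\<lambda>\<omega>. ?P U' V' \<omega> + ((momentum_form L (U1 \<omega>) (U1 \<omega>) - momentum_form L (U' \<omega>) (U' \<omega>))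
      + c * ((l2norm L (V1 \<omega>))\<^sup>2 - (l2norm L (V' \<omega>))\<^sup>2)))"
    by (simp add: fun_eq_iff right_diff_distrib)
  have "integrable M (?P U1 V1)" unfolding eq
    by (rule Bochner_Integration.integrable_add[OF iP' Bochner_Integration.integrable_add[OF stepM(1) integrable_mult_right[OF dV]]])
  then show "integrable M (\<lambda>\<omega>. momentum_form L (U1 \<omega>) (U1 \<omega>) + \<gamma>1 / (2 * \<gamma>2) * (l2norm L (V1 \<omega>))\<^sup>2)" by (simp add: c_def)
  have EP: "expectation (?P U1 V1) = expectation (?P U' V') + (h * (- Im (trace_adj L e1 \<Phi>1 (Dx L 1 \<circ> \<Phi>1))) + c * (h * hs_norm_sq L e2 \<Phi>2))"
    unfolding eq EM[symmetric] EV[symmetric]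
    using Bochner_Integration.integral_add[OF iP' Bochner_Integration.integrable_add[OF stepM(1) integrable_mult_right[OF dV, of c]]]
      Bochner_Integration.integral_add[OF stepM(1) integrable_mult_right[OF dV, of c]] by simp
  have rearrange: "x = y + (A + c * B) * h" if "x = y + (h * A + c * (h * B))" for x y A B :: real
    using that by (simp add: algebra_simps)
  show "expectation (\<lambda>\<omega>. momentum_form L (U1 \<omega>) (U1 \<omega>) + \<gamma>1 / (2 * \<gamma>2) * (l2norm L (V1 \<omega>))\<^sup>2)
      = expectation (\<lambda>\<omega>. momentum_form L (U \<omega>) (U \<omega>) + \<gamma>1 / (2 * \<gamma>2) * (l2norm L (V \<omega>))\<^sup>2)
        + (- Im (trace_adj L e1 \<Phi>1 (Dx L 1 \<circ> \<Phi>1)) + \<gamma>1 / (2 * \<gamma>2) * hs_norm_sq L e2 \<Phi>2) * (t' - t)"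
    using rearrange[OF EP[unfolded eP']] by (simp only: c_def h_def)
qed

section \<open>Evolution of mass, mean and momentum\<close>

theorem lemma3p1:
  fixes L T \<gamma>1 \<gamma>2 \<beta> :: real and N :: nat
    and M :: "'w measure"
    and e1 e2 :: "nat \<Rightarrow> real \<Rightarrow> real"
    and B1 B2 :: "nat \<Rightarrow> real \<Rightarrow> 'w \<Rightarrow> real"
    and \<Phi>1 :: "(real \<Rightarrow> real) \<Rightarrow> (real \<Rightarrow> complex)"
    and \<Phi>2 :: "(real \<Rightarrow> real) \<Rightarrow> (real \<Rightarrow> real)"
    and u0 :: "real \<Rightarrow> complex" and v0 :: "real \<Rightarrow> real"
    and U :: "nat \<Rightarrow> 'w \<Rightarrow> real \<Rightarrow> complex" and V :: "nat \<Rightarrow> 'w \<Rightarrow> real \<Rightarrow> real"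
  assumes "L > 0" and "T > 0" and "N > 0"
    and "prob_space M"
    and "cylindrical_wiener L M e1 B1" and "cylindrical_wiener L M e2 B2"
    and "indep_wiener M B1 B2"
    and "u0 \<in> Hm L 1" and "v0 \<in> Hm L 1"
    and "\<gamma>1 * \<gamma>2 > 0"
    and "hilbert_schmidt_H1 L \<Phi>1" and "hilbert_schmidt_H1 L \<Phi>2"
    and "splitting_CN_scheme L M T N \<gamma>1 \<gamma>2 \<beta> e1 B1 e2 B2 \<Phi>1 \<Phi>2 u0 v0 U V"
  shows "\<forall>n\<le>N.
      integrable M (\<lambda>\<omega>. \<integral>x. (cmod (U n \<omega> x))\<^sup>2 \<partial>Om L) \<and>
      integrable M (\<lambda>\<omega>. \<integral>x. V n \<omega> x \<partial>Om L) \<and>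
      integrable M (\<lambda>\<omega>. \<integral>x. Im (U n \<omega> x * cnj (Dx L 1 (U n \<omega>) x)) + \<gamma>1 / (2 * \<gamma>2) * (V n \<omega> x)\<^sup>2 \<partial>Om L) \<and>
      (\<integral>\<omega>. (\<integral>x. (cmod (U n \<omega> x))\<^sup>2 \<partial>Om L) \<partial>M)
        = (\<integral>\<omega>. (\<integral>x. (cmod (U 0 \<omega> x))\<^sup>2 \<partial>Om L) \<partial>M) + hs_norm_sq L e1 \<Phi>1 * (real n * (T / real N)) \<and>
      (\<integral>\<omega>. (\<integral>x. V n \<omega> x \<partial>Om L) \<partial>M) = (\<integral>\<omega>. (\<integral>x. V 0 \<omega> x \<partial>Om L) \<partial>M) \<and>
      (\<integral>\<omega>. (\<integral>x. Im (U n \<omega> x * cnj (Dx L 1 (U n \<omega>) x)) + \<gamma>1 / (2 * \<gamma>2) * (V n \<omega> x)\<^sup>2 \<partial>Om L) \<partial>M)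
        = (\<integral>\<omega>. (\<integral>x. Im (U 0 \<omega> x * cnj (Dx L 1 (U 0 \<omega>) x)) + \<gamma>1 / (2 * \<gamma>2) * (V 0 \<omega> x)\<^sup>2 \<partial>Om L) \<partial>M)
          + (- Im (trace_adj L e1 \<Phi>1 (Dx L 1 \<circ> \<Phi>1))
             + \<gamma>1 / (2 * \<gamma>2) * hs_norm_sq L e2 \<Phi>2) * (real n * (T / real N))"
proof -
  interpret prob_space M by fact
  note L = \<open>L > 0\<close>
  define h where "h = T / real N"
  define c where "c = \<gamma>1 / (2 * \<gamma>2)"
  define R where "R = - Im (trace_adj L e1 \<Phi>1 (Dx L 1 \<circ> \<Phi>1)) + c * hs_norm_sq L e2 \<Phi>2"
  have h: "h > 0" using \<open>T > 0\<close> \<open>N > 0\<close> by (simp add: h_def)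
  have e1: "orthonormal_basis L e1" using \<open>cylindrical_wiener L M e1 B1\<close> by (simp add: cylindrical_wiener_def)
  have UM: "U n \<in> M \<rightarrow>\<^sub>M H1_borel L" and VM: "V n \<in> M \<rightarrow>\<^sub>M H1_borel L" if "n \<le> N" for n
    using assms(13) that unfolding splitting_CN_scheme_def Let_def by blast+
  have init: "AE \<omega> in M. aeq L (U 0 \<omega>) u0 \<and> aeq L (V 0 \<omega>) v0"
    using assms(13) unfolding splitting_CN_scheme_def Let_def by blast
  have step: "\<exists>U' V' X1 X2.
      U' \<in> wiener_filtration M B1 B2 (real n * h) \<rightarrow>\<^sub>M H1_borel L \<and>
      V' \<in> wiener_filtration M B1 B2 (real n * h) \<rightarrow>\<^sub>M H1_borel L \<and>
      (AE \<omega> in M. CN_step L \<gamma>1 \<gamma>2 \<beta> h (U n \<omega>) (V n \<omega>) (U' \<omega>) (V' \<omega>)) \<and>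
      wiener_increment L M e1 B1 \<Phi>1 (real n * h) (real (Suc n) * h) X1 \<and>
      wiener_increment L M e2 B2 \<Phi>2 (real n * h) (real (Suc n) * h) X2 \<and>
      (AE \<omega> in M. aeq L (U (Suc n) \<omega>) (\<lambda>x. U' \<omega> x + X1 \<omega> x)) \<and>
      (AE \<omega> in M. aeq L (V (Suc n) \<omega>) (\<lambda>x. V' \<omega> x + X2 \<omega> x))" if "n < N" for n
    using assms(13) that unfolding splitting_CN_scheme_def Let_def h_def by blast
  have UH: "U n \<omega> \<in> Hm L 1" and VH: "V n \<omega> \<in> Hm L 1" if "n \<le> N" "\<omega> \<in> space M" for n \<omega>
    using measurable_space[OF UM[OF that(1)] that(2)] measurable_space[OF VM[OF that(1)] that(2)] by auto
  \<comment> \<open>mass of \<open>U\<close>, mean of \<open>V\<close>, and combined momentum along the scheme\<close>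
  define A where "A n \<omega> = (l2norm L (U n \<omega>))\<^sup>2" for n \<omega>
  define I where "I n \<omega> = (\<integral>x. V n \<omega> x \<partial>Om L)" for n \<omega>
  define P where "P n \<omega> = momentum_form L (U n \<omega>) (U n \<omega>) + c * (l2norm L (V n \<omega>))\<^sup>2" for n \<omega>
  have all: "integrable M (A n) \<and> integrable M (\<lambda>\<omega>. l2norm L (V n \<omega>)) \<and> integrable M (I n) \<and> integrable M (P n)
      \<and> expectation (A n) = expectation (A 0) + hs_norm_sq L e1 \<Phi>1 * (real n * h)
      \<and> expectation (I n) = expectation (I 0) \<and> expectation (P n) = expectation (P 0) + R * (real n * h)"
    if "n \<le> N" for n
    using that
  proof (induction n)
    case 0
    interpret lR: weak_h1_form L "l2ip L :: (real \<Rightarrow> real) \<Rightarrow> _" by (rule weak_h1_form_l2ip[OF L])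
    interpret m: weak_h1_form L "momentum_form L" by (rule weak_h1_form_momentum[OF L])
    have nC: "(l2norm L :: (real \<Rightarrow> complex) \<Rightarrow> real) \<in> borel_measurable (H1_borel L)"
      and nR: "(l2norm L :: (real \<Rightarrow> real) \<Rightarrow> real) \<in> borel_measurable (H1_borel L)"
      by (rule l2norm_H1_measurable[OF L e1])+
    note [measurable] = measurable_compose[OF UM[OF 0] nC] measurable_compose[OF VM[OF 0] nR]
      measurable_compose[OF UM[OF 0] m.measurable_quadratic[OF e1]]
    have "(\<lambda>\<omega>. l2ip L (\<lambda>_. 1) (V 0 \<omega>)) \<in> borel_measurable M"
      by (rule measurable_compose[OF VM[OF 0] lR.measurable_left[OF e1 const_Hm1[OF L]]])
    then have I0: "I 0 \<in> borel_measurable M" unfolding I_def[abs_def] l2ip_def by simp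
    have ae: "AE \<omega> in M. A 0 \<omega> = (l2norm L u0)\<^sup>2 \<and> l2norm L (V 0 \<omega>) = l2norm L v0
        \<and> I 0 \<omega> = (\<integral>x. v0 x \<partial>Om L) \<and> P 0 \<omega> = momentum_form L u0 u0 + c * (l2norm L v0)\<^sup>2"
      using init AE_space
    proof eventually_elim
      fix \<omega> assume eq: "aeq L (U 0 \<omega>) u0 \<and> aeq L (V 0 \<omega>) v0" and \<omega>: "\<omega> \<in> space M"
      note H = UH[OF 0 \<omega>] VH[OF 0 \<omega>]
      have "l2norm L (U 0 \<omega>) = l2norm L u0" "l2norm L (V 0 \<omega>) = l2norm L v0"
        using l2norm_cong[OF Hm_L2 Hm_L2] H assms(8,9) eq by blast+
      moreover have "I 0 \<omega> = (\<integral>x. v0 x \<partial>Om L)"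
        unfolding I_def using eq by (intro aeq_integral L2_meas Hm_L2[OF H(2)] Hm_L2[OF assms(9)]) auto
      moreover have "momentum_form L (U 0 \<omega>) (U 0 \<omega>) = momentum_form L u0 u0"
        using eq by (intro m.quadratic_cong H assms(8)) auto
      ultimately show "A 0 \<omega> = (l2norm L u0)\<^sup>2 \<and> l2norm L (V 0 \<omega>) = l2norm L v0
        \<and> I 0 \<omega> = (\<integral>x. v0 x \<partial>Om L) \<and> P 0 \<omega> = momentum_form L u0 u0 + c * (l2norm L v0)\<^sup>2"
        by (simp add: A_def P_def)
    qed
    have const: "integrable M f" if "f \<in> borel_measurable M" "AE \<omega> in M. f \<omega> = k" for f :: "'w \<Rightarrow> real" and k
      by (rule integrable_cong_AE_imp[of M "\<lambda>_. k"]) (use that in \<open>auto elim: eventually_mono\<close>)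
    have "integrable M (A 0)" "integrable M (\<lambda>\<omega>. l2norm L (V 0 \<omega>))" "integrable M (P 0)"
      by (rule const; use ae in \<open>(simp add: A_def[abs_def] P_def[abs_def]; fail) | (eventually_elim, blast)\<close>)+
    moreover have "integrable M (I 0)"
      by (rule const[OF I0]) (use ae in \<open>eventually_elim, blast\<close>)
    ultimately show ?case by simp
  next
    case (Suc n)
    then have n: "n < N" "n \<le> N" "Suc n \<le> N" by auto
    obtain U' V' X1 X2 where
      U': "U' \<in> wiener_filtration M B1 B2 (real n * h) \<rightarrow>\<^sub>M H1_borel L" and
      V': "V' \<in> wiener_filtration M B1 B2 (real n * h) \<rightarrow>\<^sub>M H1_borel L" and
      CN: "AE \<omega> in M. CN_step L \<gamma>1 \<gamma>2 \<beta> h (U n \<omega>) (V n \<omega>) (U' \<omega>) (V' \<omega>)" and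
      X1: "wiener_increment L M e1 B1 \<Phi>1 (real n * h) (real (Suc n) * h) X1" and
      X2: "wiener_increment L M e2 B2 \<Phi>2 (real n * h) (real (Suc n) * h) X2" and
      U1: "AE \<omega> in M. aeq L (U (Suc n) \<omega>) (\<lambda>x. U' \<omega> x + X1 \<omega> x)" and
      V1: "AE \<omega> in M. aeq L (V (Suc n) \<omega>) (\<lambda>x. V' \<omega> x + X2 \<omega> x)"
      using step[OF n(1)] by blast
    have t: "0 \<le> real n * h" "real n * h < real (Suc n) * h" using h by (simp_all add: distrib_right)
    have dt: "real (Suc n) * h - real n * h = h" by (simp add: distrib_right)
    have CN: "AE \<omega> in M. CN_step L \<gamma>1 \<gamma>2 \<beta> (real (Suc n) * h - real n * h) (U n \<omega>) (V n \<omega>) (U' \<omega>) (V' \<omega>)"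
      unfolding dt by (rule CN)
    note IH = Suc.IH[OF n(2)]
    note S = splitting_step[OF L assms(5,6,7,10,11,12) t UM[OF n(2)] VM[OF n(2)] U' V' CN X1 X2
        UM[OF n(3)] VM[OF n(3)] U1 V1, folded c_def, unfolded dt, folded R_def A_def I_def P_def]
    have i: "integrable M (A n)" "integrable M (\<lambda>\<omega>. l2norm L (V n \<omega>))" "integrable M (I n)" "integrable M (P n)"
      using IH by blast+
    note S = S[OF i]
    have mult: "x = x0 + r * (real (Suc n) * h)" if "x = y + r * h" "y = x0 + r * (real n * h)" for x x0 y r :: real
      using that by (simp add: algebra_simps)
    show ?case
      using S(1-4,6) mult[OF S(5)] mult[OF S(7)] IH by auto
  qed
  have massE: "(\<integral>x. (cmod (U n \<omega> x))\<^sup>2 \<partial>Om L) = A n \<omega>" for n \<omega>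
    unfolding A_def l2norm_sq_eq ..
  have PE: "(\<integral>x. Im (U n \<omega> x * cnj (Dx L 1 (U n \<omega>) x)) + \<gamma>1 / (2 * \<gamma>2) * (V n \<omega> x)\<^sup>2 \<partial>Om L) = P n \<omega>"
    if "n \<le> N" "\<omega> \<in> space M" for n \<omega>
    unfolding P_def c_def by (rule momentum_energy_eq[OF UH[OF that] VH[OF that]])
  have Pint: "integrable M (\<lambda>\<omega>. \<integral>x. Im (U n \<omega> x * cnj (Dx L 1 (U n \<omega>) x)) + \<gamma>1 / (2 * \<gamma>2) * (V n \<omega> x)\<^sup>2 \<partial>Om L)
      \<longleftrightarrow> integrable M (P n)"
    and Pexp: "expectation (\<lambda>\<omega>. \<integral>x. Im (U n \<omega> x * cnj (Dx L 1 (U n \<omega>) x)) + \<gamma>1 / (2 * \<gamma>2) * (V n \<omega> x)\<^sup>2 \<partial>Om L)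
      = expectation (P n)" if "n \<le> N" for n
    using PE[OF that] by (auto intro!: Bochner_Integration.integrable_cong Bochner_Integration.integral_cong)
  show ?thesis
  proof (intro allI impI)
    fix n assume n: "n \<le> N"
    show "integrable M (\<lambda>\<omega>. \<integral>x. (cmod (U n \<omega> x))\<^sup>2 \<partial>Om L) \<and>
      integrable M (\<lambda>\<omega>. \<integral>x. V n \<omega> x \<partial>Om L) \<and>
      integrable M (\<lambda>\<omega>. \<integral>x. Im (U n \<omega> x * cnj (Dx L 1 (U n \<omega>) x)) + \<gamma>1 / (2 * \<gamma>2) * (V n \<omega> x)\<^sup>2 \<partial>Om L) \<and>
      (\<integral>\<omega>. (\<integral>x. (cmod (U n \<omega> x))\<^sup>2 \<partial>Om L) \<partial>M)
        = (\<integral>\<omega>. (\<integral>x. (cmod (U 0 \<omega> x))\<^sup>2 \<partial>Om L) \<partial>M) + hs_norm_sq L e1 \<Phi>1 * (real n * (T / real N)) \<and>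
      (\<integral>\<omega>. (\<integral>x. V n \<omega> x \<partial>Om L) \<partial>M) = (\<integral>\<omega>. (\<integral>x. V 0 \<omega> x \<partial>Om L) \<partial>M) \<and>
      (\<integral>\<omega>. (\<integral>x. Im (U n \<omega> x * cnj (Dx L 1 (U n \<omega>) x)) + \<gamma>1 / (2 * \<gamma>2) * (V n \<omega> x)\<^sup>2 \<partial>Om L) \<partial>M)
        = (\<integral>\<omega>. (\<integral>x. Im (U 0 \<omega> x * cnj (Dx L 1 (U 0 \<omega>) x)) + \<gamma>1 / (2 * \<gamma>2) * (V 0 \<omega> x)\<^sup>2 \<partial>Om L) \<partial>M)
          + (- Im (trace_adj L e1 \<Phi>1 (Dx L 1 \<circ> \<Phi>1))
             + \<gamma>1 / (2 * \<gamma>2) * hs_norm_sq L e2 \<Phi>2) * (real n * (T / real N))"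
      unfolding Pint[OF n] Pexp[OF n] Pexp[OF le0] massE
      using all[OF n] unfolding h_def R_def c_def I_def[abs_def] by simp
  qed
qed

end
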